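(* Let $1<s<3/2$ and $z\in\mathbb{D}$. For $N\ge1$ and $X\in\mathrm{Conf}(\mathbb{D})$ define the $A^2(\mathbb{D})$-valued linear statistic \[ \Theta_N^{(s,z)}(X)=\sum_{x\in X\cap\mathcal{U}_N(z)}e^{-sd_{\mathrm{h}}(z,x)}K(\cdot,x),\qquad \mathcal{U}_N(z)=\{x\in\mathbb{D}:d_{\mathrm{h}}(z,x)<N\}. \] Then, $\mathbb{P}_K$-almost surely, \[ \lim_{N\to\infty}\frac{\|\Theta_N^{(s,z)}\|_{A^2(\mathbb{D})}^2}{\mathbb{E}\big[\|\Theta_N^{(s,z)}\|_{A^2(\mathbb{D})}^2\big]}=1, \] where $\mathbb{E}$ denotes expectation with respect to $\mathbb{P}_K$.
   Context: $\mathbb{D}$ is the open unit disk, $\mathrm{d}\mu=\frac{1}{\pi}\mathrm{d}x\,\mathrm{d}y$, $A^2(\mathbb{D})$ is the Hilbert space of holomorphic functions on $\mathbb{D}$ square integrable w.r.t. $\mu$, with reproducing kernel $K(z,w)=(1-z\overline{w})^{-2}$. $\mathrm{Conf}(\mathbb{D})$ is the space of locally finite subsets of $\mathbb{D}$; $\mathbb{P}_K$ is the determinantal point process on $\mathbb{D}$ whose $k$-point correlation functions w.r.t. $\mu^{\otimes k}$ are $\det[K(x_i,x_j)]_{1\le i,j\le k}$. The hyperbolic distance is $d_{\mathrm{h}}(z,x)=\log\frac{1+|\varphi_z(x)|}{1-|\varphi_z(x)|}$, $\varphi_z(x)=\frac{z-x}{1-\overline{z}x}$. *)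

theory Defs
  imports "HOL-Probability.Probability"
begin

definition disk :: "complex set" where
  "disk = ball 0 1"

definition bergK :: "complex \<Rightarrow> complex \<Rightarrow> complex" where
  "bergK z w = 1 / (1 - z * cnj w)^2"

definition mobius :: "complex \<Rightarrow> complex \<Rightarrow> complex" where
  "mobius z x = (z - x) / (1 - cnj z * x)"

definition dh :: "complex \<Rightarrow> complex \<Rightarrow> real" where
  "dh z x = ln ((1 + cmod (mobius z x)) / (1 - cmod (mobius z x)))"

definition hypball :: "real \<Rightarrow> complex \<Rightarrow> complex set" where
  "hypball N z = {x \<in> disk. dh z x < N}"

definition Theta :: "real \<Rightarrow> complex \<Rightarrow> real \<Rightarrow> complex set \<Rightarrow> complex \<Rightarrow> complex" where
  "Theta s z N X = (\<lambda>w. \<Sum>x\<in>X \<inter> hypball N z. complex_of_real (exp (- s * dh z x)) * bergK w x)"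

text \<open>Squared norm in A^2(D) with d\<mu> = dx dy / pi.\<close>
definition A2_norm_sq :: "(complex \<Rightarrow> complex) \<Rightarrow> real" where
  "A2_norm_sq f = (LINT w:disk|lborel. (cmod (f w))^2) / pi"

definition Conf :: "complex set set" where
  "Conf = {X. X \<subseteq> disk \<and> (\<forall>C. compact C \<and> C \<subseteq> disk \<longrightarrow> finite (X \<inter> C))}"

definition relcpt :: "complex set \<Rightarrow> bool" where
  "relcpt B \<longleftrightarrow> B \<in> sets borel \<and> closure B \<subseteq> disk"

definition Conf_space :: "complex set measure" where
  "Conf_space = sigma Conf {{X \<in> Conf. card (X \<inter> B) = n} | B n. relcpt B}"

definition detk :: "nat \<Rightarrow> (nat \<Rightarrow> nat \<Rightarrow> complex) \<Rightarrow> complex" where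
  "detk k M = (\<Sum>p | p permutes {..<k}. of_int (sign p) * (\<Prod>i<k. M i (p i)))"

text \<open>P is the determinantal point process P_K: its k-point correlation functions
  w.r.t. mu^k are det[K(x_i,x_j)], i.e. for pairwise disjoint relatively compact Borel
  sets B_0..B_{k-1}, E[prod_i N(B_i)] = int_{B_0 x..x B_{k-1}} det[K(x_i,x_j)] d mu^k.\<close>
definition is_DPP_K :: "complex set measure \<Rightarrow> bool" where
  "is_DPP_K P \<longleftrightarrow> prob_space P \<and> sets P = sets Conf_space \<and>
     (\<forall>k B. (\<forall>i<k. relcpt (B i)) \<and> disjoint_family_on B {..<k} \<longrightarrow>
        (\<integral>\<^sup>+ X. (\<Prod>i<k. ennreal (real (card (X \<inter> B i)))) \<partial>P)
        = ennreal ((1 / pi) ^ k) *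
          (\<integral>\<^sup>+ x \<in> PiE {..<k} B. ennreal (Re (detk k (\<lambda>i j. bergK (x i) (x j))))
              \<partial>(PiM {..<k} (\<lambda>_. lborel))))"

end

theory Submission
  imports Defs
begin

text \<open>
  Write \<open>w = 1 - \<bar>x\<bar>\<^sup>2\<close>, \<open>rho = K(x, x) = w powr (-2)\<close> and \<open>f = exp (- s * dh z x)\<close>, which is comparable to
  \<open>w powr s\<close>. By the reproducing property the squared norm is \<open>Q = \<Sum> f x * f y * Re K(x, y)\<close> over
  pairs of points in the hyperbolic ball. Its expectation is bounded below by the variance of the
  vector-valued statistic, which for a projection kernel dominates the flow of \<open>\<bar>K\<bar>\<^sup>2\<close> through the
  boundary of the ball; this is of order \<open>exp ((3 - 2 * s) * N)\<close>.

  For the variance, \<open>Q\<close> is split into its diagonal and off-diagonal part, and the second moment of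
  the latter into 4-, 3- and 2-point terms. The difference between the 4-point determinant and the
  product of the two 2-point determinants is a sum over permutations that mix the two pairs, hence
  at most a constant times \<open>\<Sum> \<bar>K(x\<^sub>a, x\<^sub>b)\<bar>\<^sup>2 * rho x\<^sub>c * rho x\<^sub>d\<close> with \<open>a, c\<close> from one pair and \<open>b, d\<close> from
  the other. The bound \<open>\<integral> w powr (s - 2) * \<bar>K(x, y)\<bar> \<le> C * w powr (- (3 - s) / 2)\<close> then shows
  that the variance is \<open>O (exp ((9/2 - 3 * s) * N))\<close>. The ratio of the variance to the squared
  expectation decays like \<open>exp ((s - 3/2) * N)\<close>, which is summable, and almost sure convergence follows.
\<close>

section \<open>The Bergman kernel on the disk\<close>

text \<open>The hypotheses on \<open>s\<close> enter through exponents: \<open>1 < s\<close> makes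
  \<open>t powr ((s - 3) / 2)\<close> integrable at 0, and \<open>s < 3/2\<close> makes the decay
  exponent \<open>s - 3/2\<close> of the normalised variance negative. This leaves room for lossy
  estimates: the majorant of the kernel operator and the variance bound only have to produce a ratio
  that is summable along the integers. Two obstacles shape the argument. \<open>is_DPP_K\<close>
  prescribes mixed moments of counts in disjoint sets only, whereas the squared statistics sum
  continuous functions over tuples of distinct points; the passage between the two, with the
  integrability it requires, has to be built. And the expected squared norm contains terms of both
  signs, so its growth is not visible term by term: positivity of the kernel discards the squared
  norm of the mean vector, and what remains is compared with the mass of
  \<open>\<bar>K\<bar>\<^sup>2\<close> that leaves the ball.\<close>

definition area_on :: "complex set \<Rightarrow> complex measure" where
  "area_on U = density lborel (\<lambda>w. ennreal (indicator U w / pi))"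

text \<open>\<open>area_on U\<close> is a density over the whole plane, not a restricted space. Its
  sigma-algebra is therefore \<open>borel\<close> for every \<open>U\<close>, and one measurability
  fact serves the disk and all of its subsets.\<close>

lemma sets_area_on [simp, measurable_cong]: "sets (area_on U) = sets borel"
  by (simp add: area_on_def)

lemma space_area_on [simp]: "space (area_on U) = UNIV"
  by (simp add: area_on_def)

lemma disk_borel [measurable]: "disk \<in> sets borel"
  by (simp add: disk_def)

lemma borel_measurable_cnj [measurable]: "cnj \<in> borel_measurable borel"
  by (intro borel_measurable_continuous_onI continuous_intros)

section \<open>Rotation invariance and radial integration for the area measure\<close>

text \<open>A rotation maps balls to balls of the same radius, whose Lebesgue measure is known.
  Vitali's covering theorem fills an open box with countably many disjoint balls up to a null set,
  so the rotated measure agrees with \<open>lborel\<close> on boxes and hence everywhere.\<close>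

lemma lborel_rotation:
  fixes \<omega> :: complex
  assumes "cmod \<omega> = 1"
  shows "distr lborel borel (\<lambda>w. \<omega> * w) = lborel"
proof (rule lborel_eqI[symmetric])
  fix l u :: complex
  assume *: "\<And>b. b \<in> Basis \<Longrightarrow> l \<bullet> b \<le> u \<bullet> b"
  let ?S = "box l u" and ?M = "distr lborel borel (\<lambda>w. \<omega> * w)"
  have w0: "\<omega> \<noteq> 0" using assms by auto
  define K where "K = {(a::complex, r::real). 0 < r \<and> ball a r \<subseteq> ?S}"
  have cov: "\<exists>i. i \<in> K \<and> x \<in> ball (fst i) (snd i) \<and> snd i < d" if "x \<in> ?S" "0 < d" for x d
  proof -
    obtain e where e: "0 < e" "ball x e \<subseteq> ?S" using open_box \<open>x \<in> ?S\<close> openE by blast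
    have "ball x (min e (d/2)) \<subseteq> ?S" using e by auto
    then show ?thesis using e that by (intro exI[of _ "(x, min e (d/2))"]) (auto simp: K_def)
  qed
  obtain C where C: "countable C" "C \<subseteq> K"
     "pairwise (\<lambda>i j. disjnt (ball (fst i) (snd i)) (ball (fst j) (snd j))) C"
     "negligible (?S - (\<Union>i \<in> C. ball (fst i) (snd i)))"
    using Vitali_covering_theorem_balls[of ?S K fst snd] cov by auto
  let ?V = "\<Union>i\<in>C. ball (fst i) (snd i)"
  have VS: "?V \<subseteq> ?S" using C(2) by (fastforce simp: K_def)
  have Vb: "?V \<in> sets borel" by (intro borel_open) auto
  have pre: "(\<lambda>w. \<omega> * w) -` A = (\<lambda>w. inverse \<omega> * w) ` A" for A
  proof (intro set_eqI iffI)
    fix w assume "w \<in> (\<lambda>w. \<omega> * w) -` A"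
    moreover have "w = inverse \<omega> * (\<omega> * w)" using w0 by (simp add: field_simps)
    ultimately show "w \<in> (\<lambda>w. inverse \<omega> * w) ` A" by blast
  qed (use w0 in \<open>auto simp: field_simps\<close>)
  \<comment> \<open>The preimage under the rotation is the image under the inverse rotation, a
    differentiable map, so it is still negligible.\<close>
  have neg0: "emeasure M (?S - ?V) = 0" if "M = ?M \<or> M = lborel" for M
  proof -
    have b: "?S - ?V \<in> sets borel" using Vb by auto
    have "negligible ((\<lambda>w. inverse \<omega> * w) ` (?S - ?V))"
      by (rule negligible_differentiable_image_negligible[OF _ C(4)])
         (auto intro!: differentiable_on_mult differentiable_on_const differentiable_on_ident)
    then have "(\<lambda>w. inverse \<omega> * w) ` (?S - ?V) \<in> null_sets lebesgue"
      by (simp add: negligible_iff_null_sets)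
    moreover have "(\<lambda>w. \<omega> * w) -` (?S - ?V) \<inter> space borel \<in> sets borel"
      by (rule measurable_sets[of _ borel borel]) (use b in auto)
    ultimately have "emeasure ?M (?S - ?V) = 0"
      using b by (subst emeasure_distr) (auto simp: pre null_sets_def)
    moreover have "emeasure lborel (?S - ?V) = 0"
      using C(4) b by (simp add: negligible_iff_null_sets null_sets_def)
    ultimately show ?thesis using that by auto
  qed
  have ballM: "emeasure ?M (ball a r) = emeasure lborel (ball a r)" if "r > 0" for a r
  proof -
    have "(\<lambda>w. \<omega> * w) -` ball a r = ball (a / \<omega>) r"
    proof -
      have "dist a (\<omega> * w) = dist (a / \<omega>) w" for w
      proof -
        have "a - \<omega> * w = \<omega> * (a / \<omega> - w)" using w0 by (simp add: field_simps)
        then show ?thesis using assms by (simp add: dist_norm norm_mult)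
      qed
      then show ?thesis by auto
    qed
    then show ?thesis using that by (subst emeasure_distr) (auto simp: emeasure_ball)
  qed
  have "emeasure ?M ?S = emeasure ?M ?V + emeasure ?M (?S - ?V)"
    using VS Vb by (subst plus_emeasure) (auto simp: Un_absorb1)
  also have "emeasure ?M ?V = (\<integral>\<^sup>+i. emeasure ?M (ball (fst i) (snd i)) \<partial>count_space C)"
    using C(1,3) by (intro emeasure_UN_countable) (auto simp: disjoint_family_on_def pairwise_def disjnt_def)
  also have "\<dots> = (\<integral>\<^sup>+i. emeasure lborel (ball (fst i) (snd i)) \<partial>count_space C)"
    using C(2) by (intro nn_integral_cong ballM) (auto simp: K_def)
  also have "\<dots> = emeasure lborel ?V"
    using C(1,3) by (intro emeasure_UN_countable[symmetric]) (auto simp: disjoint_family_on_def pairwise_def disjnt_def)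
  also have "emeasure lborel ?V + emeasure ?M (?S - ?V) = emeasure lborel ?V + emeasure lborel (?S - ?V)"
    using neg0 by simp
  also have "\<dots> = emeasure lborel ?S"
    using VS Vb by (subst plus_emeasure) (auto simp: Un_absorb1)
  finally show "emeasure ?M ?S = (\<Prod>b\<in>Basis. (u - l) \<bullet> b)"
    using * by (simp add: emeasure_lborel_box_eq)
qed simp

lemma nn_integral_area_on:
  assumes "f \<in> borel_measurable borel" "U \<in> sets borel"
  shows "(\<integral>\<^sup>+w. f w \<partial>area_on U) = (\<integral>\<^sup>+w. ennreal (indicator U w / pi) * f w \<partial>lborel)"
  using assms unfolding area_on_def by (subst nn_integral_density) auto

lemma emeasure_area_on:
  assumes [measurable]: "A \<in> sets borel" "U \<in> sets borel"
  shows "emeasure (area_on U) A = emeasure lborel (U \<inter> A) / ennreal pi"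
proof -
  have "emeasure (area_on U) A = (\<integral>\<^sup>+w. indicator A w \<partial>area_on U)" by simp
  also have "\<dots> = (\<integral>\<^sup>+w. indicator (U \<inter> A) w / ennreal pi \<partial>lborel)"
    by (subst nn_integral_area_on) (auto intro!: nn_integral_cong simp: indicator_def divide_ennreal[symmetric])
  also have "\<dots> = emeasure lborel (U \<inter> A) / ennreal pi"
    by (simp add: nn_integral_divide)
  finally show ?thesis .
qed

lemma emeasure_area_disk_ball:
  assumes "0 \<le> r" "r \<le> 1"
  shows "emeasure (area_on disk) (ball 0 r) = ennreal (r\<^sup>2)"
proof -
  have "disk \<inter> ball 0 r = ball 0 r" using assms by (auto simp: disk_def)
  then show ?thesis using assms
    by (simp add: emeasure_area_on emeasure_ball divide_ennreal eval_unit_ball_vol)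
qed

lemma prob_space_area_disk: "prob_space (area_on disk)"
proof (rule prob_spaceI)
  have "emeasure (area_on disk) (space (area_on disk)) = emeasure (area_on disk) (ball 0 1)"
    by (simp add: emeasure_area_on disk_def)
  then show "emeasure (area_on disk) (space (area_on disk)) = 1"
    using emeasure_area_disk_ball[of 1] by simp
qed

text \<open>The centred disk of radius \<open>r\<close> has mass \<open>r\<^sup>2\<close>, so the
  defect \<open>1 - \<bar>w\<bar>\<^sup>2\<close> is uniformly distributed on the unit interval.
  Every radial integral over the disk thereby becomes an integral in one real variable, without
  polar coordinates.\<close>

lemma distr_area_disk_defect:
  "distr (area_on disk) borel (\<lambda>w. 1 - (cmod w)\<^sup>2) = uniform_measure lborel {0..1::real}"
proof (rule cdf_unique)
  interpret prob_space "area_on disk" by (rule prob_space_area_disk)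
  show "real_distribution (distr (area_on disk) borel (\<lambda>w. 1 - (cmod w)\<^sup>2))"
    unfolding real_distribution_def real_distribution_axioms_def by (auto intro!: prob_space_distr)
  show "real_distribution (uniform_measure lborel {0..1::real})"
    unfolding real_distribution_def real_distribution_axioms_def by (auto intro!: prob_space_uniform_measure)
  show "cdf (distr (area_on disk) borel (\<lambda>w. 1 - (cmod w)\<^sup>2)) = cdf (uniform_measure lborel {0..1::real})"
  proof
    fix x :: real
    have L: "cdf (distr (area_on disk) borel (\<lambda>w. 1 - (cmod w)\<^sup>2)) x = 
        measure (area_on disk) {w. 1 - (cmod w)\<^sup>2 \<le> x}"
      unfolding cdf_def by (subst measure_distr) (auto simp: vimage_def)
    have R: "cdf (uniform_measure lborel {0..1::real}) x = measure lborel ({0..1} \<inter> {..x})"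
      unfolding cdf_def by (subst measure_uniform_measure) auto
    \<comment> \<open>Clamping \<open>x\<close> to the unit interval gives one formula for both
      distribution functions, valid for every real \<open>x\<close>.\<close>
    define c where "c = max 0 (min 1 x)"
    have R2: "measure lborel ({0..1} \<inter> {..x}) = c"
    proof (cases "x < 0")
      case True then have "{0..1} \<inter> {..x} = {}" by auto
      then show ?thesis using True by (simp add: c_def)
    next
      case False
      then have "{0..1} \<inter> {..x} = {0..min 1 x}" by auto
      then show ?thesis using False by (simp add: c_def)
    qed
    have ball: "prob (ball 0 (sqrt (1-c))) = 1 - c"
      using emeasure_area_disk_ball[of "sqrt (1-c)"] by (simp add: c_def measure_def)
    have "prob {w. 1 - (cmod w)\<^sup>2 \<le> x} = prob (space (area_on disk) - ball 0 (sqrt (1-c)))"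
    proof (rule finite_measure_eq_AE)
      have "AE w in area_on disk. w \<in> disk"
        unfolding area_on_def by (subst AE_density) (auto simp: indicator_def)
      then show "AE w in area_on disk. (w \<in> {w. 1 - (cmod w)\<^sup>2 \<le> x}) = (w \<in> space (area_on disk) - ball 0 (sqrt (1 - c)))"
      proof eventually_elim
        case (elim w)
        then have w: "(cmod w)\<^sup>2 < 1" by (simp add: disk_def power_less_one_iff abs_square_less_1)
        have "w \<in> ball 0 (sqrt (1-c)) \<longleftrightarrow> (cmod w)\<^sup>2 < 1 - c"
          by (simp add: real_less_rsqrt real_sqrt_less_iff flip: real_sqrt_less_iff[of "(cmod w)\<^sup>2"])
        then show ?case using w by (auto simp: c_def)
      qed
    qed auto
    also have "\<dots> = c" using ball by (subst prob_compl) auto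
    finally show "cdf (distr (area_on disk) borel (\<lambda>w. 1 - (cmod w)\<^sup>2)) x = cdf (uniform_measure lborel {0..1::real}) x"
      using L R R2 by simp
  qed
qed

lemma nn_integral_area_disk_radial:
  assumes [measurable]: "h \<in> borel_measurable borel"
  shows "(\<integral>\<^sup>+w. h (1 - (cmod w)\<^sup>2) \<partial>area_on disk) = (\<integral>\<^sup>+t. h t * indicator {0..1} t \<partial>lborel)"
proof -
  have "(\<integral>\<^sup>+w. h (1 - (cmod w)\<^sup>2) \<partial>area_on disk) = (\<integral>\<^sup>+t. h t \<partial>distr (area_on disk) borel (\<lambda>w. 1 - (cmod w)\<^sup>2))"
    by (subst nn_integral_distr) auto
  also have "\<dots> = (\<integral>\<^sup>+t. h t * indicator {0..1} t \<partial>lborel)"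
    unfolding distr_area_disk_defect by (subst nn_integral_uniform_measure) (auto simp: divide_ennreal_def)
  finally show ?thesis .
qed

lemma integral_area_disk_rotation:
  fixes f :: "complex \<Rightarrow> 'a :: {banach, second_countable_topology}"
  assumes [measurable]: "f \<in> borel_measurable borel" and "cmod \<omega> = 1"
  shows "(\<integral>w. f (\<omega> * w) \<partial>area_on disk) = (\<integral>w. f w \<partial>area_on disk)"
proof -
  have "(\<integral>w. f w \<partial>area_on disk) = (\<integral>w. (indicator disk w / pi) *\<^sub>R f w \<partial>lborel)"
    unfolding area_on_def by (subst integral_density) auto
  also have "\<dots> = (\<integral>w. (indicator disk w / pi) *\<^sub>R f w \<partial>distr lborel borel (\<lambda>w. \<omega> * w))"
    by (simp add: lborel_rotation assms)
  also have "\<dots> = (\<integral>w. (indicator disk (\<omega> * w) / pi) *\<^sub>R f (\<omega> * w) \<partial>lborel)"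
    by (subst integral_distr) auto
  also have "\<dots> = (\<integral>w. (indicator disk w / pi) *\<^sub>R f (\<omega> * w) \<partial>lborel)"
    using assms by (intro Bochner_Integration.integral_cong) (auto simp: disk_def indicator_def norm_mult)
  also have "\<dots> = (\<integral>w. f (\<omega> * w) \<partial>area_on disk)"
    unfolding area_on_def by (subst integral_density) auto
  finally show ?thesis by simp
qed

text \<open>Rotation by \<open>\<theta>\<close> multiplies the integrand by
  \<open>cis ((n - m) * \<theta>)\<close>. With \<open>\<theta> = pi / (n - m)\<close> this factor
  is -1, so the integral equals its own negative.\<close>

lemma integral_area_disk_orthogonal:
  fixes \<Phi> :: "real \<Rightarrow> complex"
  assumes [measurable]: "\<Phi> \<in> borel_measurable borel" and "n \<noteq> m"
  shows "(\<integral>w. \<Phi> (cmod w) * w ^ n * cnj w ^ m \<partial>area_on disk) = 0"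
proof -
  define \<theta> where "\<theta> = pi / (real n - real m)"
  have "cis \<theta> ^ n * cnj (cis \<theta>) ^ m = cis ((real n - real m) * \<theta>)"
    unfolding cis_cnj Complex.DeMoivre cis_mult by (simp add: algebra_simps)
  also have "\<dots> = -1" using assms by (simp add: \<theta>_def)
  finally have c: "cis \<theta> ^ n * cnj (cis \<theta>) ^ m = -1" .
  have "(\<integral>w. \<Phi> (cmod w) * w ^ n * cnj w ^ m \<partial>area_on disk)
     = (\<integral>w. \<Phi> (cmod (cis \<theta> * w)) * (cis \<theta> * w) ^ n * cnj (cis \<theta> * w) ^ m \<partial>area_on disk)"
    by (rule integral_area_disk_rotation[symmetric]) auto
  also have "\<dots> = (\<integral>w. - (\<Phi> (cmod w) * w ^ n * cnj w ^ m) \<partial>area_on disk)"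
  proof (intro Bochner_Integration.integral_cong refl)
    fix w
    have "\<Phi> (cmod (cis \<theta> * w)) * (cis \<theta> * w) ^ n * cnj (cis \<theta> * w) ^ m
      = (cis \<theta> ^ n * cnj (cis \<theta>) ^ m) * (\<Phi> (cmod w) * w ^ n * cnj w ^ m)"
      by (simp add: norm_mult power_mult_distrib)
    then show "\<Phi> (cmod (cis \<theta> * w)) * (cis \<theta> * w) ^ n * cnj (cis \<theta> * w) ^ m
      = - (\<Phi> (cmod w) * w ^ n * cnj w ^ m)" by (simp only: c) simp
  qed
  also have "\<dots> = - (\<integral>w. \<Phi> (cmod w) * w ^ n * cnj w ^ m \<partial>area_on disk)"
    by (rule Bochner_Integration.integral_minus)
  finally show ?thesis by simp
qed

section \<open>Inner products of kernel functions over centred disks\<close>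

lemma bergK_sums:
  assumes "x \<in> disk" "cmod w \<le> 1"
  shows "(\<lambda>n. of_nat (Suc n) * (w * cnj x) ^ n) sums bergK w x"
proof -
  have "norm (w * cnj x) < 1"
    using assms mult_le_one[of "cmod w"] mult_right_mono[of "cmod w" 1 "cmod x"] by (auto simp: disk_def norm_mult)
  from geometric_deriv_sums[OF this] show ?thesis by (simp add: bergK_def)
qed

text \<open>The bound depends neither on \<open>k\<close> nor on \<open>w\<close>; it is the
  dominating constant whenever the kernel is replaced by a partial sum under an integral.\<close>

lemma bergK_partial_bound:
  assumes "x \<in> disk" "cmod w \<le> 1"
  shows "cmod (\<Sum>n<k. of_nat (Suc n) * (w * cnj x) ^ n) \<le> 1 / (1 - cmod x)\<^sup>2"
proof -
  have x: "norm (cmod x) < 1" using assms by (simp add: disk_def)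
  from geometric_deriv_sums[OF this] have s: "(\<lambda>n. of_nat (Suc n) * cmod x ^ n) sums (1 / (1 - cmod x)\<^sup>2)" .
  have "cmod (\<Sum>n<k. of_nat (Suc n) * (w * cnj x) ^ n) \<le> (\<Sum>n<k. of_nat (Suc n) * cmod x ^ n)"
  proof (rule order_trans[OF norm_sum sum_mono])
    fix n
    have "cmod (w * cnj x) \<le> cmod x" using assms by (simp add: norm_mult mult_left_le_one_le)
    then have "cmod (w * cnj x) ^ n \<le> cmod x ^ n" by (intro power_mono) auto
    then show "cmod (of_nat (Suc n) * (w * cnj x) ^ n) \<le> of_nat (Suc n) * cmod x ^ n"
      by (simp only: norm_mult norm_power norm_of_nat) (intro mult_left_mono, auto simp: norm_mult)
  qed
  also have "\<dots> \<le> 1 / (1 - cmod x)\<^sup>2"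
    using sum_le_suminf[of "\<lambda>n. of_nat (Suc n) * cmod x ^ n" "{..<k}"] s by (auto simp: sums_iff)
  finally show ?thesis .
qed

text \<open>In the variable \<open>t = 1 - \<bar>w\<bar>\<^sup>2\<close> this is the integral of
  \<open>(1 - t) ^ n\<close> over the interval from \<open>1 - b\<close> to 1.\<close>

lemma integral_area_disk_moment:
  assumes b: "0 \<le> b" "b \<le> 1"
  shows "(\<integral>w. indicator {w. (cmod w)\<^sup>2 < b} w * w ^ n * cnj w ^ n \<partial>area_on disk) = complex_of_real (b ^ Suc n / real (Suc n))"
proof -
  have "(\<integral>\<^sup>+w. ennreal (indicator {w. (cmod w)\<^sup>2 < b} w * ((cmod w)\<^sup>2) ^ n) \<partial>area_on disk)
     = (\<integral>\<^sup>+w. ennreal ((\<lambda>t. indicator {t. 1 - t < b} t * (1 - t) ^ n) (1 - (cmod w)\<^sup>2)) \<partial>area_on disk)"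
    by (intro nn_integral_cong) (auto simp: indicator_def)
  also have "\<dots> = (\<integral>\<^sup>+t. ennreal (indicator {t. 1 - t < b} t * (1 - t) ^ n) * indicator {0..1} t \<partial>lborel)"
    by (rule nn_integral_area_disk_radial) auto
  also have "\<dots> = (\<integral>\<^sup>+t. ennreal ((1 - t) ^ n) * indicator {1-b..1} t \<partial>lborel)"
  proof (rule nn_integral_cong_AE)
    have "AE t in lborel. t \<noteq> 1 - b" by (rule AE_lborel_singleton)
    then show "AE t in lborel. ennreal (indicator {t. 1 - t < b} t * (1 - t) ^ n) * indicator {0..1} t = ennreal ((1 - t) ^ n) * indicator {1-b..1} t"
      by eventually_elim (use b in \<open>auto simp: indicator_def\<close>)
  qed
  also have "\<dots> = ennreal (- ((1 - 1) ^ Suc n / real (Suc n)) - - ((1 - (1 - b)) ^ Suc n / real (Suc n)))"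
  proof (rule nn_integral_FTC_Icc)
    fix t :: real
    show "((\<lambda>t. - ((1 - t) ^ Suc n / real (Suc n))) has_real_derivative (1 - t) ^ n) (at t)"
      by (rule derivative_eq_intros refl | simp del: of_nat_Suc power_Suc)+
  qed (use b in auto)
  finally have nn: "(\<integral>\<^sup>+w. ennreal (indicator {w. (cmod w)\<^sup>2 < b} w * ((cmod w)\<^sup>2) ^ n) \<partial>area_on disk)
     = ennreal (b ^ Suc n / real (Suc n))" by simp
  have "(\<integral>w. indicator {w. (cmod w)\<^sup>2 < b} w * w ^ n * cnj w ^ n \<partial>area_on disk)
      = (\<integral>w. complex_of_real (indicator {w. (cmod w)\<^sup>2 < b} w * ((cmod w)\<^sup>2) ^ n) \<partial>area_on disk)"
    by (intro Bochner_Integration.integral_cong refl)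
       (simp add: power_mult_distrib[symmetric] complex_norm_square[symmetric] mult.assoc, simp add: indicator_def)
  also have "\<dots> = complex_of_real (\<integral>w. indicator {w. (cmod w)\<^sup>2 < b} w * ((cmod w)\<^sup>2) ^ n \<partial>area_on disk)"
    by (rule integral_complex_of_real)
  also have "(\<integral>w. indicator {w. (cmod w)\<^sup>2 < b} w * ((cmod w)\<^sup>2) ^ n \<partial>area_on disk) = b ^ Suc n / real (Suc n)"
    using b by (subst integral_eq_nn_integral) (auto simp only: nn, auto)
  finally show ?thesis .
qed

lemma finite_measure_area_disk: "finite_measure (area_on disk)"
  using prob_space_area_disk by (rule prob_space.finite_measure)

text \<open>Monomials stay orthogonal on the disk of squared radius \<open>b\<close>, with moments
  \<open>b ^ Suc n / Suc n\<close>. The denominator cancels one of the two coefficients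
  \<open>Suc n\<close>, and what remains is again the differentiated geometric series, now in
  \<open>b * cnj x * y\<close>. For \<open>b = 1\<close> this is the reproducing property;
  \<open>b < 1\<close> later measures how much kernel mass lies near the boundary circle.\<close>

lemma integral_area_disk_bergK_bergK:
  assumes b: "0 \<le> b" "b \<le> 1" and x: "x \<in> disk" and y: "y \<in> disk"
  shows "(\<integral>w. indicator {w. (cmod w)\<^sup>2 < b} w * bergK w x * cnj (bergK w y) \<partial>area_on disk)
     = of_real b / (1 - of_real b * cnj x * y)\<^sup>2"
proof -
  interpret finite_measure "area_on disk" by (rule finite_measure_area_disk)
  let ?I = "\<lambda>w. indicator {w. (cmod w)\<^sup>2 < b} w :: complex"
  let ?p = "\<lambda>k x w. (\<Sum>n<k. of_nat (Suc n) * (w * cnj x) ^ n) :: complex"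
  have wd: "cmod w \<le> 1" if "(cmod w)\<^sup>2 < b" for w
    using that b abs_square_less_1[of "cmod w"] by simp
  have lim: "(\<lambda>k. \<integral>w. ?I w * ?p k x w * cnj (?p k y w) \<partial>area_on disk)
     \<longlonglongrightarrow> (\<integral>w. ?I w * bergK w x * cnj (bergK w y) \<partial>area_on disk)"
  proof (rule integral_dominated_convergence[where w = "\<lambda>w. 1 / (1 - cmod x)\<^sup>2 * (1 / (1 - cmod y)\<^sup>2)"])
    show "(\<lambda>w. ?I w * bergK w x * cnj (bergK w y)) \<in> borel_measurable (area_on disk)"
      unfolding bergK_def by measurable
    show "AE w in area_on disk. (\<lambda>k. ?I w * ?p k x w * cnj (?p k y w)) \<longlonglongrightarrow> ?I w * bergK w x * cnj (bergK w y)"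
    proof (rule AE_I2)
      fix w
      show "(\<lambda>k. ?I w * ?p k x w * cnj (?p k y w)) \<longlonglongrightarrow> ?I w * bergK w x * cnj (bergK w y)"
      proof (cases "(cmod w)\<^sup>2 < b")
        case True
        then show ?thesis
          using bergK_sums[OF x wd[of w]] bergK_sums[OF y wd[of w]] unfolding sums_def
          by (intro tendsto_mult tendsto_cnj tendsto_const) auto
      qed simp
    qed
    show "AE w in area_on disk. norm (?I w * ?p k x w * cnj (?p k y w)) \<le> 1 / (1 - cmod x)\<^sup>2 * (1 / (1 - cmod y)\<^sup>2)" for k
    proof (rule AE_I2)
      fix w
      show "norm (?I w * ?p k x w * cnj (?p k y w)) \<le> 1 / (1 - cmod x)\<^sup>2 * (1 / (1 - cmod y)\<^sup>2)"
      proof (cases "(cmod w)\<^sup>2 < b")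
        case True
        have "norm (?p k x w) * norm (?p k y w) \<le> 1 / (1 - cmod x)\<^sup>2 * (1 / (1 - cmod y)\<^sup>2)"
          by (intro mult_mono bergK_partial_bound x y wd True) auto
        then show ?thesis using True by (simp only: norm_mult complex_mod_cnj) simp
      qed simp
    qed
  qed simp_all
  have int: "integrable (area_on disk) (\<lambda>w. ?I w * w ^ n * cnj w ^ m)" for n m
  proof (rule integrable_const_bound[where B=1])
    show "AE w in area_on disk. norm (?I w * w ^ n * cnj w ^ m) \<le> 1"
    proof (rule AE_I2)
      fix w show "norm (?I w * w ^ n * cnj w ^ m) \<le> 1"
        using wd[of w] by (cases "(cmod w)\<^sup>2 < b") (auto simp: norm_mult norm_power indicator_def intro!: mult_le_one power_le_one)
    qed
  qed auto
  have val: "(\<integral>w. ?I w * ?p k x w * cnj (?p k y w) \<partial>area_on disk)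
      = (\<Sum>n<k. of_real b * (of_nat (Suc n) * (of_real b * cnj x * y) ^ n))" for k
  proof -
    have "(\<integral>w. ?I w * ?p k x w * cnj (?p k y w) \<partial>area_on disk)
       = (\<integral>w. (\<Sum>n<k. \<Sum>m<k. (of_nat (Suc n) * cnj x ^ n * of_nat (Suc m) * y ^ m) * (?I w * w ^ n * cnj w ^ m)) \<partial>area_on disk)"
      by (intro Bochner_Integration.integral_cong refl)
         (simp add: sum_product sum_distrib_left power_mult_distrib mult_ac del: of_nat_Suc)
    also have "\<dots> = (\<Sum>n<k. \<Sum>m<k. (of_nat (Suc n) * cnj x ^ n * of_nat (Suc m) * y ^ m) * (\<integral>w. ?I w * w ^ n * cnj w ^ m \<partial>area_on disk))"
      using int by (simp del: of_nat_Suc)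
    also have "\<dots> = (\<Sum>n<k. \<Sum>m<k. if m = n then (of_nat (Suc n) * cnj x ^ n * of_nat (Suc n) * y ^ n) * complex_of_real (b ^ Suc n / real (Suc n)) else 0)"
    proof (intro sum.cong refl)
      fix n m
      have "(\<integral>w. ?I w * w ^ n * cnj w ^ m \<partial>area_on disk) = 0" if "n \<noteq> m"
      proof -
        have "(\<integral>w. ?I w * w ^ n * cnj w ^ m \<partial>area_on disk) = (\<integral>w. (\<lambda>r. if r\<^sup>2 < b then 1 else 0) (cmod w) * w ^ n * cnj w ^ m \<partial>area_on disk)"
          by (intro Bochner_Integration.integral_cong) (auto simp: indicator_def)
        also have "\<dots> = 0" by (rule integral_area_disk_orthogonal[OF _ that]) auto
        finally show ?thesis .
      qed
      then show "(of_nat (Suc n) * cnj x ^ n * of_nat (Suc m) * y ^ m) * (\<integral>w. ?I w * w ^ n * cnj w ^ m \<partial>area_on disk) =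
         (if m = n then (of_nat (Suc n) * cnj x ^ n * of_nat (Suc n) * y ^ n) * complex_of_real (b ^ Suc n / real (Suc n)) else 0)"
        using integral_area_disk_moment[OF b, of n] by (auto simp del: of_nat_Suc)
    qed
    also have "\<dots> = (\<Sum>n<k. of_real b * (of_nat (Suc n) * (of_real b * cnj x * y) ^ n))"
    proof (intro sum.cong refl)
      fix n assume "n \<in> {..<k}"
      moreover have "complex_of_nat (Suc n) \<noteq> 0" by (simp only: of_nat_eq_0_iff)
      ultimately show "(\<Sum>m<k. if m = n then (of_nat (Suc n) * cnj x ^ n * of_nat (Suc n) * y ^ n) * complex_of_real (b ^ Suc n / real (Suc n)) else 0)
        = of_real b * (of_nat (Suc n) * (of_real b * cnj x * y) ^ n)"
        by (simp add: power_mult_distrib del: of_nat_Suc)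
    qed
    finally show ?thesis .
  qed
  have "norm (of_real b * cnj x * y) < 1"
  proof -
    have "b * (cmod x * cmod y) \<le> cmod x * cmod y" using b by (intro mult_left_le_one_le) auto
    also have "\<dots> \<le> cmod x * 1" using y by (intro mult_left_mono) (auto simp: disk_def)
    also have "\<dots> < 1" using x by (simp add: disk_def)
    finally show ?thesis using b by (simp add: norm_mult mult.assoc)
  qed
  from geometric_deriv_sums[OF this]
  have "(\<lambda>n. of_real b * (of_nat (Suc n) * (of_real b * cnj x * y) ^ n)) sums (of_real b * (1 / (1 - of_real b * cnj x * y)\<^sup>2))"
    by (rule sums_mult)
  then have "(\<lambda>k. \<integral>w. ?I w * ?p k x w * cnj (?p k y w) \<partial>area_on disk) \<longlonglongrightarrow> of_real b * (1 / (1 - of_real b * cnj x * y)\<^sup>2)"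
    unfolding sums_def val .
  from LIMSEQ_unique[OF lim this] show ?thesis by simp
qed

section \<open>Integrals of the kernel against radial weights\<close>

lemma one_minus_norm_pos:
  assumes "x \<in> disk" shows "0 < 1 - (cmod x)\<^sup>2"
  using assms abs_square_less_1[of "cmod x"] by (simp add: disk_def)

lemma AE_area_on: "U \<in> sets borel \<Longrightarrow> AE w in area_on U. w \<in> U"
  unfolding area_on_def by (subst AE_density) (auto simp: indicator_def)

lemma nn_integral_powr_unit:
  assumes "a > -1"
  shows "(\<integral>\<^sup>+t. ennreal (t powr a) * indicator {0..1} t \<partial>lborel) = ennreal (1 / (a + 1))"
proof -
  have "(\<integral>\<^sup>+t. ennreal (t powr a) * indicator {0..1} t \<partial>lborel) = (\<integral>\<^sup>+t. ennreal (indicator {0..1} t * t powr a) \<partial>lborel)"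
    by (intro nn_integral_cong) (auto simp: indicator_def)
  also have "\<dots> = ennreal (1 powr (a + 1) / (a + 1))"
    using has_integral_powr_from_0[OF assms, of 1]
    by (intro nn_integral_has_integral_lebesgue) auto
  finally show ?thesis by simp
qed

text \<open>With \<open>u = x * cnj w\<close> the Poisson kernel is \<open>Re ((1 + u) / (1 - u)) = 1 + 2 * Re (\<Sum>n\<ge>1. u ^ n)\<close>,
  and only the constant term survives integration against a radial weight.\<close>
lemma integral_area_disk_poisson:
  assumes x: "x \<in> disk" and int: "integrable (area_on disk) (\<lambda>w. \<Phi> (cmod w) :: real)"
    and [measurable]: "\<Phi> \<in> borel_measurable borel"
  shows "integrable (area_on disk) (\<lambda>w. \<Phi> (cmod w) * ((1 - (cmod (x * cnj w))\<^sup>2) / (cmod (1 - x * cnj w))\<^sup>2))"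
    and "(\<integral>w. \<Phi> (cmod w) * ((1 - (cmod (x * cnj w))\<^sup>2) / (cmod (1 - x * cnj w))\<^sup>2) \<partial>area_on disk) = (\<integral>w. \<Phi> (cmod w) \<partial>area_on disk)"
proof -
  let ?u = "\<lambda>w. x * cnj w"
  let ?g = "\<lambda>w. complex_of_real (\<Phi> (cmod w)) * ((1 + ?u w) / (1 - ?u w))"
  \<comment> \<open>Twice the partial sum minus 1 is 1 plus twice the terms of positive degree, the
    partial expansion of \<open>(1 + u) / (1 - u)\<close>. The upper index \<open>Suc k\<close>
    guarantees that the constant term is always present.\<close>
  let ?p = "\<lambda>k w. complex_of_real (\<Phi> (cmod w)) * (2 * (\<Sum>n<Suc k. ?u w ^ n) - 1)"
  have u: "cmod (?u w) \<le> cmod x" if "w \<in> disk" for w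
    using that by (auto simp: norm_mult disk_def intro: mult_right_le_one_le)
  have x1: "cmod x < 1" using x by (simp add: disk_def)
  have AEd: "AE w in area_on disk. w \<in> disk" by (rule AE_area_on) simp
  have bd: "norm (?p k w) \<le> \<bar>\<Phi> (cmod w)\<bar> * (2 / (1 - cmod x) + 1)" if "w \<in> disk" for k w
  proof -
    have "norm (\<Sum>n<Suc k. ?u w ^ n) \<le> (\<Sum>n<Suc k. cmod x ^ n)"
      using u[OF that] by (intro order_trans[OF norm_sum sum_mono]) (auto simp: norm_power intro!: power_mono)
    also have "\<dots> \<le> (\<Sum>n. cmod x ^ n)"
      using x1 by (intro sum_le_suminf summable_geometric) auto
    also have "\<dots> = 1 / (1 - cmod x)" using x1 by (simp add: suminf_geometric)
    finally have "norm (2 * (\<Sum>n<Suc k. ?u w ^ n) - 1) \<le> 2 / (1 - cmod x) + 1"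
      by (intro order_trans[OF norm_triangle_ineq4]) (simp add: norm_mult del: sum.lessThan_Suc)
    then show ?thesis by (simp only: norm_mult norm_of_real) (intro mult_left_mono, auto)
  qed
  have lim: "(\<lambda>k. ?p k w) \<longlonglongrightarrow> ?g w" if "w \<in> disk" for w
  proof -
    have u1: "cmod (?u w) < 1" using u[OF that] x1 by simp
    have "(\<lambda>k. \<Sum>n<Suc k. ?u w ^ n) \<longlonglongrightarrow> 1 / (1 - ?u w)"
      using geometric_sums[OF u1] unfolding sums_def by (rule LIMSEQ_Suc)
    then have "(\<lambda>k. ?p k w) \<longlonglongrightarrow> complex_of_real (\<Phi> (cmod w)) * (2 * (1 / (1 - ?u w)) - 1)"
      by (intro tendsto_intros)
    moreover have "2 * (1 / (1 - ?u w)) - 1 = (1 + ?u w) / (1 - ?u w)"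
    proof -
      have "1 - ?u w \<noteq> 0" using u1 by auto
      then show ?thesis by (simp add: field_simps)
    qed
    ultimately show ?thesis by simp
  qed
  have dom: "integrable (area_on disk) (\<lambda>w. \<bar>\<Phi> (cmod w)\<bar> * (2 / (1 - cmod x) + 1))"
    using int by auto
  note dc = integral_dominated_convergence[where w = "\<lambda>w. \<bar>\<Phi> (cmod w)\<bar> * (2 / (1 - cmod x) + 1)" and s = ?p and f = ?g and M = "area_on disk"]
  note dc2 = integrable_dominated_convergence[where w = "\<lambda>w. \<bar>\<Phi> (cmod w)\<bar> * (2 / (1 - cmod x) + 1)" and s = ?p and f = ?g and M = "area_on disk"]
  have intg: "integrable (area_on disk) ?g"
    by (rule dc2[OF _ _ dom]) (measurable, (rule eventually_mono[OF AEd], erule lim bd)+)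
  have L: "(\<lambda>k. \<integral>w. ?p k w \<partial>area_on disk) \<longlonglongrightarrow> (\<integral>w. ?g w \<partial>area_on disk)"
    by (rule dc[OF _ _ dom]) (measurable, (rule eventually_mono[OF AEd], erule lim bd)+)
  have intn: "integrable (area_on disk) (\<lambda>w. complex_of_real (\<Phi> (cmod w)) * w ^ 0 * cnj w ^ n)" for n
  proof (rule Bochner_Integration.integrable_bound[OF int])
    show "AE w in area_on disk. norm (complex_of_real (\<Phi> (cmod w)) * w ^ 0 * cnj w ^ n) \<le> norm (\<Phi> (cmod w))"
      using AEd by eventually_elim (auto simp: norm_mult norm_power disk_def intro!: mult_right_le_one_le power_le_one)
  qed auto
  have val: "(\<integral>w. ?p k w \<partial>area_on disk) = complex_of_real (\<integral>w. \<Phi> (cmod w) \<partial>area_on disk)" for k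
  proof -
    have "(\<integral>w. ?p k w \<partial>area_on disk) = (\<integral>w. (complex_of_real (\<Phi> (cmod w)) + (\<Sum>n<k. (2 * x ^ Suc n) * (complex_of_real (\<Phi> (cmod w)) * w ^ 0 * cnj w ^ Suc n))) \<partial>area_on disk)"
      unfolding sum.lessThan_Suc_shift
      by (intro Bochner_Integration.integral_cong refl)
         (simp add: algebra_simps sum_distrib_left power_mult_distrib)
    also have "\<dots> = (\<integral>w. complex_of_real (\<Phi> (cmod w)) \<partial>area_on disk) + (\<Sum>n<k. (2 * x ^ Suc n) * (\<integral>w. complex_of_real (\<Phi> (cmod w)) * w ^ 0 * cnj w ^ Suc n \<partial>area_on disk))"
      using int intn by (subst Bochner_Integration.integral_add) (auto simp del: power_Suc power_0)
    also have "(\<Sum>n<k. (2 * x ^ Suc n) * (\<integral>w. complex_of_real (\<Phi> (cmod w)) * w ^ 0 * cnj w ^ Suc n \<partial>area_on disk)) = 0"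
      by (intro sum.neutral ballI) (subst integral_area_disk_orthogonal[where \<Phi> = "\<lambda>r. complex_of_real (\<Phi> r)"], auto)
    finally show ?thesis by simp
  qed
  have gval: "(\<integral>w. ?g w \<partial>area_on disk) = complex_of_real (\<integral>w. \<Phi> (cmod w) \<partial>area_on disk)"
    using LIMSEQ_unique[OF L[unfolded val] tendsto_const] by simp
  have Reg: "\<Phi> (cmod w) * ((1 - (cmod (x * cnj w))\<^sup>2) / (cmod (1 - x * cnj w))\<^sup>2) = Re (?g w)" for w
  proof -
    have "Re ((1 + v) / (1 - v)) = (1 - (cmod v)\<^sup>2) / (cmod (1 - v))\<^sup>2" for v
      by (simp add: Re_divide cmod_power2) (simp add: power2_eq_square algebra_simps)
    moreover have "Re (complex_of_real a * c) = a * Re c" for a c by simp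
    ultimately show ?thesis by (simp only:)
  qed
  show "integrable (area_on disk) (\<lambda>w. \<Phi> (cmod w) * ((1 - (cmod (x * cnj w))\<^sup>2) / (cmod (1 - x * cnj w))\<^sup>2))"
    unfolding Reg using intg by (rule integrable_Re)
  show "(\<integral>w. \<Phi> (cmod w) * ((1 - (cmod (x * cnj w))\<^sup>2) / (cmod (1 - x * cnj w))\<^sup>2) \<partial>area_on disk) = (\<integral>w. \<Phi> (cmod w) \<partial>area_on disk)"
    unfolding Reg using intg gval by simp
qed

text \<open>\<open>\<bar>K(x, y)\<bar>\<close> is the Poisson kernel divided by the radial factor
  \<open>1 - \<bar>x\<bar>\<^sup>2 * \<bar>y\<bar>\<^sup>2\<close>, so the angular dependence
  integrates out exactly. With \<open>e = 1 - \<bar>x\<bar>\<^sup>2\<close> and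
  \<open>t = 1 - \<bar>y\<bar>\<^sup>2\<close> there remains the integral of
  \<open>t powr (s - 2) / (e + (1 - e) * t)\<close>. A geometric mean below the denominator
  separates \<open>e\<close> from \<open>t\<close> and leaves \<open>t powr ((s - 3) / 2)\<close>,
  whose integral is \<open>2 / (s - 1)\<close>.\<close>

lemma nn_integral_bergK_powr_le:
  assumes s: "1 < s" "s < 3" and x: "x \<in> disk"
  shows "(\<integral>\<^sup>+y. ennreal ((1 - (cmod y)\<^sup>2) powr (s - 2) * cmod (bergK x y)) \<partial>area_on disk)
     \<le> ennreal (2 / (s - 1) * (1 - (cmod x)\<^sup>2) powr (- ((3 - s) / 2)))"
proof -
  define e where "e = 1 - (cmod x)\<^sup>2"
  have e: "0 < e" "e \<le> 1" using one_minus_norm_pos[OF x] by (auto simp: e_def)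
  define \<Psi> where "\<Psi> = (\<lambda>t. t powr (s - 2) / (1 - (cmod x)\<^sup>2 * (1 - t)))"
  define \<Phi> where "\<Phi> = (\<lambda>r. \<Psi> (1 - r\<^sup>2))"
  have [measurable]: "\<Psi> \<in> borel_measurable borel" "\<Phi> \<in> borel_measurable borel"
    by (auto simp: \<Psi>_def \<Phi>_def)
  have \<Psi>le: "\<Psi> t \<le> e powr (- ((3 - s) / 2)) * t powr ((s - 3) / 2)" if "0 < t" "t \<le> 1" for t
  proof -
    have eq: "1 - (cmod x)\<^sup>2 * (1 - t) = e + (1 - e) * t" by (simp add: e_def algebra_simps)
    \<comment> \<open>The exponents \<open>(3 - s) / 2\<close> and \<open>(s - 1) / 2\<close> are
      nonnegative and add up to 1, so the left side is at most the maximum of \<open>e\<close> and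
      \<open>t\<close>; the right side is at least this maximum.\<close>
    have ge: "e powr ((3 - s) / 2) * t powr ((s - 1) / 2) \<le> e + (1 - e) * t"
    proof (cases "t \<le> e")
      case True
      have "e powr ((3 - s) / 2) * t powr ((s - 1) / 2) \<le> e powr ((3 - s) / 2) * e powr ((s - 1) / 2)"
        using True that s by (intro mult_left_mono powr_mono2) auto
      also have "\<dots> = e" using e by (simp add: powr_add[symmetric] field_simps)
      finally show ?thesis using e that by (smt (verit) mult_nonneg_nonneg)
    next
      case False
      have "e powr ((3 - s) / 2) * t powr ((s - 1) / 2) \<le> t powr ((3 - s) / 2) * t powr ((s - 1) / 2)"
        using False that s e by (intro mult_right_mono powr_mono2) auto
      also have "\<dots> = t" using that by (simp add: powr_add[symmetric] field_simps)
      also have "\<dots> \<le> e + (1 - e) * t" using e that mult_left_le[of t e] by (simp add: algebra_simps)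
      finally show ?thesis .
    qed
    have "\<Psi> t \<le> t powr (s - 2) / (e powr ((3 - s) / 2) * t powr ((s - 1) / 2))"
      unfolding \<Psi>_def eq using ge e that by (intro divide_left_mono mult_pos_pos) (auto intro!: add_pos_nonneg)
    also have "\<dots> = e powr (- ((3 - s) / 2)) * t powr ((s - 2) - (s - 1) / 2)"
      unfolding powr_minus powr_diff by (simp add: field_simps)
    also have "(s - 2) - (s - 1) / 2 = (s - 3) / 2" by (simp add: field_simps)
    finally show ?thesis .
  qed
  have \<Phi>0: "0 \<le> \<Phi> (cmod w)" if "w \<in> disk" for w
    using one_minus_norm_pos[OF that] e by (auto simp: \<Phi>_def \<Psi>_def e_def intro!: divide_nonneg_nonneg mult_le_one)
  have nn\<Phi>: "(\<integral>\<^sup>+w. ennreal (\<Phi> (cmod w)) \<partial>area_on disk) \<le> ennreal (2 / (s - 1) * e powr (- ((3 - s) / 2)))"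
  proof -
    have "(\<integral>\<^sup>+w. ennreal (\<Phi> (cmod w)) \<partial>area_on disk) = (\<integral>\<^sup>+t. ennreal (\<Psi> t) * indicator {0..1} t \<partial>lborel)"
      unfolding \<Phi>_def by (rule nn_integral_area_disk_radial) auto
    also have "\<dots> \<le> (\<integral>\<^sup>+t. ennreal (e powr (- ((3 - s) / 2))) * (ennreal (t powr ((s - 3) / 2)) * indicator {0..1} t) \<partial>lborel)"
    proof (rule nn_integral_mono)
      fix t :: real
      consider "t = 0" | "0 < t \<and> t \<le> 1" | "t \<notin> {0..1}" by fastforce
      then show "ennreal (\<Psi> t) * indicator {0..1} t \<le> ennreal (e powr (- ((3 - s) / 2))) * (ennreal (t powr ((s - 3) / 2)) * indicator {0..1} t)"
      proof cases
        case 1 then show ?thesis by (simp add: \<Psi>_def)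
      next
        case 2 then show ?thesis using \<Psi>le[of t] by (auto simp: ennreal_mult[symmetric] intro!: ennreal_leI)
      qed simp
    qed
    also have "\<dots> = ennreal (e powr (- ((3 - s) / 2))) * (\<integral>\<^sup>+t. ennreal (t powr ((s - 3) / 2)) * indicator {0..1} t \<partial>lborel)"
      by (rule nn_integral_cmult) auto
    also have "(\<integral>\<^sup>+t. ennreal (t powr ((s - 3) / 2)) * indicator {0..1} t \<partial>lborel) = ennreal (1 / ((s - 3) / 2 + 1))"
      by (rule nn_integral_powr_unit) (use s in auto)
    also have "1 / ((s - 3) / 2 + 1) = 2 / (s - 1)" by (simp add: field_simps)
    also have "ennreal (e powr (- ((3 - s) / 2))) * ennreal (2 / (s - 1)) = ennreal (2 / (s - 1) * e powr (- ((3 - s) / 2)))"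
      using s by (simp add: ennreal_mult[symmetric] mult.commute)
    finally show ?thesis .
  qed
  have AEd: "AE w in area_on disk. w \<in> disk" by (rule AE_area_on) simp
  have int: "integrable (area_on disk) (\<lambda>w. \<Phi> (cmod w))"
  proof (rule integrableI_nonneg)
    show "AE w in area_on disk. 0 \<le> \<Phi> (cmod w)" using AEd by eventually_elim (rule \<Phi>0)
    show "(\<integral>\<^sup>+w. ennreal (\<Phi> (cmod w)) \<partial>area_on disk) < \<infinity>" using nn\<Phi> by (auto simp: le_less_trans)
  qed auto
  let ?F = "\<lambda>w. \<Phi> (cmod w) * ((1 - (cmod (x * cnj w))\<^sup>2) / (cmod (1 - x * cnj w))\<^sup>2)"
  have F: "(1 - (cmod w)\<^sup>2) powr (s - 2) * cmod (bergK x w) = ?F w" if "w \<in> disk" for w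
  proof -
    have "1 - (cmod x)\<^sup>2 * (cmod w)\<^sup>2 > 0"
    proof -
      have "(cmod x)\<^sup>2 * (cmod w)\<^sup>2 \<le> (cmod x)\<^sup>2"
        using one_minus_norm_pos[OF that] by (intro mult_right_le_one_le) auto
      then show ?thesis using e by (simp add: e_def)
    qed
    then show ?thesis
      by (simp add: \<Phi>_def \<Psi>_def bergK_def norm_divide norm_power norm_mult power_mult_distrib)
  qed
  have F0: "0 \<le> ?F w" if "w \<in> disk" for w unfolding F[OF that, symmetric] by simp
  have "(\<integral>\<^sup>+y. ennreal ((1 - (cmod y)\<^sup>2) powr (s - 2) * cmod (bergK x y)) \<partial>area_on disk) = (\<integral>\<^sup>+w. ennreal (?F w) \<partial>area_on disk)"
    using AEd by (intro nn_integral_cong_AE) (auto elim!: eventually_mono simp: F)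
  also have "\<dots> = ennreal (\<integral>w. ?F w \<partial>area_on disk)"
    by (intro nn_integral_eq_integral integral_area_disk_poisson x int eventually_mono[OF AEd] F0) auto
  also have "\<dots> = ennreal (\<integral>w. \<Phi> (cmod w) \<partial>area_on disk)"
    by (subst integral_area_disk_poisson(2)[OF x int]) auto
  also have "\<dots> = (\<integral>\<^sup>+w. ennreal (\<Phi> (cmod w)) \<partial>area_on disk)"
    using AEd by (intro nn_integral_eq_integral[symmetric] int) (auto elim!: eventually_mono intro: \<Phi>0)
  also note nn\<Phi>
  finally show ?thesis by (simp add: e_def)
qed

section \<open>Pointwise estimates of the kernel\<close>

definition rho :: "complex \<Rightarrow> real" where
  "rho x = 1 / (1 - (cmod x)\<^sup>2)\<^sup>2"

lemma rho_nonneg [simp]: "0 \<le> rho x"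
  by (simp add: rho_def)

lemma borel_measurable_rho [measurable]: "rho \<in> borel_measurable borel"
  unfolding rho_def by measurable

lemma borel_measurable_bergK [measurable (raw)]:
  assumes [measurable]: "f \<in> borel_measurable M" "g \<in> borel_measurable M"
  shows "(\<lambda>x. bergK (f x) (g x)) \<in> borel_measurable M"
  unfolding bergK_def by measurable

lemma bergK_diag: "bergK x x = of_real (rho x)"
  by (simp add: bergK_def rho_def complex_norm_square[symmetric])

lemma cnj_bergK: "cnj (bergK x y) = bergK y x"
  by (simp add: bergK_def mult.commute)

lemma norm_bergK_commute: "cmod (bergK x y) = cmod (bergK y x)"
  by (subst cnj_bergK[symmetric]) simp

text \<open>Dropping \<open>\<bar>x - y\<bar>\<^sup>2\<close> gives the Cauchy-Schwarz inequality of
  the kernel; dividing by the left side gives the formula for 1 minus the squared modulus of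
  \<open>mobius\<close>.\<close>

lemma one_minus_norm_mult:
  "(cmod (1 - x * cnj y))\<^sup>2 = (1 - (cmod x)\<^sup>2) * (1 - (cmod y)\<^sup>2) + (cmod (x - y))\<^sup>2"
  by (simp add: cmod_power2) (simp add: power2_eq_square algebra_simps)

lemma norm_bergK_le:
  assumes "x \<in> disk" "y \<in> disk"
  shows "(cmod (bergK x y))\<^sup>2 \<le> rho x * rho y"
proof -
  have p: "0 < (1 - (cmod x)\<^sup>2) * (1 - (cmod y)\<^sup>2)"
    using assms by (intro mult_pos_pos one_minus_norm_pos)
  have "((1 - (cmod x)\<^sup>2) * (1 - (cmod y)\<^sup>2))\<^sup>2 \<le> ((cmod (1 - x * cnj y))\<^sup>2)\<^sup>2"
    using p by (intro power_mono) (auto simp: one_minus_norm_mult)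
  moreover have "(cmod (bergK x y))\<^sup>2 = 1 / ((cmod (1 - x * cnj y))\<^sup>2)\<^sup>2"
    by (simp add: bergK_def norm_divide norm_power power_divide)
  moreover have "rho x * rho y = 1 / ((1 - (cmod x)\<^sup>2) * (1 - (cmod y)\<^sup>2))\<^sup>2"
    by (simp add: rho_def power_mult_distrib)
  ultimately show ?thesis using p
    by (simp only:) (rule divide_left_mono, auto intro!: mult_pos_pos)
qed

lemma one_minus_norm_mult_ge:
  assumes "x \<in> disk" "y \<in> disk"
  shows "1 - cmod x * cmod y \<ge> (1 - (cmod x)\<^sup>2) / 2"
proof -
  have "cmod x * cmod y \<le> cmod x * 1" using assms by (intro mult_left_mono) (auto simp: disk_def)
  moreover have "0 \<le> (1 - cmod x)\<^sup>2" by simp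
  ultimately show ?thesis by (simp add: power2_eq_square field_simps)
qed

text \<open>Both defects are at most \<open>2 * d\<close> with
  \<open>d = 1 - \<bar>x\<bar> * \<bar>y\<bar>\<close>, and the kernel is at most
  \<open>1 / d\<^sup>2\<close>. The power of the defect of \<open>y\<close> is absorbed into
  \<open>d\<close>, and since \<open>s - 2\<close> is not positive, \<open>d\<close> can be
  exchanged for the defect of \<open>x\<close>. This is the pointwise companion of the integral
  bound, for places where no integration is left to spend.\<close>

lemma norm_bergK_powr_le:
  assumes "x \<in> disk" "y \<in> disk" "0 \<le> s" "s \<le> 2"
  shows "(1 - (cmod y)\<^sup>2) powr s * cmod (bergK x y) \<le> 4 * (1 - (cmod x)\<^sup>2) powr (s - 2)"
proof -
  define d where "d = 1 - cmod x * cmod y"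
  have dx: "(1 - (cmod x)\<^sup>2) / 2 \<le> d" and dy: "(1 - (cmod y)\<^sup>2) / 2 \<le> d"
    using one_minus_norm_mult_ge[OF assms(1,2)] one_minus_norm_mult_ge[OF assms(2,1)]
    by (auto simp: d_def mult.commute)
  note p = one_minus_norm_pos[OF assms(1)] one_minus_norm_pos[OF assms(2)]
  have d: "0 < d" using dx p by simp
  have "d \<le> cmod (1 - x * cnj y)"
    using norm_triangle_ineq2[of 1 "x * cnj y"] by (simp add: d_def norm_mult)
  then have "cmod (bergK x y) \<le> 1 / d\<^sup>2"
    using d by (auto simp: bergK_def norm_divide norm_power intro!: divide_left_mono power_mono mult_pos_pos zero_less_power)
  moreover have "(1 - (cmod y)\<^sup>2) powr s \<le> (2 * d) powr s"
    using dy p assms by (intro powr_mono2) auto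
  ultimately have "(1 - (cmod y)\<^sup>2) powr s * cmod (bergK x y) \<le> (2 * d) powr s * (1 / d\<^sup>2)"
    by (intro mult_mono) auto
  also have "\<dots> = 4 * (2 * d) powr (s - 2)"
    using d by (simp add: powr_diff powr_numeral power_mult_distrib)
  also have "\<dots> \<le> 4 * (1 - (cmod x)\<^sup>2) powr (s - 2)"
    using dx p assms by (intro mult_left_mono powr_mono2') auto
  finally show ?thesis .
qed

lemma integral_area_disk_norm_bergK:
  assumes b: "0 \<le> b" "b \<le> 1" and x: "x \<in> disk"
  shows "(\<integral>w. indicator {w. (cmod w)\<^sup>2 < b} w * (cmod (bergK x w))\<^sup>2 \<partial>area_on disk) = b / (1 - b * (cmod x)\<^sup>2)\<^sup>2"
proof -
  have "complex_of_real (\<integral>w. indicator {w. (cmod w)\<^sup>2 < b} w * (cmod (bergK x w))\<^sup>2 \<partial>area_on disk)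
     = (\<integral>w. complex_of_real (indicator {w. (cmod w)\<^sup>2 < b} w * (cmod (bergK x w))\<^sup>2) \<partial>area_on disk)"
    by (rule integral_complex_of_real[symmetric])
  also have "\<dots> = (\<integral>w. indicator {w. (cmod w)\<^sup>2 < b} w * bergK w x * cnj (bergK w x) \<partial>area_on disk)"
    by (intro Bochner_Integration.integral_cong refl)
       (simp add: mult.assoc complex_norm_square[symmetric] norm_bergK_commute[of x], simp add: indicator_def)
  also have "\<dots> = of_real b / (1 - of_real b * cnj x * x)\<^sup>2"
    by (rule integral_area_disk_bergK_bergK[OF b x x])
  also have "\<dots> = complex_of_real (b / (1 - b * (cmod x)\<^sup>2)\<^sup>2)"
    by (simp add: mult.assoc mult.commute[of "cnj x"] complex_norm_square[symmetric])
  finally show ?thesis by (simp only: of_real_eq_iff)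
qed

lemma integral_area_on:
  fixes f :: "complex \<Rightarrow> 'a :: {banach, second_countable_topology}"
  assumes "U \<subseteq> disk" and [measurable]: "U \<in> sets borel" "f \<in> borel_measurable borel"
  shows "(\<integral>x. f x \<partial>area_on U) = (\<integral>x. indicator U x *\<^sub>R f x \<partial>area_on disk)"
  using assms(1) unfolding area_on_def
  by (subst (1 2) integral_density) (auto intro!: Bochner_Integration.integral_cong simp: indicator_def)

lemma nn_integral_area_on_mono:
  assumes "U \<subseteq> V" and [measurable]: "U \<in> sets borel" "V \<in> sets borel" "f \<in> borel_measurable borel"
  shows "(\<integral>\<^sup>+x. f x \<partial>area_on U) \<le> (\<integral>\<^sup>+x. f x \<partial>area_on V)"
  using assms(1) by (subst (1 2) nn_integral_area_on) (auto intro!: nn_integral_mono mult_right_mono ennreal_leI divide_right_mono simp: indicator_def)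

lemma finite_measure_area_on:
  assumes "U \<subseteq> disk" "U \<in> sets borel" shows "finite_measure (area_on U)"
proof (rule finite_measureI)
  interpret D: prob_space "area_on disk" by (rule prob_space_area_disk)
  have "emeasure (area_on U) UNIV \<le> emeasure (area_on disk) UNIV"
    using nn_integral_area_on_mono[OF assms(1) assms(2) disk_borel, of "\<lambda>_. 1"] by simp
  then show "emeasure (area_on U) (space (area_on U)) \<noteq> \<infinity>"
    using D.emeasure_space_1 by (auto simp: top_unique)
qed

lemma norm_bergK_bound:
  assumes x: "x \<in> disk" and w: "w \<in> disk"
  shows "cmod (bergK w x) \<le> 1 / (1 - cmod x)\<^sup>2"
proof -
  have w': "cmod w \<le> 1" using w by (simp add: disk_def)
  have "(\<lambda>k. cmod (\<Sum>n<k. of_nat (Suc n) * (w * cnj x) ^ n)) \<longlonglongrightarrow> cmod (bergK w x)"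
    using bergK_sums[OF x w'] unfolding sums_def by (rule tendsto_norm)
  then show ?thesis
    by (rule Lim_bounded[of _ _ 0]) (intro allI impI bergK_partial_bound[OF x w'])
qed

lemma nn_integral_area_disk_norm_bergK:
  assumes x: "x \<in> disk"
  shows "(\<integral>\<^sup>+w. ennreal ((cmod (bergK x w))\<^sup>2) \<partial>area_on disk) = ennreal (rho x)"
proof -
  interpret finite_measure "area_on disk" by (rule finite_measure_area_disk)
  have AEd: "AE w in area_on disk. w \<in> disk" by (rule AE_area_on) simp
  have "integrable (area_on disk) (\<lambda>w. (cmod (bergK x w))\<^sup>2)"
  proof (rule integrable_const_bound[where B = "(1 / (1 - cmod x)\<^sup>2)\<^sup>2"])
    show "AE w in area_on disk. norm ((cmod (bergK x w))\<^sup>2) \<le> (1 / (1 - cmod x)\<^sup>2)\<^sup>2"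
      using AEd
    proof eventually_elim
      case (elim w)
      from norm_bergK_bound[OF x elim]
      show ?case by (simp only: norm_bergK_commute[of x] real_norm_def abs_power2) (intro power_mono, auto)
    qed
  qed auto
  then have "(\<integral>\<^sup>+w. ennreal ((cmod (bergK x w))\<^sup>2) \<partial>area_on disk) = ennreal (\<integral>w. (cmod (bergK x w))\<^sup>2 \<partial>area_on disk)"
    by (intro nn_integral_eq_integral) auto
  also have "(\<integral>w. (cmod (bergK x w))\<^sup>2 \<partial>area_on disk) = (\<integral>w. indicator {w. (cmod w)\<^sup>2 < 1} w * (cmod (bergK x w))\<^sup>2 \<partial>area_on disk)"
    using AEd by (intro integral_cong_AE) (auto elim!: eventually_mono dest!: one_minus_norm_pos simp: indicator_def)
  also have "\<dots> = rho x"
    using integral_area_disk_norm_bergK[of 1 x] x by (simp add: rho_def)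
  finally show ?thesis .
qed

section \<open>Hyperbolic distance compared with the distance to the boundary\<close>

text \<open>With \<open>m\<close> the modulus of \<open>mobius z x\<close>, \<open>exp (- dh z x) =
  (1 - m) / (1 + m) = (1 - m\<^sup>2) / (1 + m)\<^sup>2\<close>. Here \<open>1 - m\<^sup>2\<close>
  is the product of the defects of \<open>z\<close> and \<open>x\<close> over
  \<open>q = \<bar>1 - cnj z * x\<bar>\<^sup>2\<close>, and \<open>q\<close> lies between
  \<open>(1 - \<bar>z\<bar>)\<^sup>2\<close> and \<open>(1 + \<bar>z\<bar>)\<^sup>2\<close>; these
  extremes produce \<open>A\<close> and \<open>1 / A\<close>. The 4 comes from
  \<open>(1 + m)\<^sup>2 \<le> 4\<close>.\<close>

lemma exp_dh_bounds:
  assumes z: "z \<in> disk" and x: "x \<in> disk" and A: "A = (1 + cmod z) / (1 - cmod z)"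
  shows "(1 - (cmod x)\<^sup>2) / (4 * A) \<le> exp (- dh z x)" "exp (- dh z x) \<le> A * (1 - (cmod x)\<^sup>2)"
    "cmod (mobius z x) < 1"
proof -
  define m where "m = cmod (mobius z x)"
  have z1: "cmod z < 1" and x1: "cmod x < 1" using z x by (auto simp: disk_def)
  have A1: "0 < A" using z1 by (auto simp: A intro!: divide_pos_pos add_pos_nonneg)
  have zx: "cmod z * cmod x \<le> cmod z" using x1 by (intro mult_left_le) auto
  have lo: "1 - cmod z \<le> cmod (1 - cnj z * x)"
    using norm_triangle_ineq2[of 1 "cnj z * x"] zx by (simp add: norm_mult)
  have hi: "cmod (1 - cnj z * x) \<le> 1 + cmod z"
    using norm_triangle_ineq4[of 1 "cnj z * x"] zx by (simp add: norm_mult)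
  define q where "q = (cmod (1 - cnj z * x))\<^sup>2"
  have q: "0 < q" "(1 - cmod z)\<^sup>2 \<le> q" "q \<le> (1 + cmod z)\<^sup>2"
    using lo hi z1 by (auto simp: q_def intro!: power_mono)
  have id: "1 - m\<^sup>2 = (1 - (cmod z)\<^sup>2) * (1 - (cmod x)\<^sup>2) / q"
  proof -
    have "q = (1 - (cmod x)\<^sup>2) * (1 - (cmod z)\<^sup>2) + (cmod (z - x))\<^sup>2"
      using one_minus_norm_mult[of x z] by (simp add: q_def mult.commute norm_minus_commute)
    moreover have "m\<^sup>2 = (cmod (z - x))\<^sup>2 / q"
      by (simp add: m_def mobius_def norm_divide power_divide q_def)
    ultimately show ?thesis using q by (simp add: field_simps)
  qed
  note pz = one_minus_norm_pos[OF z] and px = one_minus_norm_pos[OF x]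
  have "0 < 1 - m\<^sup>2" unfolding id using q pz px by (intro divide_pos_pos mult_pos_pos)
  then have m: "0 \<le> m" "m < 1" using abs_square_less_1[of m] by (auto simp: m_def)
  then show "cmod (mobius z x) < 1" by (simp add: m_def)
  have ex: "exp (- dh z x) = (1 - m\<^sup>2) / (1 + m)\<^sup>2"
  proof -
    have "exp (- dh z x) = (1 - m) / (1 + m)"
      using m by (simp add: dh_def m_def[symmetric] exp_minus)
    also have "\<dots> = (1 - m\<^sup>2) / (1 + m)\<^sup>2"
    proof -
      have "1 - m\<^sup>2 = (1 - m) * (1 + m)" by (simp add: power2_eq_square algebra_simps)
      then show ?thesis using m by (simp add: power2_eq_square)
    qed
    finally show ?thesis .
  qed
  have z2: "1 - (cmod z)\<^sup>2 = (1 - cmod z) * (1 + cmod z)" by (simp add: power2_eq_square algebra_simps)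
  have up: "1 - m\<^sup>2 \<le> A * (1 - (cmod x)\<^sup>2)"
  proof -
    have "(1 - (cmod z)\<^sup>2) * (1 - (cmod x)\<^sup>2) / q \<le> (1 - (cmod z)\<^sup>2) * (1 - (cmod x)\<^sup>2) / (1 - cmod z)\<^sup>2"
      using q pz px z1 by (intro divide_left_mono mult_nonneg_nonneg mult_pos_pos) auto
    also have "\<dots> = A * (1 - (cmod x)\<^sup>2)" using z1 unfolding z2 A by (simp add: power2_eq_square)
    finally show ?thesis unfolding id .
  qed
  have dn: "(1 - (cmod x)\<^sup>2) / A \<le> 1 - m\<^sup>2"
  proof -
    have "(1 - (cmod x)\<^sup>2) / A = (1 - (cmod z)\<^sup>2) * (1 - (cmod x)\<^sup>2) / (1 + cmod z)\<^sup>2"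
    proof -
      have "1 + cmod z \<noteq> 0" using norm_ge_zero[of z] by linarith
      then show ?thesis using z1 unfolding z2 A by (simp add: power2_eq_square)
    qed
    also have "\<dots> \<le> (1 - (cmod z)\<^sup>2) * (1 - (cmod x)\<^sup>2) / q"
      using q pz px z1 by (intro divide_left_mono mult_nonneg_nonneg mult_pos_pos) (auto intro: less_le_trans)
    finally show ?thesis unfolding id .
  qed
  have m4: "1 \<le> (1 + m)\<^sup>2" "(1 + m)\<^sup>2 \<le> 4"
    using m power_mono[of "1 + m" 2 2] by (auto simp: one_le_power)
  show "exp (- dh z x) \<le> A * (1 - (cmod x)\<^sup>2)"
  proof -
    have "(1 - m\<^sup>2) / (1 + m)\<^sup>2 \<le> (1 - m\<^sup>2) / 1"
      using m4 \<open>0 < 1 - m\<^sup>2\<close> by (intro divide_left_mono) auto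
    then show ?thesis using up ex by simp
  qed
  show "(1 - (cmod x)\<^sup>2) / (4 * A) \<le> exp (- dh z x)"
  proof -
    have "(1 - m\<^sup>2) / 4 \<le> (1 - m\<^sup>2) / (1 + m)\<^sup>2"
      using m4 \<open>0 < 1 - m\<^sup>2\<close> by (intro divide_left_mono) auto
    moreover have "(1 - (cmod x)\<^sup>2) / (4 * A) \<le> (1 - m\<^sup>2) / 4"
      using divide_right_mono[OF dn, of 4] by (simp add: mult.commute)
    ultimately show ?thesis unfolding ex by (rule order_trans[rotated])
  qed
qed

section \<open>Sums over distinct tuples of points\<close>

text \<open>The truncation at 0 matches the \<open>ennreal\<close> coercion in \<^const>\<open>is_DPP_K\<close>; this way
  nonnegativity of the determinants is needed only for \<open>k \<le> 2\<close>.\<close>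
definition corr :: "nat \<Rightarrow> (nat \<Rightarrow> complex) \<Rightarrow> real" where
  "corr k x = max 0 (Re (detk k (\<lambda>i j. bergK (x i) (x j))))"

text \<open>The integral of \<open>F\<close> against the factorial power of the point set
  \<open>Y\<close>: correlation functions describe tuples of distinct points only. Tuples are
  functions on \<open>{..<k}\<close> so that they live in the same space as the points of
  \<open>PiM\<close>.\<close>

definition distinct_sum :: "nat \<Rightarrow> ((nat \<Rightarrow> complex) \<Rightarrow> real) \<Rightarrow> complex set \<Rightarrow> real" where
  "distinct_sum k F Y = (\<Sum>t\<in>PiE {..<k} (\<lambda>_. Y). if inj_on t {..<k} then F t else 0)"

section \<open>Locally finite configurations and relatively compact sets\<close>

lemma Conf_space_props:
  assumes "sets P = sets Conf_space"
  shows "space P = Conf"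
    and "relcpt B \<Longrightarrow> (\<lambda>X. real (card (X \<inter> B))) \<in> borel_measurable P"
proof -
  have gen: "{{X \<in> Conf. card (X \<inter> B) = n} | B n. relcpt B} \<subseteq> Pow Conf" by auto
  have "space Conf_space = Conf" unfolding Conf_space_def using gen by (rule space_measure_of)
  with sets_eq_imp_space_eq[OF assms] show sp: "space P = Conf" by simp
  assume B: "relcpt B"
  have "{X \<in> Conf. card (X \<inter> B) = n} \<in> sets P" for n
    unfolding assms Conf_space_def using B by (subst sets_measure_of[OF gen]) (rule sigma_sets.Basic, auto)
  then have "(\<lambda>X. card (X \<inter> B)) \<in> measurable P (count_space UNIV)"
    unfolding sp[symmetric] by (subst measurable_count_space_eq_countable) (auto simp: vimage_def Int_def conj_commute)
  then show "(\<lambda>X. real (card (X \<inter> B))) \<in> borel_measurable P" by measurable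
qed

text \<open>Turns relative compactness into a radius below 1, from which uniform bounds on the
  kernel over \<open>U\<close> follow.\<close>

lemma relcpt_cball:
  assumes "relcpt U" obtains r where "0 \<le> r" "r < 1" "U \<subseteq> cball 0 r"
proof (cases "U = {}")
  case False
  have c: "compact (closure U)"
    using assms bounded_subset[OF bounded_ball[of 0 1]] by (auto simp: relcpt_def disk_def compact_eq_bounded_closed)
  obtain x where x: "x \<in> closure U" "\<And>y. y \<in> closure U \<Longrightarrow> cmod y \<le> cmod x"
    using continuous_attains_sup[OF c, of cmod] False by (auto intro: continuous_intros)
  show ?thesis
  proof
    show "cmod x < 1" using x(1) assms by (auto simp: relcpt_def disk_def)
    show "U \<subseteq> cball 0 (cmod x)" using x(2) closure_subset by fastforce
  qed simp
qed (use that[of 0] in auto)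

lemma relcptI:
  assumes "U \<in> sets borel" "U \<subseteq> cball 0 r" "r < 1" shows "relcpt U"
proof -
  have "closure U \<subseteq> cball 0 r" using assms(2) by (intro closure_minimal) auto
  then show ?thesis using assms by (auto simp: relcpt_def disk_def)
qed

lemma relcpt_subset_disk: "relcpt U \<Longrightarrow> U \<subseteq> disk"
  using closure_subset by (auto simp: relcpt_def)

lemma Conf_finite:
  assumes "X \<in> Conf" "relcpt U" shows "finite (X \<inter> U)"
proof -
  have "compact (closure U)"
    using assms bounded_subset[OF bounded_ball[of 0 1]] by (auto simp: relcpt_def disk_def compact_eq_bounded_closed)
  then have "finite (X \<inter> closure U)" using assms by (auto simp: Conf_def relcpt_def)
  then show ?thesis by (rule finite_subset[rotated]) (use closure_subset in auto)
qed

section \<open>Bounds and zeros of the correlation functions\<close>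

lemma borel_measurable_corr [measurable]:
  assumes "\<And>i. i < k \<Longrightarrow> sets (M i) = sets borel"
  shows "corr k \<in> borel_measurable (PiM {..<k} M)"
proof -
  have m: "(\<lambda>x. x i) \<in> borel_measurable (PiM {..<k} M)" if "i < k" for i
    using measurable_component_singleton[of i "{..<k}" M] that assms measurable_cong_sets by blast
  have "(\<lambda>x. detk k (\<lambda>i j. bergK (x i) (x j))) \<in> borel_measurable (PiM {..<k} M)"
    unfolding detk_def
    by (intro borel_measurable_sum borel_measurable_times borel_measurable_prod borel_measurable_bergK borel_measurable_const m)
       (auto simp: permutes_in_image[of _ "{..<k}", simplified])
  then show ?thesis unfolding corr_def by measurable
qed

lemma corr_nonneg [simp]: "0 \<le> corr k x" by (simp add: corr_def)

text \<open>Cauchy-Schwarz bounds each factor by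
  \<open>sqrt (rho (x i)) * sqrt (rho (x (p i)))\<close>. As \<open>p\<close> is a bijection, every
  point collects exactly two square roots.\<close>

lemma norm_detk_term_le:
  assumes p: "p permutes {..<k}" and x: "\<And>i. i < k \<Longrightarrow> x i \<in> disk"
  shows "cmod (\<Prod>i<k. bergK (x i) (x (p i))) \<le> (\<Prod>i<k. rho (x i))"
proof -
  have pk: "p i < k" if "i < k" for i using permutes_in_image[OF p, of i] that by simp
  have "cmod (\<Prod>i<k. bergK (x i) (x (p i))) = (\<Prod>i<k. cmod (bergK (x i) (x (p i))))"
    by (simp add: prod_norm)
  also have "\<dots> \<le> (\<Prod>i<k. sqrt (rho (x i)) * sqrt (rho (x (p i))))"
    using norm_bergK_le[OF x x] pk
    by (intro prod_mono) (auto simp flip: real_sqrt_mult intro!: real_le_rsqrt)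
  also have "\<dots> = (\<Prod>i<k. sqrt (rho (x i))) * (\<Prod>i<k. sqrt (rho (x (p i))))"
    by (rule prod.distrib)
  also have "(\<Prod>i<k. sqrt (rho (x (p i)))) = (\<Prod>i<k. sqrt (rho (x i)))"
    using prod.permute[OF p, of "\<lambda>i. sqrt (rho (x i))"] by (simp add: o_def)
  also have "(\<Prod>i<k. sqrt (rho (x i))) * (\<Prod>i<k. sqrt (rho (x i))) = (\<Prod>i<k. rho (x i))"
    by (simp flip: prod.distrib)
  finally show ?thesis .
qed

lemma corr_le:
  assumes x: "\<And>i. i < k \<Longrightarrow> x i \<in> disk"
  shows "corr k x \<le> fact k * (\<Prod>i<k. rho (x i))"
proof -
  let ?d = "detk k (\<lambda>i j. bergK (x i) (x j))"
  have "cmod ?d \<le> (\<Sum>p | p permutes {..<k}. (\<Prod>i<k. rho (x i)))"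
    unfolding detk_def
  proof (rule order_trans[OF norm_sum sum_mono])
    fix p assume "p \<in> {p. p permutes {..<k}}"
    then show "cmod (of_int (sign p) * (\<Prod>i<k. bergK (x i) (x (p i)))) \<le> (\<Prod>i<k. rho (x i))"
      using norm_detk_term_le[of p k x] x by (simp add: norm_mult sign_def)
  qed
  also have "\<dots> = fact k * (\<Prod>i<k. rho (x i))"
    using card_permutations[of "{..<k}" k] by (simp add: card_lessThan)
  finally have "Re ?d \<le> fact k * (\<Prod>i<k. rho (x i))" using complex_Re_le_cmod order_trans by blast
  then show ?thesis by (simp add: corr_def prod_nonneg)
qed

lemma rho_le:
  assumes "x \<in> cball 0 r" "0 \<le> r" "r < 1" shows "rho x \<le> 1 / (1 - r\<^sup>2)\<^sup>2"
proof -
  have "(cmod x)\<^sup>2 \<le> r\<^sup>2" using assms by (intro power_mono) auto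
  moreover have "r\<^sup>2 < 1" using assms abs_square_less_1[of r] by simp
  ultimately show ?thesis unfolding rho_def by (intro divide_left_mono power_mono mult_pos_pos zero_less_power) auto
qed

lemma corr_bounded:
  assumes "relcpt U"
  obtains M where "0 \<le> M" "\<And>x. x \<in> PiE {..<k} (\<lambda>_. U) \<Longrightarrow> corr k x \<le> M"
proof -
  obtain r where r: "0 \<le> r" "r < 1" "U \<subseteq> cball 0 r" using relcpt_cball[OF assms] by blast
  show ?thesis
  proof
    fix x assume "x \<in> PiE {..<k} (\<lambda>_. U)"
    then have x: "x i \<in> U" if "i < k" for i using that by auto
    have "corr k x \<le> fact k * (\<Prod>i<k. rho (x i))"
      using x relcpt_subset_disk[OF assms] by (intro corr_le) auto
    also have "\<dots> \<le> fact k * (\<Prod>i<k. 1 / (1 - r\<^sup>2)\<^sup>2)"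
      using subsetD[OF r(3) x] r(1,2) by (intro mult_left_mono prod_mono conjI rho_le) auto
    finally show "corr k x \<le> fact k * (\<Prod>i<k. 1 / (1 - r\<^sup>2)\<^sup>2)" .
  qed (auto intro!: prod_nonneg)
qed

text \<open>If two points coincide, composing with their transposition preserves the product and
  flips the sign, so the determinant equals its own negative. Sums over distinct tuples can thus be
  matched with integrals over all tuples.\<close>

lemma corr_eq_0:
  assumes "\<not> inj_on x {..<k}" shows "corr k x = 0"
proof -
  obtain a b where ab: "a < k" "b < k" "a \<noteq> b" "x a = x b" using assms by (auto simp: inj_on_def)
  let ?\<tau> = "Transposition.transpose a b"
  let ?f = "\<lambda>p. of_int (sign p) * (\<Prod>i<k. bergK (x i) (x (p i))) :: complex"
  have \<tau>: "?\<tau> permutes {..<k}" using ab by (intro permutes_swap_id) auto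
  have "(\<Sum>p | p permutes {..<k}. ?f p) = (\<Sum>p | p permutes {..<k}. ?f (?\<tau> \<circ> p))"
    by (rule setum_permutations_compose_left[OF \<tau>])
  also have "\<dots> = (\<Sum>p | p permutes {..<k}. - ?f p)"
  proof (rule sum.cong[OF refl])
    fix p assume "p \<in> {p. p permutes {..<k}}"
    then have "permutation p" using permutation_permutes by blast
    then have "sign (?\<tau> \<circ> p) = - sign p"
      using ab by (simp add: sign_compose permutation_swap_id sign_swap_id)
    moreover have "x (?\<tau> j) = x j" for j using ab by (auto simp: Transposition.transpose_def)
    ultimately show "?f (?\<tau> \<circ> p) = - ?f p" by simp
  qed
  also have "\<dots> = - (\<Sum>p | p permutes {..<k}. ?f p)" by (rule sum_negf)
  finally have "(\<Sum>p | p permutes {..<k}. ?f p) = 0" by simp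
  then show ?thesis by (simp add: corr_def detk_def)
qed

section \<open>From counts in disjoint cells to sums over tuples\<close>

lemma PiM_area_on:
  assumes [measurable]: "U \<in> sets borel" and U: "U \<subseteq> disk"
  shows "PiM {..<k::nat} (\<lambda>_. area_on U) = density (PiM {..<k} (\<lambda>_. lborel)) (\<lambda>x. \<Prod>i<k. ennreal (indicator U (x i) / pi))"
proof -
  interpret A: finite_measure "area_on U" by (rule finite_measure_area_on) fact+
  interpret product_sigma_finite "\<lambda>_::nat. area_on U" by standard
  interpret L: product_sigma_finite "\<lambda>_::nat. lborel :: complex measure" by standard
  show ?thesis
  proof (rule PiM_eqI[symmetric])
    show "sets (density (PiM {..<k} (\<lambda>_. lborel)) (\<lambda>x. \<Prod>i<k. ennreal (indicator U (x i) / pi))) = sets (PiM {..<k} (\<lambda>_. area_on U))"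
      by (simp cong: sets_PiM_cong)
    fix A :: "nat \<Rightarrow> complex set" assume A: "\<And>i. i \<in> {..<k} \<Longrightarrow> A i \<in> sets (area_on U)"
    then have [measurable]: "A i \<in> sets borel" if "i < k" for i using that by simp
    have S: "PiE {..<k} A \<in> sets (PiM {..<k} (\<lambda>_. lborel))" by (rule sets_PiM_I_finite) auto
    have "emeasure (density (PiM {..<k} (\<lambda>_. lborel)) (\<lambda>x. \<Prod>i<k. ennreal (indicator U (x i) / pi))) (PiE {..<k} A)
      = (\<integral>\<^sup>+x. (\<Prod>i<k. ennreal (indicator U (x i) / pi)) * indicator (PiE {..<k} A) x \<partial>PiM {..<k} (\<lambda>_. lborel))"
      by (rule emeasure_density[OF _ S]) measurable
    also have "\<dots> = (\<integral>\<^sup>+x. (\<Prod>i<k. ennreal (indicator U (x i) / pi) * indicator (A i) (x i)) \<partial>PiM {..<k} (\<lambda>_. lborel))"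
    proof (rule nn_integral_cong)
      fix x :: "nat \<Rightarrow> complex" assume "x \<in> space (PiM {..<k} (\<lambda>_. lborel))"
      then have "x \<in> extensional {..<k}" by (auto simp: space_PiM PiE_def)
      then have "(indicator (PiE {..<k} A) x :: ennreal) = (\<Prod>i<k. indicator (A i) (x i))"
        by (auto simp: indicator_def PiE_iff)
      then show "(\<Prod>i<k. ennreal (indicator U (x i) / pi)) * indicator (PiE {..<k} A) x = (\<Prod>i<k. ennreal (indicator U (x i) / pi) * indicator (A i) (x i))"
        by (simp add: prod.distrib)
    qed
    also have "\<dots> = (\<Prod>i<k. \<integral>\<^sup>+x. ennreal (indicator U x / pi) * indicator (A i) x \<partial>lborel)"
      by (rule L.product_nn_integral_prod) auto
    also have "\<dots> = (\<Prod>i<k. emeasure (area_on U) (A i))"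
      unfolding area_on_def by (intro prod.cong refl emeasure_density[symmetric]) auto
    finally show "emeasure (density (PiM {..<k} (\<lambda>_. lborel)) (\<lambda>x. \<Prod>i<k. ennreal (indicator U (x i) / pi))) (PiE {..<k} A) = (\<Prod>i<k. emeasure (area_on U) (A i))" .
  qed simp
qed

text \<open>The defining identity with the factor \<open>(1 / pi) ^ k\<close> and the domain of
  integration absorbed into powers of \<open>area_on U\<close>. The reference measure stays the same
  for all choices of the cells, so the identities can be combined linearly.\<close>

lemma DPP_box:
  assumes P: "is_DPP_K P" and U: "relcpt U"
    and B: "\<And>i. i < k \<Longrightarrow> B i \<in> sets borel" "\<And>i. i < k \<Longrightarrow> B i \<subseteq> U" "disjoint_family_on B {..<k}"
  shows "(\<integral>\<^sup>+X. ennreal (\<Prod>i<k. real (card (X \<inter> B i))) \<partial>P)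
     = (\<integral>\<^sup>+x. ennreal ((\<Prod>i<k. indicator (B i) (x i)) * corr k x) \<partial>PiM {..<k} (\<lambda>_. area_on U))"
proof -
  have [measurable]: "U \<in> sets borel" using U by (simp add: relcpt_def)
  have [measurable]: "B i \<in> sets borel" if "i < k" for i using B that by simp
  have Bi: "relcpt (B i)" if "i < k" for i
    using B(1,2)[OF that] U closure_mono[of "B i" U] by (auto simp: relcpt_def)
  have "(\<integral>\<^sup>+X. ennreal (\<Prod>i<k. real (card (X \<inter> B i))) \<partial>P) = (\<integral>\<^sup>+ X. (\<Prod>i<k. ennreal (real (card (X \<inter> B i)))) \<partial>P)"
    by (simp add: prod_ennreal)
  also have "\<dots> = ennreal ((1 / pi) ^ k) *
          (\<integral>\<^sup>+ x \<in> PiE {..<k} B. ennreal (Re (detk k (\<lambda>i j. bergK (x i) (x j)))) \<partial>(PiM {..<k} (\<lambda>_. lborel)))"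
    using P Bi B(3) by (auto simp: is_DPP_K_def)
  also have "\<dots> = (\<integral>\<^sup>+ x. ennreal ((1 / pi) ^ k) * (ennreal (corr k x) * indicator (PiE {..<k} B) x) \<partial>(PiM {..<k} (\<lambda>_. lborel)))"
  proof -
    have S: "PiE {..<k} B \<in> sets (PiM {..<k} (\<lambda>_. lborel))" by (rule sets_PiM_I_finite) auto
    have [measurable]: "corr k \<in> borel_measurable (PiM {..<k} (\<lambda>_. lborel))" by (rule borel_measurable_corr) simp
    have "ennreal (Re (detk k (\<lambda>i j. bergK (x i) (x j)))) = ennreal (corr k x)" for x
      by (simp add: corr_def max_def ennreal_neg)
    then show ?thesis using S by (simp add: nn_integral_cmult)
  qed
  also have "\<dots> = (\<integral>\<^sup>+ x. (\<Prod>i<k. ennreal (indicator U (x i) / pi)) * ennreal ((\<Prod>i<k. indicator (B i) (x i)) * corr k x) \<partial>(PiM {..<k} (\<lambda>_. lborel)))"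
  proof (rule nn_integral_cong)
    fix x :: "nat \<Rightarrow> complex" assume "x \<in> space (PiM {..<k} (\<lambda>_. lborel))"
    then have e: "x \<in> extensional {..<k}" by (auto simp: space_PiM PiE_def)
    show "ennreal ((1 / pi) ^ k) * (ennreal (corr k x) * indicator (PiE {..<k} B) x) = 
       (\<Prod>i<k. ennreal (indicator U (x i) / pi)) * ennreal ((\<Prod>i<k. indicator (B i) (x i)) * corr k x)"
    proof (cases "x \<in> PiE {..<k} B")
      case True
      then have "x i \<in> B i" "x i \<in> U" if "i < k" for i using that B(2)[OF that] by (auto simp: PiE_iff)
      then show ?thesis using True by (simp add: ennreal_power power_one_over)
    next
      case False
      then obtain i where "i < k" "x i \<notin> B i" using e by (auto simp: PiE_iff)
      then have "(\<Prod>i<k. indicator (B i) (x i)) = (0::real)" by (intro prod_zero bexI[of _ i]) auto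
      then show ?thesis using False by (simp del: prod_zero_iff)
    qed
  qed
  also have "\<dots> = (\<integral>\<^sup>+x. ennreal ((\<Prod>i<k. indicator (B i) (x i)) * corr k x) \<partial>PiM {..<k} (\<lambda>_. area_on U))"
  proof -
    have [measurable]: "corr k \<in> borel_measurable (PiM {..<k} (\<lambda>_. lborel))" by (rule borel_measurable_corr) simp
    show ?thesis using relcpt_subset_disk[OF U]
      by (subst PiM_area_on) (auto simp: nn_integral_density)
  qed
  finally show ?thesis .
qed

definition grid :: "nat \<Rightarrow> complex \<Rightarrow> int \<times> int" where
  "grid n x = (\<lfloor>real (Suc n) * Re x\<rfloor>, \<lfloor>real (Suc n) * Im x\<rfloor>)"

text \<open>A representative of the cell inside \<open>U\<close>, so that test functions are
  evaluated only where they are known to be bounded and continuous. For cells that miss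
  \<open>U\<close> the value is arbitrary; such cells never enter the sums.\<close>

definition grid_pt :: "complex set \<Rightarrow> nat \<Rightarrow> int \<times> int \<Rightarrow> complex" where
  "grid_pt U n i = (SOME x. x \<in> U \<and> grid n x = i)"

text \<open>Tuples with two points in the same cell are discarded, so that only disjoint cells enter and
  the defining identity of the process applies.\<close>
definition grid_step :: "complex set \<Rightarrow> nat \<Rightarrow> nat \<Rightarrow> ((nat \<Rightarrow> complex) \<Rightarrow> real) \<Rightarrow> (nat \<Rightarrow> complex) \<Rightarrow> real" where
  "grid_step U k n F x = (if inj_on (\<lambda>j. grid n (x j)) {..<k}
     then F (\<lambda>j\<in>{..<k}. grid_pt U n (grid n (x j))) else 0)"

lemma grid_pt: "x \<in> U \<Longrightarrow> grid_pt U n (grid n x) \<in> U \<and> grid n (grid_pt U n (grid n x)) = grid n x"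
  unfolding grid_pt_def by (rule someI[of _ x]) simp

lemma grid_close:
  assumes "grid n x = grid n y" shows "cmod (x - y) \<le> 2 / real (Suc n)"
proof -
  have *: "\<bar>a - b\<bar> \<le> 1 / real (Suc n)" if "\<lfloor>real (Suc n) * a\<rfloor> = \<lfloor>real (Suc n) * b\<rfloor>" for a b
  proof -
    have "\<bar>real (Suc n) * a - real (Suc n) * b\<bar> \<le> 1" using that by linarith
    then have "real (Suc n) * \<bar>a - b\<bar> \<le> 1" by (simp add: abs_mult flip: right_diff_distrib)
    then show ?thesis by (simp add: field_simps)
  qed
  have "cmod (x - y) \<le> \<bar>Re (x - y)\<bar> + \<bar>Im (x - y)\<bar>" by (rule cmod_le)
  also have "\<dots> \<le> 1 / real (Suc n) + 1 / real (Suc n)"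
    using assms unfolding grid_def by (intro add_mono) (auto intro!: * simp del: of_nat_Suc)
  finally show ?thesis by simp
qed

lemma finite_grid:
  assumes "U \<subseteq> disk" shows "finite (grid n ` U)"
proof (rule finite_subset)
  show "grid n ` U \<subseteq> {- int (Suc n)..int (Suc n)} \<times> {- int (Suc n)..int (Suc n)}"
  proof (rule image_subsetI)
    fix x assume "x \<in> U"
    then have "cmod x \<le> 1" using assms by (auto simp: disk_def)
    then have R: "\<bar>Re x\<bar> \<le> 1" "\<bar>Im x\<bar> \<le> 1" using abs_Re_le_cmod[of x] abs_Im_le_cmod[of x] by auto
    have "\<lfloor>real (Suc n) * c\<rfloor> \<in> {- int (Suc n)..int (Suc n)}" if "\<bar>c\<bar> \<le> 1" for c
    proof -
      have "\<bar>real (Suc n) * c\<bar> \<le> real (Suc n)" using that by (simp add: abs_mult mult_left_le)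
      then show ?thesis by (simp only: atLeastAtMost_iff) linarith
    qed
    then show "grid n x \<in> {- int (Suc n)..int (Suc n)} \<times> {- int (Suc n)..int (Suc n)}"
      using R by (auto simp: grid_def simp del: of_nat_Suc)
  qed
qed simp

lemma grid_cell_borel:
  assumes [measurable]: "U \<in> sets borel" shows "{x \<in> U. grid n x = i} \<in> sets borel"
proof -
  have "{x \<in> U. grid n x = i} = {x \<in> U. real_of_int \<lfloor>real (Suc n) * Re x\<rfloor> = real_of_int (fst i) \<and> real_of_int \<lfloor>real (Suc n) * Im x\<rfloor> = real_of_int (snd i)}"
    by (cases i) (auto simp: grid_def)
  also have "\<dots> = U \<inter> {x \<in> space borel. real_of_int \<lfloor>real (Suc n) * Re x\<rfloor> = real_of_int (fst i) \<and> real_of_int \<lfloor>real (Suc n) * Im x\<rfloor> = real_of_int (snd i)}"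
    by auto
  also have "\<dots> \<in> sets borel" by measurable
  finally show ?thesis .
qed

text \<open>On tuples from \<open>U\<close> the step function is a finite linear combination of
  indicators of products of disjoint cells, the only functions whose mean the process prescribes
  directly.\<close>

lemma grid_step_expand:
  assumes U: "U \<subseteq> disk" and x: "x \<in> PiE {..<k} (\<lambda>_. U)"
  shows "grid_step U k n F x = (\<Sum>i | i \<in> PiE {..<k} (\<lambda>_. grid n ` U) \<and> inj_on i {..<k}.
     F (\<lambda>j\<in>{..<k}. grid_pt U n (i j)) * (\<Prod>j<k. indicator {y \<in> U. grid n y = i j} (x j)))"
    (is "_ = sum ?f ?I")
proof -
  have fin: "finite ?I" using finite_grid[OF U] by (auto intro: finite_subset[OF _ finite_PiE[of "{..<k}" "\<lambda>_. grid n ` U"]])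
  \<comment> \<open>The cells that contain \<open>x\<close>: every other index tuple has a vanishing
    indicator factor.\<close>
  define i0 where "i0 = (\<lambda>j\<in>{..<k}. grid n (x j))"
  have xU: "x j \<in> U" if "j < k" for j using x that by auto
  have z: "?f i = 0" if "i \<in> ?I" "i \<noteq> i0" for i
  proof -
    have "\<exists>j<k. i j \<noteq> grid n (x j)"
    proof (rule ccontr)
      assume "\<not> ?thesis"
      then have "i = i0" using that(1) by (intro ext) (auto simp: i0_def PiE_iff extensional_def)
      with that show False by simp
    qed
    then obtain j where "j < k" "i j \<noteq> grid n (x j)" by blast
    then have "(\<Prod>j<k. indicator {y \<in> U. grid n y = i j} (x j)) = (0::real)"
      by (intro prod_zero bexI[of _ j]) auto
    then show ?thesis by simp
  qed
  show ?thesis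
  proof (cases "i0 \<in> ?I")
    case True
    have "sum ?f ?I = ?f i0" using sum.remove[OF fin True, of ?f] z by (simp add: sum.neutral)
    also have "\<dots> = F (\<lambda>j\<in>{..<k}. grid_pt U n (i0 j))" using xU by (simp add: i0_def)
    also have "(\<lambda>j\<in>{..<k}. grid_pt U n (i0 j)) = (\<lambda>j\<in>{..<k}. grid_pt U n (grid n (x j)))"
      by (auto simp: i0_def)
    finally have "sum ?f ?I = F (\<lambda>j\<in>{..<k}. grid_pt U n (grid n (x j)))" .
    moreover have "inj_on (\<lambda>j. grid n (x j)) {..<k}" using True by (auto simp: i0_def inj_on_def)
    ultimately show ?thesis by (simp add: grid_step_def)
  next
    case False
    then have "\<not> inj_on (\<lambda>j. grid n (x j)) {..<k}" using xU by (auto simp: i0_def inj_on_def)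
    moreover have "sum ?f ?I = 0" using z False by (intro sum.neutral) blast
    ultimately show ?thesis by (simp add: grid_step_def)
  qed
qed

text \<open>Exchanging the sums and factoring over coordinates turns each product of indicators into
  a product of counts, which is the random variable in the defining identity.\<close>

lemma sum_grid_step:
  assumes U: "U \<subseteq> disk" and Y: "finite Y" "Y \<subseteq> U"
  shows "(\<Sum>t\<in>PiE {..<k} (\<lambda>_. Y). grid_step U k n F t) = (\<Sum>i | i \<in> PiE {..<k} (\<lambda>_. grid n ` U) \<and> inj_on i {..<k}.
     F (\<lambda>j\<in>{..<k}. grid_pt U n (i j)) * (\<Prod>j<k. real (card (Y \<inter> {y \<in> U. grid n y = i j}))))"
    (is "_ = sum _ ?I")
proof -
  have "(\<Sum>t\<in>PiE {..<k} (\<lambda>_. Y). grid_step U k n F t) = (\<Sum>t\<in>PiE {..<k} (\<lambda>_. Y). \<Sum>i\<in>?I.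
      F (\<lambda>j\<in>{..<k}. grid_pt U n (i j)) * (\<Prod>j<k. indicator {y \<in> U. grid n y = i j} (t j)))"
    using Y by (intro sum.cong refl grid_step_expand U) auto
  also have "\<dots> = (\<Sum>i\<in>?I. F (\<lambda>j\<in>{..<k}. grid_pt U n (i j)) * (\<Sum>t\<in>PiE {..<k} (\<lambda>_. Y). \<Prod>j<k. indicator {y \<in> U. grid n y = i j} (t j)))"
    by (subst sum.swap) (simp add: sum_distrib_left)
  also have "\<dots> = (\<Sum>i\<in>?I. F (\<lambda>j\<in>{..<k}. grid_pt U n (i j)) * (\<Prod>j<k. real (card (Y \<inter> {y \<in> U. grid n y = i j}))))"
  proof -
    have "(\<Sum>t\<in>PiE {..<k} (\<lambda>_. Y). \<Prod>j<k. indicator {y \<in> U. grid n y = i j} (t j)) = (\<Prod>j<k. real (card (Y \<inter> {y \<in> U. grid n y = i j})))" for i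
      using Y by (subst prod_sum_PiE[symmetric]) (auto simp: indicator_def sum_of_bool_eq)
    then show ?thesis by simp
  qed
  finally show ?thesis .
qed

text \<open>Points of one cell are at distance at most \<open>2 / Suc n\<close>, so the
  representatives converge to \<open>x\<close>. Distinct points eventually occupy distinct cells,
  whereas coinciding points share a cell for every \<open>n\<close>; hence the limit is
  \<open>F\<close> cut off on the diagonals.\<close>

lemma grid_step_tendsto:
  assumes x: "x \<in> PiE {..<k} (\<lambda>_. U)"
    and cont: "\<And>X. (\<And>n. X n \<in> PiE {..<k} (\<lambda>_. U)) \<Longrightarrow> (\<And>j. j < k \<Longrightarrow> (\<lambda>n. X n j) \<longlonglongrightarrow> x j) \<Longrightarrow> (\<lambda>n. F (X n)) \<longlonglongrightarrow> F x"
  shows "(\<lambda>n. grid_step U k n F x) \<longlonglongrightarrow> (if inj_on x {..<k} then F x else 0)"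
proof (cases "inj_on x {..<k}")
  case False
  then have "grid_step U k n F x = 0" for n by (auto simp: grid_step_def inj_on_def)
  then show ?thesis using False by simp
next
  case True
  have xU: "x j \<in> U" if "j < k" for j using x that by auto
  have sm: "(\<lambda>n. 2 / real (Suc n)) \<longlonglongrightarrow> 0"
    using tendsto_mult_right_zero[OF LIMSEQ_inverse_real_of_nat, of 2] by (simp add: divide_inverse)
  have "(\<lambda>n. grid_pt U n (grid n (x j))) \<longlonglongrightarrow> x j" if "j < k" for j
  proof (rule Lim_transform2[OF tendsto_const], rule Lim_null_comparison[OF always_eventually sm], rule allI)
    fix n show "norm (x j - grid_pt U n (grid n (x j))) \<le> 2 / real (Suc n)"
      using grid_pt[OF xU[OF that], of n] by (intro grid_close) auto
  qed
  then have lim: "(\<lambda>n. F (\<lambda>j\<in>{..<k}. grid_pt U n (grid n (x j)))) \<longlonglongrightarrow> F x"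
    using grid_pt xU by (intro cont) auto
  have "eventually (\<lambda>n. \<forall>i\<in>{..<k}. \<forall>j\<in>{..<k}. grid n (x i) = grid n (x j) \<longrightarrow> i = j) sequentially"
  proof (intro eventually_ball_finite ballI, simp, simp)
    fix i j assume ij: "i \<in> {..<k}" "j \<in> {..<k}"
    show "eventually (\<lambda>n. grid n (x i) = grid n (x j) \<longrightarrow> i = j) sequentially"
    proof (cases "i = j")
      case False
      then have "0 < cmod (x i - x j)" using True ij by (auto simp: inj_on_def)
      then have "eventually (\<lambda>n. 2 / real (Suc n) < cmod (x i - x j)) sequentially"
        using order_tendstoD(2)[OF sm] by blast
      then show ?thesis by eventually_elim (use grid_close in force)
    qed simp
  qed
  then have "eventually (\<lambda>n. F (\<lambda>j\<in>{..<k}. grid_pt U n (grid n (x j))) = grid_step U k n F x) sequentially"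
    by eventually_elim (auto simp: grid_step_def inj_on_def)
  from Lim_transform_eventually[OF lim this] True show ?thesis by simp
qed

lemma finite_measure_PiM:
  assumes "finite_measure M" shows "finite_measure (PiM {..<k::nat} (\<lambda>_. M))"
proof (rule finite_measureI)
  interpret finite_measure M by fact
  interpret product_sigma_finite "\<lambda>_::nat. M" by standard
  interpret finite_product_sigma_finite "\<lambda>_::nat. M" "{..<k}" by standard simp
  have "space (PiM {..<k} (\<lambda>_. M)) = PiE {..<k} (\<lambda>_. space M)" by (simp add: space_PiM)
  moreover have "emeasure (PiM {..<k} (\<lambda>_. M)) (PiE {..<k} (\<lambda>_. space M)) = (\<Prod>i<k. emeasure M (space M))"
    by (subst emeasure_PiM) auto
  ultimately show "emeasure (PiM {..<k} (\<lambda>_. M)) (space (PiM {..<k} (\<lambda>_. M))) \<noteq> \<infinity>"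
    using emeasure_finite[of "space M"] by (simp add: power_eq_top_ennreal)
qed

text \<open>For grid steps the formula is an identity between finite sums, and both sides pass to
  the limit by dominated convergence. On the side of integrals a multiple of \<open>corr k\<close>
  dominates. On the side of configurations the dominating variable is \<open>C\<close> times the
  number of distinct tuples; its integrability is not given in advance and comes from Fatou's lemma
  for the constant test function.\<close>

lemma campbell:
  assumes P: "is_DPP_K P" and U: "relcpt U"
    and bound: "\<And>x. x \<in> PiE {..<k} (\<lambda>_. U) \<Longrightarrow> \<bar>F x\<bar> \<le> C"
    and cont: "\<And>x X. x \<in> PiE {..<k} (\<lambda>_. U) \<Longrightarrow> (\<And>n. X n \<in> PiE {..<k} (\<lambda>_. U)) \<Longrightarrow>
       (\<And>j. j < k \<Longrightarrow> (\<lambda>n. X n j) \<longlonglongrightarrow> x j) \<Longrightarrow> (\<lambda>n. F (X n)) \<longlonglongrightarrow> F x"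
    and meas: "F \<in> borel_measurable (PiM {..<k} (\<lambda>_. area_on U))"
  shows "integrable P (\<lambda>X. distinct_sum k F (X \<inter> U))"
    and "(\<integral>X. distinct_sum k F (X \<inter> U) \<partial>P) = (\<integral>x. F x * corr k x \<partial>PiM {..<k} (\<lambda>_. area_on U))"
proof -
  have Ud: "U \<subseteq> disk" and Ub [measurable]: "U \<in> sets borel"
    using U relcpt_subset_disk by (auto simp: relcpt_def)
  interpret P: prob_space P using P by (simp add: is_DPP_K_def)
  interpret A: finite_measure "area_on U" by (rule finite_measure_area_on) fact+
  let ?N = "PiM {..<k} (\<lambda>_. area_on U)"
  interpret N: finite_measure ?N by (rule finite_measure_PiM) (rule A.finite_measure_axioms)
  have setsP: "sets P = sets Conf_space" using P by (simp add: is_DPP_K_def)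
  note sp = Conf_space_props(1)[OF setsP]
  have corr_m [measurable]: "corr k \<in> borel_measurable ?N" by (rule borel_measurable_corr) simp
  have AEU: "AE x in ?N. x \<in> PiE {..<k} (\<lambda>_. U)"
  proof -
    have "AE x in ?N. \<forall>i\<in>{..<k}. x i \<in> U"
      unfolding PiM_area_on[OF Ub Ud]
    proof (subst AE_density)
      show "AE x in PiM {..<k} (\<lambda>_. lborel). 0 < (\<Prod>i<k. ennreal (indicator U (x i) / pi)) \<longrightarrow> (\<forall>i\<in>{..<k}. x i \<in> U)"
      proof (intro AE_I2 impI ballI)
        fix x :: "nat \<Rightarrow> complex" and i
        assume "0 < (\<Prod>i<k. ennreal (indicator U (x i) / pi))" "i \<in> {..<k}"
        then have "ennreal (indicator U (x i) / pi) \<noteq> 0" by (metis finite_lessThan less_irrefl prod_zero)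
        then show "x i \<in> U" by (auto simp: indicator_def split: if_splits)
      qed
    qed measurable
    then show ?thesis
      using AE_space by eventually_elim (auto simp: space_PiM PiE_iff)
  qed
  obtain M where M: "0 \<le> M" "\<And>x. x \<in> PiE {..<k} (\<lambda>_. U) \<Longrightarrow> corr k x \<le> M"
    using corr_bounded[OF U] by blast
  have corr_int: "integrable ?N (corr k)"
    by (rule N.integrable_const_bound[where B = M]) (use AEU in \<open>auto elim!: eventually_mono intro: M\<close>)
  let ?I = "\<lambda>n. {i. i \<in> PiE {..<k} (\<lambda>_. grid n ` U) \<and> inj_on i {..<k}}"
  let ?B = "\<lambda>n i. {y \<in> U. grid n y = i}"
  have finX: "finite (X \<inter> U)" if "X \<in> space P" for X using Conf_finite[OF _ U] that sp by simp
  have cell_m [measurable]: "?B n i \<in> sets borel" for n i by (rule grid_cell_borel) fact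
  have card_m [measurable]: "(\<lambda>X. real (card (X \<inter> ?B n i))) \<in> borel_measurable P" for n i
  proof -
    have "closure (?B n i) \<subseteq> closure U" by (rule closure_mono) auto
    then show ?thesis using cell_m U by (intro Conf_space_props(2)[OF setsP]) (auto simp: relcpt_def)
  qed
  have ind01: "0 \<le> (\<Prod>j<k. indicator (?B n (i j)) (x j) :: real)" "(\<Prod>j<k. indicator (?B n (i j)) (x j) :: real) \<le> 1" for n i x
    by (auto intro!: prod_nonneg prod_le_1)
  have ind_m: "(\<lambda>x. \<Prod>j<k. indicator (?B n (i j)) (x j) :: real) \<in> borel_measurable ?N" for n i
    by measurable
  have prod_int: "has_bochner_integral P (\<lambda>X. \<Prod>j<k. real (card (X \<inter> ?B n (i j)))) (\<integral>x. (\<Prod>j<k. indicator (?B n (i j)) (x j)) * corr k x \<partial>?N)"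
    if "i \<in> ?I n" for n i
  proof (rule has_bochner_integral_nn_integral)
    have ind: "(\<integral>\<^sup>+x. ennreal ((\<Prod>j<k. indicator (?B n (i j)) (x j)) * corr k x) \<partial>?N) = ennreal (\<integral>x. (\<Prod>j<k. indicator (?B n (i j)) (x j)) * corr k x \<partial>?N)"
    proof (rule nn_integral_eq_integral)
      show "integrable ?N (\<lambda>x. (\<Prod>j<k. indicator (?B n (i j)) (x j)) * corr k x)"
      proof (rule Bochner_Integration.integrable_bound[OF corr_int])
        show "AE x in ?N. norm ((\<Prod>j<k. indicator (?B n (i j)) (x j)) * corr k x) \<le> norm (corr k x)"
          by (intro AE_I2) (simp add: abs_mult abs_of_nonneg[OF ind01(1)] mult_left_le_one_le[OF _ ind01])
      qed measurable
    qed (auto intro!: prod_nonneg mult_nonneg_nonneg)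
    show "(\<integral>\<^sup>+X. ennreal (\<Prod>j<k. real (card (X \<inter> ?B n (i j)))) \<partial>P) = ennreal (\<integral>x. (\<Prod>j<k. indicator (?B n (i j)) (x j)) * corr k x \<partial>?N)"
      unfolding ind[symmetric]
      by (rule DPP_box[OF P U]) (use that in \<open>auto simp: disjoint_family_on_def inj_on_def\<close>)
  qed (auto intro!: prod_nonneg mult_nonneg_nonneg Bochner_Integration.integral_nonneg)
  define S where "S = (\<lambda>G n X. \<Sum>t\<in>PiE {..<k} (\<lambda>_. X \<inter> U). grid_step U k n G t)"
  have S_eq: "S G n X = (\<Sum>i\<in>?I n. G (\<lambda>j\<in>{..<k}. grid_pt U n (i j)) * (\<Prod>j<k. real (card (X \<inter> ?B n (i j)))))" if "X \<in> space P" for G n X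
  proof -
    have "X \<inter> U \<inter> ?B n i = X \<inter> ?B n i" for i by auto
    then show ?thesis unfolding S_def using finX[OF that] by (subst sum_grid_step[OF Ud]) auto
  qed
  \<comment> \<open>The cell expansion is available for tuples in \<open>U\<close> only. The extra
    indicator makes the integrand measurable on the whole space and does not change the integral, as
    almost every tuple lies in \<open>U\<close>.\<close>
  have S_int: "has_bochner_integral P (S G n) (\<integral>x. grid_step U k n G x * corr k x * indicator (PiE {..<k} (\<lambda>_. U)) x \<partial>?N)"
    and step_m: "\<And>G. (\<lambda>x. grid_step U k n G x * corr k x * indicator (PiE {..<k} (\<lambda>_. U)) x) \<in> borel_measurable ?N" for G n
  proof -
    let ?c = "\<lambda>G i. G (\<lambda>j\<in>{..<k}. grid_pt U n (i j))"
    have Um: "PiE {..<k} (\<lambda>_. U) \<in> sets ?N" by (rule sets_PiM_I_finite) auto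
    have eq: "grid_step U k n G x * corr k x = (\<Sum>i\<in>?I n. ?c G i * ((\<Prod>j<k. indicator (?B n (i j)) (x j)) * corr k x))"
      if "x \<in> PiE {..<k} (\<lambda>_. U)" for G x
      by (simp only: grid_step_expand[OF Ud that] sum_distrib_right mult.assoc)
    show m: "(\<lambda>x. grid_step U k n G x * corr k x * indicator (PiE {..<k} (\<lambda>_. U)) x) \<in> borel_measurable ?N" for G
    proof -
      have "(\<lambda>x. (\<Sum>i\<in>?I n. ?c G i * ((\<Prod>j<k. indicator (?B n (i j)) (x j)) * corr k x)) * indicator (PiE {..<k} (\<lambda>_. U)) x) \<in> borel_measurable ?N"
        by (intro borel_measurable_times borel_measurable_sum borel_measurable_const ind_m corr_m borel_measurable_indicator Um)
      moreover have "(\<lambda>x. (\<Sum>i\<in>?I n. ?c G i * ((\<Prod>j<k. indicator (?B n (i j)) (x j)) * corr k x)) * indicator (PiE {..<k} (\<lambda>_. U)) x)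
         = (\<lambda>x. grid_step U k n G x * corr k x * indicator (PiE {..<k} (\<lambda>_. U)) x)"
      proof
        fix x show "(\<Sum>i\<in>?I n. ?c G i * ((\<Prod>j<k. indicator (?B n (i j)) (x j)) * corr k x)) * indicator (PiE {..<k} (\<lambda>_. U)) x
           = grid_step U k n G x * corr k x * indicator (PiE {..<k} (\<lambda>_. U)) x"
        proof (cases "x \<in> PiE {..<k} (\<lambda>_. U)")
          case True then show ?thesis by (simp only: eq)
        next
          case False
          then have "indicator (PiE {..<k} (\<lambda>_. U)) x = (0::real)" by (simp only: indicator_simps simp_thms)
          then show ?thesis by (simp only: mult_zero_right)
        qed
      qed
      ultimately show ?thesis by simp
    qed
    have "has_bochner_integral P (\<lambda>X. \<Sum>i\<in>?I n. ?c G i * (\<Prod>j<k. real (card (X \<inter> ?B n (i j)))))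
       (\<Sum>i\<in>?I n. ?c G i * (\<integral>x. (\<Prod>j<k. indicator (?B n (i j)) (x j)) * corr k x \<partial>?N))"
      by (intro has_bochner_integral_sum has_bochner_integral_mult_right prod_int)
    moreover have "(\<Sum>i\<in>?I n. ?c G i * (\<integral>x. (\<Prod>j<k. indicator (?B n (i j)) (x j)) * corr k x \<partial>?N)) = (\<integral>x. grid_step U k n G x * corr k x * indicator (PiE {..<k} (\<lambda>_. U)) x \<partial>?N)"
    proof -
      have int: "integrable ?N (\<lambda>x. (\<Prod>j<k. indicator (?B n (i j)) (x j)) * corr k x)" for i
      proof (rule Bochner_Integration.integrable_bound[OF corr_int])
        show "AE x in ?N. norm ((\<Prod>j<k. indicator (?B n (i j)) (x j)) * corr k x) \<le> norm (corr k x)"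
          by (intro AE_I2) (simp add: abs_mult abs_of_nonneg[OF ind01(1)] mult_left_le_one_le[OF _ ind01])
      qed measurable
      have "(\<Sum>i\<in>?I n. ?c G i * (\<integral>x. (\<Prod>j<k. indicator (?B n (i j)) (x j)) * corr k x \<partial>?N)) =
         (\<integral>x. (\<Sum>i\<in>?I n. ?c G i * ((\<Prod>j<k. indicator (?B n (i j)) (x j)) * corr k x)) \<partial>?N)"
        using int by simp
      also have "\<dots> = (\<integral>x. grid_step U k n G x * corr k x * indicator (PiE {..<k} (\<lambda>_. U)) x \<partial>?N)"
      proof (rule integral_cong_AE[OF _ m])
        show "(\<lambda>x. (\<Sum>i\<in>?I n. ?c G i * ((\<Prod>j<k. indicator (?B n (i j)) (x j)) * corr k x))) \<in> borel_measurable ?N"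
          by (intro borel_measurable_times borel_measurable_sum borel_measurable_const ind_m corr_m)
        show "AE x in ?N. (\<Sum>i\<in>?I n. ?c G i * ((\<Prod>j<k. indicator (?B n (i j)) (x j)) * corr k x))
          = grid_step U k n G x * corr k x * indicator (PiE {..<k} (\<lambda>_. U)) x"
          using AEU by eventually_elim (simp only: eq indicator_simps mult_1_right)
      qed
      finally show ?thesis .
    qed
    ultimately show "has_bochner_integral P (S G n) (\<integral>x. grid_step U k n G x * corr k x * indicator (PiE {..<k} (\<lambda>_. U)) x \<partial>?N)"
      by (simp only: has_bochner_integral_cong[OF refl S_eq refl])
  qed
  let ?one = "\<lambda>_::nat \<Rightarrow> complex. 1::real"
  have conv: "(\<lambda>n. S G n X) \<longlonglongrightarrow> distinct_sum k G (X \<inter> U)" if G: "G = F \<or> G = ?one" for G X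
    unfolding S_def distinct_sum_def
  proof (rule tendsto_sum)
    fix x assume "x \<in> PiE {..<k} (\<lambda>_. X \<inter> U)"
    then have x: "x \<in> PiE {..<k} (\<lambda>_. U)" by (auto simp: PiE_iff)
    show "(\<lambda>n. grid_step U k n G x) \<longlonglongrightarrow> (if inj_on x {..<k} then G x else 0)"
      by (rule grid_step_tendsto[OF x]) (use G cont[OF x] in auto)
  qed
  have S_m [measurable]: "S G n \<in> borel_measurable P" for G n
    using S_int[of G n] by (rule borel_measurable_has_bochner_integral)
  have D_m: "(\<lambda>X. distinct_sum k G (X \<inter> U)) \<in> borel_measurable P" if "G = F \<or> G = ?one" for G
    by (rule borel_measurable_LIMSEQ_real[OF conv[OF that]]) (rule S_m)
  have step1: "0 \<le> grid_step U k n ?one x" "grid_step U k n ?one x \<le> 1" for n x by (auto simp: grid_step_def)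
  \<comment> \<open>Fatou bounds the mean number of distinct \<open>k\<close>-tuples in
    \<open>U\<close> by the integral of \<open>corr k\<close>, since every grid step of the constant
    1 is at most 1.\<close>
  have D1: "integrable P (\<lambda>X. distinct_sum k ?one (X \<inter> U))"
  proof (rule integrableI_nonneg[OF D_m])
    have "(\<integral>\<^sup>+X. ennreal (distinct_sum k ?one (X \<inter> U)) \<partial>P) = (\<integral>\<^sup>+X. liminf (\<lambda>n. ennreal (S ?one n X)) \<partial>P)"
      by (intro nn_integral_cong lim_imp_Liminf[symmetric] tendsto_ennrealI conv) auto
    also have "\<dots> \<le> liminf (\<lambda>n. \<integral>\<^sup>+X. ennreal (S ?one n X) \<partial>P)"
      by (rule nn_integral_liminf) measurable
    also have "\<dots> \<le> liminf (\<lambda>n. ennreal (\<integral>x. corr k x \<partial>?N))"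
    proof (intro Liminf_mono always_eventually allI)
      fix n
      have "(\<integral>\<^sup>+X. ennreal (S ?one n X) \<partial>P) = ennreal (\<integral>x. grid_step U k n ?one x * corr k x * indicator (PiE {..<k} (\<lambda>_. U)) x \<partial>?N)"
        using S_int[of ?one n] by (subst nn_integral_eq_integral) (auto simp: has_bochner_integral_iff S_def intro!: sum_nonneg step1)
      also have "\<dots> \<le> ennreal (\<integral>x. corr k x \<partial>?N)"
      proof (rule ennreal_leI, rule integral_mono_AE'[OF corr_int])
        show "AE x in ?N. grid_step U k n ?one x * corr k x * indicator (PiE {..<k} (\<lambda>_. U)) x \<le> corr k x"
        proof (rule AE_I2)
          fix x
          have "grid_step U k n ?one x * corr k x \<le> corr k x"
            by (rule mult_left_le_one_le[OF corr_nonneg step1])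
          then show "grid_step U k n ?one x * corr k x * indicator (PiE {..<k} (\<lambda>_. U)) x \<le> corr k x"
            by (cases "x \<in> PiE {..<k} (\<lambda>_. U)") (simp_all only: indicator_simps simp_thms mult_1_right mult_zero_right corr_nonneg)
        qed
        show "AE x in ?N. 0 \<le> corr k x"
          by simp
      qed
      finally show "(\<integral>\<^sup>+X. ennreal (S ?one n X) \<partial>P) \<le> ennreal (\<integral>x. corr k x \<partial>?N)" .
    qed
    also have "\<dots> < \<infinity>" by (simp add: Liminf_const)
    finally show "(\<integral>\<^sup>+X. ennreal (distinct_sum k ?one (X \<inter> U)) \<partial>P) < \<infinity>" .
  qed (auto simp: distinct_sum_def intro!: sum_nonneg)
  \<comment> \<open>Points in distinct cells are distinct, so the indicator of distinct tuples
    dominates the steps for all \<open>n\<close> at once.\<close>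
  have stepF: "\<bar>grid_step U k n F x\<bar> \<le> C * (if inj_on x {..<k} then 1 else 0)" if x: "x \<in> PiE {..<k} (\<lambda>_. U)" for n x
  proof -
    have "0 \<le> C" using bound[OF x] by linarith
    moreover have "\<bar>F (\<lambda>j\<in>{..<k}. grid_pt U n (grid n (x j)))\<bar> \<le> C"
      using x grid_pt by (intro bound) (auto simp: PiE_iff)
    moreover have "inj_on x {..<k}" if "inj_on (\<lambda>j. grid n (x j)) {..<k}" using that by (auto simp: inj_on_def)
    ultimately show ?thesis by (auto simp: grid_step_def)
  qed
  have SF: "\<bar>S F n X\<bar> \<le> C * distinct_sum k ?one (X \<inter> U)" for n X
  proof -
    have "\<bar>S F n X\<bar> \<le> (\<Sum>t\<in>PiE {..<k} (\<lambda>_. X \<inter> U). C * (if inj_on t {..<k} then 1 else 0))"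
      unfolding S_def by (intro order_trans[OF sum_abs sum_mono] stepF) (auto simp: PiE_iff)
    then show ?thesis by (simp add: distinct_sum_def sum_distrib_left)
  qed
  have dom: "integrable P (\<lambda>X. C * distinct_sum k ?one (X \<inter> U))" using D1 by simp
  show "integrable P (\<lambda>X. distinct_sum k F (X \<inter> U))"
    by (rule integrable_dominated_convergence[OF D_m S_m dom]) (rule disjI1 refl AE_I2 conv | simp only: real_norm_def SF)+
  have L1: "(\<lambda>n. \<integral>X. S F n X \<partial>P) \<longlonglongrightarrow> (\<integral>X. distinct_sum k F (X \<inter> U) \<partial>P)"
    by (rule integral_dominated_convergence[OF D_m S_m dom]) (rule disjI1 refl AE_I2 conv | simp only: real_norm_def SF)+
  have Um: "PiE {..<k} (\<lambda>_. U) \<in> sets ?N" by (rule sets_PiM_I_finite) auto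
  have L2: "(\<lambda>n. \<integral>x. grid_step U k n F x * corr k x * indicator (PiE {..<k} (\<lambda>_. U)) x \<partial>?N) \<longlonglongrightarrow>
     (\<integral>x. F x * corr k x * indicator (PiE {..<k} (\<lambda>_. U)) x \<partial>?N)"
  proof (rule integral_dominated_convergence[where w = "\<lambda>x. C * corr k x"])
    show "(\<lambda>x. F x * corr k x * indicator (PiE {..<k} (\<lambda>_. U)) x) \<in> borel_measurable ?N"
      by (intro borel_measurable_times meas corr_m borel_measurable_indicator Um)
    show "(\<lambda>x. grid_step U k n F x * corr k x * indicator (PiE {..<k} (\<lambda>_. U)) x) \<in> borel_measurable ?N" for n
      by (rule step_m)
    show "integrable ?N (\<lambda>x. C * corr k x)" using corr_int by simp
    show "AE x in ?N. (\<lambda>n. grid_step U k n F x * corr k x * indicator (PiE {..<k} (\<lambda>_. U)) x) \<longlonglongrightarrow> F x * corr k x * indicator (PiE {..<k} (\<lambda>_. U)) x"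
      using AEU
    proof eventually_elim
      case (elim x)
      have "(\<lambda>n. grid_step U k n F x) \<longlonglongrightarrow> (if inj_on x {..<k} then F x else 0)"
        by (rule grid_step_tendsto[OF elim]) (use cont[OF elim] in auto)
      then have "(\<lambda>n. grid_step U k n F x * corr k x) \<longlonglongrightarrow> (if inj_on x {..<k} then F x else 0) * corr k x"
        by (rule tendsto_mult_right)
      \<comment> \<open>On a diagonal the steps tend to 0 while \<open>F x\<close> need not vanish;
        there the factor \<open>corr k x\<close> is 0, so the limits agree.\<close>
      then show ?case using elim corr_eq_0[of x k] by (cases "inj_on x {..<k}") auto
    qed
    show "AE x in ?N. norm (grid_step U k n F x * corr k x * indicator (PiE {..<k} (\<lambda>_. U)) x) \<le> C * corr k x" for n
      using AEU
    proof eventually_elim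
      case (elim x)
      then have "0 \<le> C" using bound[OF elim] by linarith
      then have "\<bar>grid_step U k n F x\<bar> \<le> C" using stepF[OF elim, of n] by (auto split: if_splits)
      then have "\<bar>grid_step U k n F x\<bar> * corr k x \<le> C * corr k x" by (rule mult_right_mono) simp
      moreover have "indicator (PiE {..<k} (\<lambda>_. U)) x = (1::real)" using elim by (rule indicator_simps)
      ultimately show ?case by (simp add: abs_mult)
    qed
  qed
  have "(\<integral>X. distinct_sum k F (X \<inter> U) \<partial>P) = (\<integral>x. F x * corr k x * indicator (PiE {..<k} (\<lambda>_. U)) x \<partial>?N)"
    using L1 L2 unfolding S_int[of F, THEN has_bochner_integral_integral_eq] by (rule LIMSEQ_unique)
  also have "\<dots> = (\<integral>x. F x * corr k x \<partial>?N)"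
  proof (rule integral_cong_AE)
    show "(\<lambda>x. F x * corr k x * indicator (PiE {..<k} (\<lambda>_. U)) x) \<in> borel_measurable ?N"
      by (intro borel_measurable_times meas corr_m borel_measurable_indicator Um)
    show "(\<lambda>x. F x * corr k x) \<in> borel_measurable ?N"
      by (intro borel_measurable_times meas corr_m)
    show "AE x in ?N. F x * corr k x * indicator (PiE {..<k} (\<lambda>_. U)) x = F x * corr k x"
      using AEU by eventually_elim simp
  qed
  finally show "(\<integral>X. distinct_sum k F (X \<inter> U) \<partial>P) = (\<integral>x. F x * corr k x \<partial>?N)" .
qed

section \<open>Four-point correlations\<close>

text \<open>The factor \<open>y\<close> is at most \<open>sqrt (P * Q)\<close>, and one root is
  given to \<open>u\<close>, the other to \<open>v\<close>, before the arithmetic-geometric mean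
  inequality is applied.\<close>

lemma amgm_sq:
  fixes u v y P Q :: real
  assumes "y\<^sup>2 \<le> P * Q" "0 \<le> P" "0 \<le> Q"
  shows "u * v * y \<le> (u\<^sup>2 * P + v\<^sup>2 * Q) / 2"
proof (rule power2_le_imp_le)
  have "(u * v * y)\<^sup>2 = u\<^sup>2 * v\<^sup>2 * y\<^sup>2" by (simp add: power_mult_distrib)
  also have "\<dots> \<le> u\<^sup>2 * v\<^sup>2 * (P * Q)" using assms by (intro mult_left_mono) auto
  also have "\<dots> = (u\<^sup>2 * P) * (v\<^sup>2 * Q)" by simp
  also have "\<dots> \<le> ((u\<^sup>2 * P + v\<^sup>2 * Q) / 2)\<^sup>2"
  proof -
    have "0 \<le> (u\<^sup>2 * P - v\<^sup>2 * Q)\<^sup>2" by simp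
    then show ?thesis by (simp add: power2_eq_square field_simps)
  qed
  finally show "(u * v * y)\<^sup>2 \<le> ((u\<^sup>2 * P + v\<^sup>2 * Q) / 2)\<^sup>2" .
qed (use assms in simp)

lemma lessThan_4: "{..<4::nat} = {0,1,2,3}" by auto

lemma permutes_4_noncrossing:
  assumes p: "p permutes {..<4::nat}" and nc: "p 0 \<in> {0,1}" "p 1 \<in> {0,1}"
  shows "p \<in> {id, Transposition.transpose 0 1, Transposition.transpose 2 3, Transposition.transpose 0 1 \<circ> Transposition.transpose 2 3}"
proof -
  have inj: "p i = p j \<longleftrightarrow> i = j" for i j using permutes_inj[OF p] by (auto simp: inj_def)
  have r: "p i < 4" if "i < 4" for i using permutes_in_image[OF p, of i] that by simp
  have o: "p i = i" if "\<not> i < 4" for i using permutes_not_in[OF p, of i] that by simp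
  have v: "p 2 \<in> {0,1,2,3}" "p 3 \<in> {0,1,2,3}" using r[of 2] r[of 3] by auto
  have d: "p 0 \<noteq> p 1" "p 0 \<noteq> p 2" "p 0 \<noteq> p 3" "p 1 \<noteq> p 2" "p 1 \<noteq> p 3" "p 2 \<noteq> p 3" by (simp_all add: inj)
  have ext4: "p = q" if "p 0 = q 0" "p 1 = q 1" "p 2 = q 2" "p 3 = q 3" "\<And>i. \<not> i < 4 \<Longrightarrow> q i = i" for q
  proof
    fix i
    show "p i = q i"
    proof (cases "i < 4")
      case True
      then have "i \<in> {0,1,2,3}" by auto
      then show ?thesis using that by auto
    qed (use that o in auto)
  qed
  consider "p 0 = 0" "p 1 = 1" "p 2 = 2" "p 3 = 3" | "p 0 = 1" "p 1 = 0" "p 2 = 2" "p 3 = 3"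
    | "p 0 = 0" "p 1 = 1" "p 2 = 3" "p 3 = 2" | "p 0 = 1" "p 1 = 0" "p 2 = 3" "p 3 = 2"
    using nc v d by auto
  then show ?thesis
  proof cases
    case 1 then have "p = id" by (intro ext4) auto
    then show ?thesis by simp
  next
    case 2 then have "p = Transposition.transpose 0 1" by (intro ext4) (auto simp: Transposition.transpose_def)
    then show ?thesis by simp
  next
    case 3 then have "p = Transposition.transpose 2 3" by (intro ext4) (auto simp: Transposition.transpose_def)
    then show ?thesis by simp
  next
    case 4 then have "p = Transposition.transpose 0 1 \<circ> Transposition.transpose 2 3" by (intro ext4) (auto simp: Transposition.transpose_def)
    then show ?thesis by simp
  qed
qed

text \<open>Permutations that preserve \<open>{0,1}\<close> also preserve \<open>{2,3}\<close>; they
  form the product of two symmetric groups of order 2, so signs and products factor into two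
  determinants of size 2.\<close>

lemma noncrossing_sum:
  fixes M :: "nat \<Rightarrow> nat \<Rightarrow> complex"
  shows "(\<Sum>p | p permutes {..<4} \<and> p 0 \<in> {0,1} \<and> p 1 \<in> {0,1}. of_int (sign p) * (\<Prod>i<4. M i (p i)))
    = (M 0 0 * M 1 1 - M 0 1 * M 1 0) * (M 2 2 * M 3 3 - M 2 3 * M 3 2)"
proof -
  let ?a = "Transposition.transpose 0 (1::nat)" and ?b = "Transposition.transpose 2 (3::nat)"
  have S: "{p. p permutes {..<4} \<and> p 0 \<in> {0,1} \<and> p 1 \<in> {0,1}} = {id, ?a, ?b, ?a \<circ> ?b}"
  proof (intro equalityI subsetI)
    fix p assume "p \<in> {p. p permutes {..<4} \<and> p 0 \<in> {0,1} \<and> p (1::nat) \<in> {0,1}}"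
    then show "p \<in> {id, ?a, ?b, ?a \<circ> ?b}" using permutes_4_noncrossing[of p] by blast
  next
    fix p assume "p \<in> {id, ?a, ?b, ?a \<circ> ?b}"
    then show "p \<in> {p. p permutes {..<4} \<and> p 0 \<in> {0,1} \<and> p (1::nat) \<in> {0,1}}"
      by (auto intro!: permutes_id permutes_swap_id permutes_compose simp: Transposition.transpose_def)
  qed
  have ev: "?a 0 = 1" "?a 2 = 2" "?b 0 = 0" "?b 2 = 3" "(?a \<circ> ?b) 0 = 1" "(?a \<circ> ?b) 2 = 3"
    by (simp_all add: Transposition.transpose_def)
  have neq: "f \<noteq> g" if "f i \<noteq> g i" for f g :: "nat \<Rightarrow> nat" and i using that by auto
  have ne: "id \<noteq> ?a" "id \<noteq> ?b" "id \<noteq> ?a \<circ> ?b" "?a \<noteq> ?b" "?a \<noteq> ?a \<circ> ?b" "?b \<noteq> ?a \<circ> ?b"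
    using neq[of id 0 ?a] neq[of id 2 ?b] neq[of id 0 "?a \<circ> ?b"] neq[of ?a 0 ?b] neq[of ?a 2 "?a \<circ> ?b"] neq[of ?b 0 "?a \<circ> ?b"]
    unfolding ev id_apply by (simp_all only: zero_neq_one one_neq_zero zero_neq_numeral numeral_eq_iff num.distinct num.inject simp_thms)
  have sg: "sign ?a = -1" "sign ?b = -1" "sign (?a \<circ> ?b) = 1"
    by (simp_all add: sign_swap_id sign_compose permutation_swap_id)
  show ?thesis unfolding S using ne
    by (simp add: sg sg[unfolded One_nat_def] sign_id lessThan_4) (simp add: Transposition.transpose_def algebra_simps)
qed

text \<open>\<open>1 - w\<close> exchanges 0 and 1, and \<open>5 - u\<close> exchanges 2 and 3: each
  is the partner of a point within its own pair. The two remaining indices are these partners, in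
  one order or the other.\<close>

lemma complementary_pair:
  fixes u w \<alpha> \<gamma> :: nat
  assumes "u \<in> {2,3}" "w \<in> {0,1}" "\<alpha> \<in> {0,1,2,3}" "\<gamma> \<in> {0,1,2,3}" "\<alpha> \<noteq> \<gamma>" "\<alpha> \<noteq> u" "\<alpha> \<noteq> w" "\<gamma> \<noteq> u" "\<gamma> \<noteq> w"
  shows "\<alpha> = 5 - u \<and> \<gamma> = 1 - w \<or> \<alpha> = 1 - w \<and> \<gamma> = 5 - u"
  using assms by auto

text \<open>A permutation of \<open>{0,1} \<union> {2,3}\<close> that mixes the two pairs has an edge in each direction
  between them. These two edges are kept; the other two factors are bounded by
  \<open>\<bar>M i j\<bar>\<^sup>2 \<le> r i * r j\<close>.\<close>
lemma crossing_term_le: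
  fixes M :: "nat \<Rightarrow> nat \<Rightarrow> complex" and r :: "nat \<Rightarrow> real"
  assumes p: "p permutes {..<4}" and cr: "\<not> (p 0 \<in> {0,1} \<and> p 1 \<in> {0,1})"
    and sym: "\<And>i j. cmod (M i j) = cmod (M j i)" and le: "\<And>i j. i < 4 \<Longrightarrow> j < 4 \<Longrightarrow> (cmod (M i j))\<^sup>2 \<le> r i * r j"
    and r: "\<And>i. 0 \<le> r i"
  shows "cmod (\<Prod>i<4. M i (p i)) \<le> (cmod (M 0 2))\<^sup>2 * r 1 * r 3 + (cmod (M 0 3))\<^sup>2 * r 1 * r 2
     + (cmod (M 1 2))\<^sup>2 * r 0 * r 3 + (cmod (M 1 3))\<^sup>2 * r 0 * r 2"
proof -
  have inj: "p i = p j \<longleftrightarrow> i = j" for i j using permutes_inj[OF p] by (auto simp: inj_def)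
  have rg: "p i < 4" if "i < 4" for i using permutes_in_image[OF p, of i] that by simp
  have v: "p 0 \<in> {0,1,2,3}" "p 1 \<in> {0,1,2,3}" "p 2 \<in> {0,1,2,3}" "p 3 \<in> {0,1,2,3}"
    using rg[of 0] rg[of 1] rg[of 2] rg[of 3] by auto
  have d: "p 0 \<noteq> p 1" "p 0 \<noteq> p 2" "p 0 \<noteq> p 3" "p 1 \<noteq> p 2" "p 1 \<noteq> p 3" "p 2 \<noteq> p 3" by (simp_all add: inj)
  \<comment> \<open>The weight of a crossing edge between \<open>a\<close> in the first pair and
    \<open>b\<close> in the second; \<open>r\<close> sits at the partners \<open>1 - a\<close> and
    \<open>5 - b\<close>.\<close>
  define W where "W = (\<lambda>a b. (cmod (M a b))\<^sup>2 * (r (1 - a) * r (5 - b)))"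
  let ?T = "W 0 2 + W 0 3 + W 1 2 + W 1 3"
  have W0: "0 \<le> W a b" for a b by (simp add: W_def r)
  have Wle: "W a b \<le> ?T" if "a \<in> {0,1}" "b \<in> {2,3}" for a b
    using that W0[of 0 2] W0[of 0 3] W0[of 1 2] W0[of 1 3] by auto
  have "p 0 \<in> {2,3} \<or> p 1 \<in> {2,3}" using cr v(1,2) by auto
  then obtain a where a: "a \<in> {0,1}" "p a \<in> {2,3}" by blast
  \<comment> \<open>Counting: if both 2 and 3 stayed in \<open>{2,3}\<close>, they would fill it and
    leave no room for \<open>p a\<close>. Hence there is also an edge back into the first
    pair.\<close>
  have "\<exists>c\<in>{2,3}. p c \<in> {0,1}"
  proof (rule ccontr)
    assume "\<not> ?thesis"
    then have "p 2 \<in> {2,3}" "p 3 \<in> {2,3}" using v(3,4) by auto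
    moreover have "p a \<noteq> p 2" "p a \<noteq> p 3" using a(1) by (auto simp: inj)
    ultimately show False using a(2) d(6) by auto
  qed
  then obtain c where c: "c \<in> {2,3}" "p c \<in> {0,1}" by blast
  define a' c' where "a' = 1 - a" and "c' = 5 - c"
  have ac: "a' \<in> {0,1}" "c' \<in> {2,3}" "a' \<noteq> a" "c' \<noteq> c" using a c by (auto simp: a'_def c'_def)
  have prod: "cmod (\<Prod>i<4. M i (p i)) = cmod (M a (p a)) * cmod (M (p c) c) * (cmod (M a' (p a')) * cmod (M c' (p c')))"
    using a(1) c(1) sym[of c] by (auto simp: lessThan_4 a'_def c'_def norm_mult mult_ac)
  have "(cmod (M a' (p a')) * cmod (M c' (p c')))\<^sup>2 \<le> (r a' * r (p a')) * (r c' * r (p c'))"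
    unfolding power_mult_distrib using ac rg by (intro mult_mono le) (auto simp: r)
  also have "\<dots> = (r a' * r (5 - p a)) * (r (1 - p c) * r (5 - c))"
  proof -
    \<comment> \<open>The values of \<open>p\<close> at the two remaining indices are what the two
      crossing edges left over, namely the partners of \<open>p a\<close> and
      \<open>p c\<close>.\<close>
    have "r (p a') * r (p c') = r (1 - p c) * r (5 - p a)"
    proof -
      have dd: "p a' \<noteq> p c'" "p a' \<noteq> p a" "p a' \<noteq> p c" "p c' \<noteq> p a" "p c' \<noteq> p c" using ac a c by (auto simp: inj)
      have "a' < 4" "c' < 4" using ac(1,2) by auto
      from this[THEN rg] have "p a' \<in> {0,1,2,3}" "p c' \<in> {0,1,2,3}" by auto
      then have "p a' = 5 - p a \<and> p c' = 1 - p c \<or> p a' = 1 - p c \<and> p c' = 5 - p a"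
        using complementary_pair[OF a(2) c(2)] dd by metis
      then show ?thesis by (elim disjE conjE) simp_all
    qed
    then show ?thesis by (simp add: c'_def)
  qed
  finally have y: "(cmod (M a' (p a')) * cmod (M c' (p c')))\<^sup>2 \<le> (r (1 - a) * r (5 - p a)) * (r (1 - p c) * r (5 - c))"
    by (simp add: a'_def)
  \<comment> \<open>The moduli of the two crossing edges play the roles of \<open>u\<close> and
    \<open>v\<close>; grouping the four values of \<open>r\<close> as in \<open>y\<close> gives each
    edge exactly the weights required by \<open>W\<close>.\<close>
  have "cmod (\<Prod>i<4. M i (p i)) \<le> (W a (p a) + W (p c) c) / 2"
    unfolding prod W_def by (rule amgm_sq[OF y]) (auto simp: r)
  also have "\<dots> \<le> ?T" using Wle[OF a] Wle[OF c(2,1)] by simp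
  finally show ?thesis by (simp add: W_def mult.assoc)
qed

section \<open>Correlation functions of low order\<close>

text \<open>The determinant of size 2 without the truncation at 0; on the disk it coincides with
  \<open>corr 2\<close>, because Cauchy-Schwarz makes it nonnegative there.\<close>

definition corr2 :: "complex \<Rightarrow> complex \<Rightarrow> real" where
  "corr2 x y = rho x * rho y - (cmod (bergK x y))\<^sup>2"

lemma corr2_nonneg: "x \<in> disk \<Longrightarrow> y \<in> disk \<Longrightarrow> 0 \<le> corr2 x y"
  using norm_bergK_le[of x y] by (simp add: corr2_def)

lemma corr2_eq: "bergK x x * bergK y y - bergK x y * bergK y x = of_real (corr2 x y)"
  unfolding corr2_def bergK_diag by (subst cnj_bergK[of x y, symmetric]) (simp add: complex_norm_square[symmetric])

lemma corr_1: "corr (Suc 0) x = rho (x 0)"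
proof -
  have "{p. p permutes {0::nat}} = {id}" by (auto simp: permutes_sing)
  then show ?thesis by (simp add: corr_def detk_def lessThan_Suc bergK_diag sign_id)
qed

lemma detk_2: "detk 2 M = M 0 0 * M 1 1 - M 0 1 * M 1 0"
proof -
  have 2: "{..<2::nat} = insert 0 {1}" by auto
  show ?thesis unfolding detk_def 2
    by (subst sum_over_permutations_insert) (auto simp: permutes_sing sign_id sign_swap_id)
qed

lemma corr_2:
  assumes "x 0 \<in> disk" "x 1 \<in> disk" shows "corr 2 x = corr2 (x 0) (x 1)"
  using corr2_nonneg[OF assms] corr2_eq[of "x 0" "x 1"] by (simp add: corr_def detk_2)

lemma corr_4:
  assumes x: "\<And>i. i < 4 \<Longrightarrow> x i \<in> disk"
  shows "\<bar>corr 4 x - corr2 (x 0) (x 1) * corr2 (x 2) (x 3)\<bar> \<le> 24 *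
    ((cmod (bergK (x 0) (x 2)))\<^sup>2 * rho (x 1) * rho (x 3) + (cmod (bergK (x 0) (x 3)))\<^sup>2 * rho (x 1) * rho (x 2)
     + (cmod (bergK (x 1) (x 2)))\<^sup>2 * rho (x 0) * rho (x 3) + (cmod (bergK (x 1) (x 3)))\<^sup>2 * rho (x 0) * rho (x 2))"
    (is "_ \<le> 24 * ?T")
proof -
  let ?M = "\<lambda>i j. bergK (x i) (x j)"
  let ?f = "\<lambda>p. of_int (sign p) * (\<Prod>i<4. ?M i (p i)) :: complex"
  let ?S = "{p. p permutes {..<4::nat}}" and ?N = "{p. p permutes {..<4::nat} \<and> p 0 \<in> {0,1} \<and> p 1 \<in> {0,1}}"
  let ?q = "corr2 (x 0) (x 1) * corr2 (x 2) (x 3)"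
  have finS: "finite ?S" by (rule finite_permutations) simp
  have N: "sum ?f ?N = of_real ?q"
    using noncrossing_sum[of ?M] by (simp only: corr2_eq of_real_mult)
  have "detk 4 ?M = sum ?f ?N + sum ?f (?S - ?N)"
    unfolding detk_def using finS by (subst sum.subset_diff[of ?N ?S]) (auto simp: add.commute)
  then have diff: "detk 4 ?M - of_real ?q = sum ?f (?S - ?N)" unfolding N by simp
  have T0: "0 \<le> ?T" by simp
  have "cmod (sum ?f (?S - ?N)) \<le> (\<Sum>p\<in>?S - ?N. ?T)"
  proof (rule order_trans[OF norm_sum sum_mono])
    fix p assume "p \<in> ?S - ?N"
    then have "cmod (\<Prod>i<4. ?M i (p i)) \<le> ?T"
      using x norm_bergK_commute norm_bergK_le by (intro crossing_term_le) auto
    then show "cmod (?f p) \<le> ?T" by (simp add: norm_mult sign_def)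
  qed
  also have "\<dots> = real (card (?S - ?N)) * ?T" by simp
  also have "\<dots> \<le> 24 * ?T"
  proof (intro mult_right_mono T0)
    have "card (?S - ?N) \<le> card ?S" using finS by (intro card_mono) auto
    also have "\<dots> = 24" by (subst card_permutations[of _ 4]) (auto simp: fact_numeral)
    finally show "real (card (?S - ?N)) \<le> 24" by simp
  qed
  finally have "cmod (detk 4 ?M - of_real ?q) \<le> 24 * ?T" unfolding diff .
  then have "\<bar>Re (detk 4 ?M) - ?q\<bar> \<le> 24 * ?T"
    using abs_Re_le_cmod[of "detk 4 ?M - of_real ?q"] by simp
  \<comment> \<open>The comparison value is nonnegative, so truncating the determinant at 0 can only
    bring it closer.\<close>
  moreover have "0 \<le> ?q" using x by (intro mult_nonneg_nonneg corr2_nonneg) auto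
  ultimately show ?thesis unfolding corr_def by (auto simp: max_def)
qed

section \<open>Squares of sums as sums over distinct points\<close>

lemma sum_PiE_lessThan_Suc:
  "(\<Sum>t\<in>PiE {..<Suc k} (\<lambda>_. Y). f t) = (\<Sum>t\<in>PiE {..<k} (\<lambda>_. Y). \<Sum>y\<in>Y. f (t(k := y)))"
proof -
  have "(\<Sum>t\<in>PiE {..<Suc k} (\<lambda>_. Y). f t) = (\<Sum>t\<in>(\<lambda>(y, g). g(k := y)) ` (Y \<times> PiE {..<k} (\<lambda>_. Y)). f t)"
    by (simp add: lessThan_Suc PiE_insert_eq)
  also have "\<dots> = (\<Sum>(y, g)\<in>Y \<times> PiE {..<k} (\<lambda>_. Y). f (g(k := y)))"
    using inj_combinator[of k "{..<k}" "\<lambda>_. Y"] by (subst sum.reindex) (auto simp: case_prod_unfold)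
  also have "\<dots> = (\<Sum>y\<in>Y. \<Sum>g\<in>PiE {..<k} (\<lambda>_. Y). f (g(k := y)))"
    by (simp add: sum.cartesian_product)
  also have "\<dots> = (\<Sum>g\<in>PiE {..<k} (\<lambda>_. Y). \<Sum>y\<in>Y. f (g(k := y)))" by (rule sum.swap)
  finally show ?thesis .
qed

lemma sum_PiE_lessThan_0: "(\<Sum>t\<in>PiE {..<0::nat} (\<lambda>_. Y). f t) = f (\<lambda>_. undefined)"
  by simp

lemma distinct_sum_1: "distinct_sum (Suc 0) (\<lambda>t. h (t 0)) Y = (\<Sum>a\<in>Y. h a)"
  unfolding distinct_sum_def sum_PiE_lessThan_Suc sum_PiE_lessThan_0 by (simp add: lessThan_Suc)

lemma distinct_sum_2: "distinct_sum 2 (\<lambda>t. h (t 0) (t 1)) Y = (\<Sum>a\<in>Y. \<Sum>b\<in>Y. if a \<noteq> b then h a b else 0)"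
  unfolding distinct_sum_def numeral_2_eq_2 sum_PiE_lessThan_Suc sum_PiE_lessThan_0
  by (intro sum.cong refl) (auto simp: lessThan_Suc)

lemma distinct_sum_3: "distinct_sum 3 (\<lambda>t. h (t 0) (t 1) (t 2)) Y =
    (\<Sum>a\<in>Y. \<Sum>b\<in>Y. \<Sum>c\<in>Y. if distinct [a, b, c] then h a b c else 0)"
  unfolding distinct_sum_def numeral_3_eq_3 sum_PiE_lessThan_Suc sum_PiE_lessThan_0
  by (intro sum.cong refl) (auto simp: lessThan_Suc numeral_2_eq_2)

lemma distinct_sum_4: "distinct_sum 4 (\<lambda>t. h (t 0) (t 1) (t 2) (t 3)) Y =
    (\<Sum>a\<in>Y. \<Sum>b\<in>Y. \<Sum>c\<in>Y. \<Sum>d\<in>Y. if distinct [a, b, c, d] then h a b c d else 0)"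
proof -
  have 4: "(4::nat) = Suc (Suc (Suc (Suc 0)))" by simp
  show ?thesis unfolding distinct_sum_def 4 sum_PiE_lessThan_Suc sum_PiE_lessThan_0
    by (intro sum.cong refl) (auto simp: lessThan_Suc numeral_2_eq_2 numeral_3_eq_3)
qed

text \<open>Two ordered pairs are disjoint, share one point or consist of the same points. One
  shared point arises in four ways, which agree by the symmetry of \<open>G\<close>; the same two
  points arise in two orders. This explains the coefficients 4 and 2.\<close>

lemma offdiag_sum_square:
  fixes G :: "'a \<Rightarrow> 'a \<Rightarrow> real"
  assumes Y: "finite Y" and sym: "\<And>a b. G a b = G b a"
  shows "(\<Sum>a\<in>Y. \<Sum>b\<in>Y. if a \<noteq> b then G a b else 0)\<^sup>2 =
     (\<Sum>a\<in>Y. \<Sum>b\<in>Y. \<Sum>c\<in>Y. \<Sum>d\<in>Y. if distinct [a, b, c, d] then G a b * G c d else 0)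
     + 4 * (\<Sum>a\<in>Y. \<Sum>b\<in>Y. \<Sum>c\<in>Y. if distinct [a, b, c] then G a b * G a c else 0)
     + 2 * (\<Sum>a\<in>Y. \<Sum>b\<in>Y. if a \<noteq> b then (G a b)\<^sup>2 else 0)"
proof -
  let ?H = "\<lambda>a b. if a \<noteq> b then G a b else 0"
  let ?T = "\<lambda>a b c. if distinct [a, b, c] then G a b * G a c else 0"
  let ?S3 = "\<Sum>a\<in>Y. \<Sum>b\<in>Y. \<Sum>c\<in>Y. ?T a b c"
  let ?S2 = "\<Sum>a\<in>Y. \<Sum>b\<in>Y. if a \<noteq> b then (G a b)\<^sup>2 else 0"
  have "(\<Sum>a\<in>Y. \<Sum>b\<in>Y. ?H a b)\<^sup>2 = (\<Sum>a\<in>Y. \<Sum>b\<in>Y. \<Sum>c\<in>Y. \<Sum>d\<in>Y. ?H a b * ?H c d)"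
    unfolding power2_eq_square sum_distrib_right by (simp only: sum_distrib_left)
  also have "\<dots> = (\<Sum>a\<in>Y. \<Sum>b\<in>Y. \<Sum>c\<in>Y. \<Sum>d\<in>Y.
      (if distinct [a, b, c, d] then G a b * G c d else 0)
      + (if a = c then ?T a b d else 0) + (if a = d then ?T a b c else 0)
      + (if b = c then ?T b a d else 0) + (if b = d then ?T b a c else 0)
      + (if b = d then (if a = c then (if a \<noteq> b then (G a b)\<^sup>2 else 0) else 0) else 0)
      + (if a = d then (if b = c then (if a \<noteq> b then (G a b)\<^sup>2 else 0) else 0) else 0))"
    by (intro sum.cong refl) (auto simp: power2_eq_square sym)
  also have "\<dots> = (\<Sum>a\<in>Y. \<Sum>b\<in>Y. \<Sum>c\<in>Y. \<Sum>d\<in>Y. if distinct [a, b, c, d] then G a b * G c d else 0)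
      + (\<Sum>a\<in>Y. \<Sum>b\<in>Y. \<Sum>c\<in>Y. \<Sum>d\<in>Y. if a = c then ?T a b d else 0)
      + (\<Sum>a\<in>Y. \<Sum>b\<in>Y. \<Sum>c\<in>Y. \<Sum>d\<in>Y. if a = d then ?T a b c else 0)
      + (\<Sum>a\<in>Y. \<Sum>b\<in>Y. \<Sum>c\<in>Y. \<Sum>d\<in>Y. if b = c then ?T b a d else 0)
      + (\<Sum>a\<in>Y. \<Sum>b\<in>Y. \<Sum>c\<in>Y. \<Sum>d\<in>Y. if b = d then ?T b a c else 0)
      + (\<Sum>a\<in>Y. \<Sum>b\<in>Y. \<Sum>c\<in>Y. \<Sum>d\<in>Y. if b = d then (if a = c then (if a \<noteq> b then (G a b)\<^sup>2 else 0) else 0) else 0)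
      + (\<Sum>a\<in>Y. \<Sum>b\<in>Y. \<Sum>c\<in>Y. \<Sum>d\<in>Y. if a = d then (if b = c then (if a \<noteq> b then (G a b)\<^sup>2 else 0) else 0) else 0)"
    by (simp only: sum.distrib)
  also have "(\<Sum>a\<in>Y. \<Sum>b\<in>Y. \<Sum>c\<in>Y. \<Sum>d\<in>Y. if a = c then ?T a b d else 0) = ?S3"
    by (rule sum.cong[OF refl], rule sum.cong[OF refl], subst sum.swap) (simp add: Y sum.delta' cong: if_cong)
  also have "(\<Sum>a\<in>Y. \<Sum>b\<in>Y. \<Sum>c\<in>Y. \<Sum>d\<in>Y. if a = d then ?T a b c else 0) = ?S3"
    by (rule sum.cong[OF refl], rule sum.cong[OF refl]) (simp add: Y sum.delta' cong: if_cong)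
  also have "(\<Sum>a\<in>Y. \<Sum>b\<in>Y. \<Sum>c\<in>Y. \<Sum>d\<in>Y. if b = c then ?T b a d else 0) = ?S3"
    by (subst sum.swap, rule sum.cong[OF refl], rule sum.cong[OF refl], subst sum.swap) (simp add: Y sum.delta' cong: if_cong)
  also have "(\<Sum>a\<in>Y. \<Sum>b\<in>Y. \<Sum>c\<in>Y. \<Sum>d\<in>Y. if b = d then ?T b a c else 0) = ?S3"
    by (subst sum.swap, rule sum.cong[OF refl], rule sum.cong[OF refl]) (simp add: Y sum.delta' cong: if_cong)
  also have "(\<Sum>a\<in>Y. \<Sum>b\<in>Y. \<Sum>c\<in>Y. \<Sum>d\<in>Y. if b = d then (if a = c then (if a \<noteq> b then (G a b)\<^sup>2 else 0) else 0) else 0) = ?S2"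
    by (rule sum.cong[OF refl], rule sum.cong[OF refl]) (simp add: Y sum.delta' cong: if_cong)
  also have "(\<Sum>a\<in>Y. \<Sum>b\<in>Y. \<Sum>c\<in>Y. \<Sum>d\<in>Y. if a = d then (if b = c then (if a \<noteq> b then (G a b)\<^sup>2 else 0) else 0) else 0) = ?S2"
    by (rule sum.cong[OF refl], rule sum.cong[OF refl]) (simp add: Y sum.delta' cong: if_cong)
  finally show ?thesis by simp
qed

lemma sum_square_offdiag:
  fixes h :: "'a \<Rightarrow> real"
  assumes "finite Y"
  shows "(\<Sum>a\<in>Y. h a)\<^sup>2 = (\<Sum>a\<in>Y. (h a)\<^sup>2) + (\<Sum>a\<in>Y. \<Sum>b\<in>Y. if a \<noteq> b then h a * h b else 0)"
proof -
  have "(\<Sum>a\<in>Y. h a)\<^sup>2 = (\<Sum>a\<in>Y. \<Sum>b\<in>Y. (if a = b then (h a)\<^sup>2 else 0) + (if a \<noteq> b then h a * h b else 0))"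
    unfolding power2_eq_square sum_product by (intro sum.cong refl) auto
  then show ?thesis using assms by (simp add: sum.distrib)
qed

section \<open>Iterated integrals over powers of a finite measure\<close>

lemma measurable_apply2:
  assumes h: "(\<lambda>(a, b). h a b) \<in> borel_measurable (borel \<Otimes>\<^sub>M borel)"
    and "a \<in> borel_measurable N" "b \<in> borel_measurable N"
  shows "(\<lambda>x. h (a x) (b x)) \<in> borel_measurable N"
  using measurable_compose[OF measurable_Pair[OF assms(2,3)] h] by simp

lemma measurable_apply3:
  assumes h: "(\<lambda>(a, b, c). h a b c) \<in> borel_measurable (borel \<Otimes>\<^sub>M borel \<Otimes>\<^sub>M borel)"
    and "a \<in> borel_measurable N" "b \<in> borel_measurable N" "c \<in> borel_measurable N"
  shows "(\<lambda>x. h (a x) (b x) (c x)) \<in> borel_measurable N"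
  using measurable_compose[OF measurable_Pair[OF assms(2) measurable_Pair[OF assms(3,4)]] h] by simp

lemma measurable_apply4:
  assumes h: "(\<lambda>(a, b, c, d). h a b c d) \<in> borel_measurable (borel \<Otimes>\<^sub>M borel \<Otimes>\<^sub>M borel \<Otimes>\<^sub>M borel)"
    and "a \<in> borel_measurable N" "b \<in> borel_measurable N" "c \<in> borel_measurable N" "d \<in> borel_measurable N"
  shows "(\<lambda>x. h (a x) (b x) (c x) (d x)) \<in> borel_measurable N"
  using measurable_compose[OF measurable_Pair[OF assms(2) measurable_Pair[OF assms(3) measurable_Pair[OF assms(4,5)]]] h] by simp

lemma integrable_bounded:
  fixes f :: "'z \<Rightarrow> real"
  assumes "finite_measure N" "f \<in> borel_measurable N" "\<And>x. \<bar>f x\<bar> \<le> B"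
  shows "integrable N f"
  using finite_measure.integrable_const_bound[OF assms(1), of f B] assms by auto

context
  fixes \<nu> :: "complex measure"
  assumes fin: "finite_measure \<nu>" and sets_nu [measurable_cong]: "sets \<nu> = sets borel"
begin

interpretation finite_measure \<nu> by (rule fin)
interpretation product_sigma_finite "\<lambda>_::nat. \<nu>" by standard

lemma nn_integral_PiM_Suc:
  assumes "f \<in> borel_measurable (PiM {..<Suc k} (\<lambda>_. \<nu>))"
  shows "(\<integral>\<^sup>+x. f x \<partial>PiM {..<Suc k} (\<lambda>_. \<nu>)) = (\<integral>\<^sup>+x. (\<integral>\<^sup>+y. f (x(k := y)) \<partial>\<nu>) \<partial>PiM {..<k} (\<lambda>_. \<nu>))"
  using assms unfolding lessThan_Suc by (intro product_nn_integral_insert) auto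

lemma integral_PiM_Suc:
  fixes f :: "(nat \<Rightarrow> complex) \<Rightarrow> real"
  assumes "integrable (PiM {..<Suc k} (\<lambda>_. \<nu>)) f"
  shows "(\<integral>x. f x \<partial>PiM {..<Suc k} (\<lambda>_. \<nu>)) = (\<integral>x. (\<integral>y. f (x(k := y)) \<partial>\<nu>) \<partial>PiM {..<k} (\<lambda>_. \<nu>))"
  using assms unfolding lessThan_Suc by (intro product_integral_insert) auto

lemma nn_integral_PiM_1:
  assumes "h \<in> borel_measurable borel"
  shows "(\<integral>\<^sup>+x. h (x 0) \<partial>PiM {..<Suc 0} (\<lambda>_. \<nu>)) = (\<integral>\<^sup>+a. h a \<partial>\<nu>)"
proof -
  have "{..<Suc 0} = {0::nat}" by auto
  moreover have "h \<in> borel_measurable \<nu>" using assms by measurable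
  ultimately show ?thesis using product_nn_integral_singleton[of h 0] by simp
qed

lemma nn_integral_PiM_2:
  assumes h: "(\<lambda>(a, b). h a b) \<in> borel_measurable (borel \<Otimes>\<^sub>M borel)"
  shows "(\<integral>\<^sup>+x. h (x 0) (x 1) \<partial>PiM {..<2::nat} (\<lambda>_. \<nu>)) = (\<integral>\<^sup>+a. \<integral>\<^sup>+b. h a b \<partial>\<nu> \<partial>\<nu>)"
proof -
  have "(\<integral>\<^sup>+x. h (x 0) (x 1) \<partial>PiM {..<Suc 1} (\<lambda>_. \<nu>)) = (\<integral>\<^sup>+x. (\<integral>\<^sup>+b. h (x 0) b \<partial>\<nu>) \<partial>PiM {..<1::nat} (\<lambda>_. \<nu>))"
    by (subst nn_integral_PiM_Suc) (auto intro!: measurable_apply2[OF h])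
  also have "\<dots> = (\<integral>\<^sup>+a. \<integral>\<^sup>+b. h a b \<partial>\<nu> \<partial>\<nu>)"
    unfolding One_nat_def
    by (rule nn_integral_PiM_1, rule borel_measurable_nn_integral, unfold split_beta', intro measurable_apply2[OF h]) measurable
  finally show ?thesis by (simp add: numeral_2_eq_2)
qed

lemma nn_integral_PiM_3:
  assumes h: "(\<lambda>(a, b, c). h a b c) \<in> borel_measurable (borel \<Otimes>\<^sub>M borel \<Otimes>\<^sub>M borel)"
  shows "(\<integral>\<^sup>+x. h (x 0) (x 1) (x 2) \<partial>PiM {..<3::nat} (\<lambda>_. \<nu>)) = (\<integral>\<^sup>+a. \<integral>\<^sup>+b. \<integral>\<^sup>+c. h a b c \<partial>\<nu> \<partial>\<nu> \<partial>\<nu>)"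
proof -
  have "(\<integral>\<^sup>+x. h (x 0) (x 1) (x 2) \<partial>PiM {..<Suc 2} (\<lambda>_. \<nu>)) = (\<integral>\<^sup>+x. (\<integral>\<^sup>+c. h (x 0) (x 1) c \<partial>\<nu>) \<partial>PiM {..<2::nat} (\<lambda>_. \<nu>))"
    by (subst nn_integral_PiM_Suc) (auto intro!: measurable_apply3[OF h])
  also have "\<dots> = (\<integral>\<^sup>+a. \<integral>\<^sup>+b. \<integral>\<^sup>+c. h a b c \<partial>\<nu> \<partial>\<nu> \<partial>\<nu>)"
    by (rule nn_integral_PiM_2[where h = "\<lambda>a b. \<integral>\<^sup>+c. h a b c \<partial>\<nu>"], unfold split_beta',
        rule borel_measurable_nn_integral, unfold split_beta', intro measurable_apply3[OF h]) measurable
  finally show ?thesis by simp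
qed

lemma nn_integral_PiM_4:
  assumes h: "(\<lambda>(a, b, c, d). h a b c d) \<in> borel_measurable (borel \<Otimes>\<^sub>M borel \<Otimes>\<^sub>M borel \<Otimes>\<^sub>M borel)"
  shows "(\<integral>\<^sup>+x. h (x 0) (x 1) (x 2) (x 3) \<partial>PiM {..<4::nat} (\<lambda>_. \<nu>)) = (\<integral>\<^sup>+a. \<integral>\<^sup>+b. \<integral>\<^sup>+c. \<integral>\<^sup>+d. h a b c d \<partial>\<nu> \<partial>\<nu> \<partial>\<nu> \<partial>\<nu>)"
proof -
  have "(\<integral>\<^sup>+x. h (x 0) (x 1) (x 2) (x 3) \<partial>PiM {..<Suc 3} (\<lambda>_. \<nu>)) = (\<integral>\<^sup>+x. (\<integral>\<^sup>+d. h (x 0) (x 1) (x 2) d \<partial>\<nu>) \<partial>PiM {..<3::nat} (\<lambda>_. \<nu>))"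
    by (subst nn_integral_PiM_Suc) (auto intro!: measurable_apply4[OF h])
  also have "\<dots> = (\<integral>\<^sup>+a. \<integral>\<^sup>+b. \<integral>\<^sup>+c. \<integral>\<^sup>+d. h a b c d \<partial>\<nu> \<partial>\<nu> \<partial>\<nu> \<partial>\<nu>)"
    by (rule nn_integral_PiM_3[where h = "\<lambda>a b c. \<integral>\<^sup>+d. h a b c d \<partial>\<nu>"], unfold split_beta',
        rule borel_measurable_nn_integral, unfold split_beta', intro measurable_apply4[OF h]) measurable
  finally show ?thesis by simp
qed

lemma integral_PiM_1:
  fixes h :: "complex \<Rightarrow> real"
  assumes [measurable]: "h \<in> borel_measurable borel"
  shows "(\<integral>x. h (x 0) \<partial>PiM {..<Suc 0} (\<lambda>_. \<nu>)) = (\<integral>a. h a \<partial>\<nu>)"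
proof -
  have "{..<Suc 0} = {0::nat}" by auto
  then show ?thesis using product_integral_singleton[of h 0] by simp
qed

lemma integral_PiM_2:
  fixes h :: "complex \<Rightarrow> complex \<Rightarrow> real"
  assumes h: "(\<lambda>(a, b). h a b) \<in> borel_measurable (borel \<Otimes>\<^sub>M borel)" and b: "\<And>a b. \<bar>h a b\<bar> \<le> B"
  shows "(\<integral>x. h (x 0) (x 1) \<partial>PiM {..<2::nat} (\<lambda>_. \<nu>)) = (\<integral>a. \<integral>b. h a b \<partial>\<nu> \<partial>\<nu>)"
proof -
  note [measurable (raw)] = measurable_apply2[OF h]
  have "(\<integral>x. h (x 0) (x 1) \<partial>PiM {..<Suc (Suc 0)} (\<lambda>_. \<nu>)) = (\<integral>x. (\<integral>b. h (x 0) b \<partial>\<nu>) \<partial>PiM {..<Suc 0} (\<lambda>_. \<nu>))"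
    by (subst integral_PiM_Suc) (auto intro!: integrable_bounded[OF finite_measure_PiM[OF fin] _ b] measurable_apply2[OF h])
  also have "\<dots> = (\<integral>a. \<integral>b. h a b \<partial>\<nu> \<partial>\<nu>)"
    by (rule integral_PiM_1, rule borel_measurable_lebesgue_integral, unfold split_beta', intro measurable_apply2[OF h]) measurable
  finally show ?thesis by (simp add: numeral_2_eq_2)
qed

text \<open>Integrating the last coordinate replaces the second factor by its marginal
  \<open>g\<close>, and the next integration makes it constant. Read backwards, a squared mean
  becomes an integral over four points, ready to be compared with a four-point correlation.\<close>

lemma integral_PiM_4_product:
  fixes h :: "complex \<Rightarrow> complex \<Rightarrow> real"
  assumes h: "(\<lambda>(a, b). h a b) \<in> borel_measurable (borel \<Otimes>\<^sub>M borel)" and b: "\<And>a b. \<bar>h a b\<bar> \<le> B"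
  shows "(\<integral>x. h (x 0) (x 1) * h (x 2) (x 3) \<partial>PiM {..<4::nat} (\<lambda>_. \<nu>)) = (\<integral>a. \<integral>b. h a b \<partial>\<nu> \<partial>\<nu>)\<^sup>2"
proof -
  note [measurable (raw)] = measurable_apply2[OF h]
  have B0: "0 \<le> B" using b[of undefined undefined] by linarith
  define g where "g = (\<lambda>a. \<integral>b. h a b \<partial>\<nu>)"
  have [measurable]: "g \<in> borel_measurable borel" unfolding g_def by measurable
  have gb: "\<bar>g a\<bar> \<le> B * measure \<nu> (space \<nu>)" for a
  proof -
    have "\<bar>g a\<bar> \<le> (\<integral>b. \<bar>h a b\<bar> \<partial>\<nu>)" unfolding g_def by (rule integral_abs_bound)
    also have "\<dots> \<le> (\<integral>b. B \<partial>\<nu>)"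
      by (intro integral_mono integrable_bounded[OF fin _ b] integrable_abs) (auto intro: b)
    finally show ?thesis by (simp add: mult.commute)
  qed
  have "(\<integral>x. h (x 0) (x 1) * h (x 2) (x 3) \<partial>PiM {..<Suc 3} (\<lambda>_. \<nu>)) = (\<integral>x. h (x 0) (x 1) * g (x 2) \<partial>PiM {..<Suc 2} (\<lambda>_. \<nu>))"
    unfolding g_def
    by (subst integral_PiM_Suc) (rule integrable_bounded[OF finite_measure_PiM[OF fin], where B = "B * B"], measurable,
        auto simp: abs_mult intro!: mult_mono b B0)
  also have "\<dots> = (\<integral>x. h (x 0) (x 1) * (\<integral>c. g c \<partial>\<nu>) \<partial>PiM {..<2::nat} (\<lambda>_. \<nu>))"
    by (subst integral_PiM_Suc) (rule integrable_bounded[OF finite_measure_PiM[OF fin], where B = "B * (B * measure \<nu> (space \<nu>))"], measurable,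
        auto simp: abs_mult intro!: mult_mono b B0 gb)
  also have "\<dots> = (\<integral>a. \<integral>b. h a b \<partial>\<nu> \<partial>\<nu>)\<^sup>2"
    using integral_PiM_2[OF h b] by (simp add: g_def power2_eq_square)
  finally show ?thesis by simp
qed

end

section \<open>Mean and variance of the quadratic statistic\<close>

lemma tendsto_rho:
  assumes "(X \<longlongrightarrow> x) F" "x \<in> disk" shows "((\<lambda>n. rho (X n)) \<longlongrightarrow> rho x) F"
  unfolding rho_def using assms(1) one_minus_norm_pos[OF assms(2)] by (intro tendsto_intros) auto

lemma tendsto_bergK:
  assumes "(X \<longlongrightarrow> x) F" "(Y \<longlongrightarrow> y) F" "x \<in> disk" "y \<in> disk"
  shows "((\<lambda>n. bergK (X n) (Y n)) \<longlongrightarrow> bergK x y) F"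
proof -
  have "0 < (cmod (1 - x * cnj y))\<^sup>2"
    unfolding one_minus_norm_mult using assms by (intro add_pos_nonneg mult_pos_pos one_minus_norm_pos) auto
  then have "1 - x * cnj y \<noteq> 0" by auto
  then show ?thesis unfolding bergK_def using assms(1,2) by (intro tendsto_intros) auto
qed

lemma nn_integral_swap:
  assumes "finite_measure \<nu>" and [measurable_cong]: "sets \<nu> = sets borel"
    and g: "(\<lambda>(a, b). g a b) \<in> borel_measurable (borel \<Otimes>\<^sub>M borel)"
  shows "(\<integral>\<^sup>+a. \<integral>\<^sup>+b. g a b \<partial>\<nu> \<partial>\<nu>) = (\<integral>\<^sup>+b. \<integral>\<^sup>+a. g a b \<partial>\<nu> \<partial>\<nu>)"
proof -
  interpret finite_measure \<nu> by fact
  interpret pair_sigma_finite \<nu> \<nu> by standard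
  have "(\<lambda>(a, b). g a b) \<in> borel_measurable (\<nu> \<Otimes>\<^sub>M \<nu>)" using g by measurable
  from Fubini'[of g] this show ?thesis by simp
qed

text \<open>All error terms are controlled by \<open>J\<close>, through a majorant \<open>m\<close> of the integral operator with
  kernel \<open>\<bar>bergK\<bar>\<close> applied to the weight \<open>f * rho\<close>.\<close>
locale weighted_DPP =
  fixes P :: "complex set measure" and U :: "complex set" and f m :: "complex \<Rightarrow> real" and J :: real
  assumes P: "is_DPP_K P" and U: "relcpt U"
    and f_meas [measurable]: "f \<in> borel_measurable borel" and f0: "\<And>x. 0 \<le> f x" and f1: "\<And>x. f x \<le> 1"
    and fU: "\<And>x. x \<notin> U \<Longrightarrow> f x = 0" and fc: "continuous_on U f"
    and m_meas [measurable]: "m \<in> borel_measurable borel" and m0: "\<And>x. 0 \<le> m x"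
    and schur: "\<And>x. x \<in> U \<Longrightarrow> (\<integral>\<^sup>+y. ennreal (f y * cmod (bergK x y) * rho y) \<partial>area_on U) \<le> ennreal (m x)"
    and ptw: "\<And>x y. x \<in> U \<Longrightarrow> y \<in> U \<Longrightarrow> f y * cmod (bergK x y) \<le> m x"
    and J: "(\<integral>\<^sup>+x. ennreal ((f x)\<^sup>2 * (m x)\<^sup>2 * rho x) \<partial>area_on U) \<le> ennreal J" and J0: "0 \<le> J"
begin

abbreviation "\<nu> \<equiv> area_on U"

text \<open>\<open>G x y\<close> is the real part of the inner product of the vectors
  \<open>f x * K(., x)\<close> and \<open>f y * K(., y)\<close>. Since the weights are real and the
  kernel is Hermitian, imaginary parts cancel in the double sum, so \<open>Q\<close> is a squared
  norm.\<close>

definition G :: "complex \<Rightarrow> complex \<Rightarrow> real" where "G x y = f x * f y * Re (bergK x y)"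
definition h :: "complex \<Rightarrow> real" where "h x = (f x)\<^sup>2 * rho x"
definition Diag :: "complex set \<Rightarrow> real" where "Diag X = (\<Sum>a\<in>X \<inter> U. h a)"
definition Off :: "complex set \<Rightarrow> real" where "Off X = (\<Sum>a\<in>X \<inter> U. \<Sum>b\<in>X \<inter> U. if a \<noteq> b then G a b else 0)"
definition Q :: "complex set \<Rightarrow> real" where "Q X = (\<Sum>a\<in>X \<inter> U. \<Sum>b\<in>X \<inter> U. G a b)"

lemma Ud: "U \<subseteq> disk" and Ub [measurable]: "U \<in> sets borel"
  using U relcpt_subset_disk by (auto simp: relcpt_def)

sublocale A: finite_measure "area_on U" by (rule finite_measure_area_on[OF Ud Ub])
sublocale P: prob_space P using P by (simp add: is_DPP_K_def)

lemmas fin_nu = A.finite_measure_axioms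

lemma borel_measurable_G [measurable (raw)]:
  assumes [measurable]: "a \<in> borel_measurable N" "b \<in> borel_measurable N"
  shows "(\<lambda>x. G (a x) (b x)) \<in> borel_measurable N"
  unfolding G_def by measurable

lemma borel_measurable_h [measurable]: "h \<in> borel_measurable borel"
  unfolding h_def by measurable

lemma G_sym: "G a b = G b a"
  unfolding G_def by (subst cnj_bergK[symmetric]) (simp add: mult_ac)

lemma G_diag: "G a a = h a"
  by (simp add: G_def h_def bergK_diag power2_eq_square)

lemma G_zero: "a \<notin> U \<Longrightarrow> G a b = 0" "b \<notin> U \<Longrightarrow> G a b = 0"
  by (simp_all add: G_def fU)

lemma h_zero: "a \<notin> U \<Longrightarrow> h a = 0" by (simp add: h_def fU)
lemma h_nonneg: "0 \<le> h a" by (simp add: h_def)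

lemma abs_G_le: "\<bar>G a b\<bar> \<le> f a * f b * cmod (bergK a b)"
  using abs_Re_le_cmod[of "bergK a b"] f0 by (simp add: G_def abs_mult mult_left_mono)

text \<open>A uniform bound on \<open>rho\<close> over \<open>U\<close>. It provides boundedness and
  hence integrability; the quantitative estimates are expressed through \<open>J\<close>
  instead.\<close>

definition R :: real where "R = (SOME R. 0 \<le> R \<and> (\<forall>x\<in>U. rho x \<le> R))"

lemma R: "0 \<le> R" "\<And>x. x \<in> U \<Longrightarrow> rho x \<le> R"
proof -
  obtain r where r: "0 \<le> r" "r < 1" "U \<subseteq> cball 0 r" using relcpt_cball[OF U] by blast
  have "0 \<le> R \<and> (\<forall>x\<in>U. rho x \<le> R)"
    unfolding R_def by (rule someI[of _ "1 / (1 - r\<^sup>2)\<^sup>2"]) (use r rho_le[OF subsetD[OF r(3)]] in auto)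
  then show "0 \<le> R" "\<And>x. x \<in> U \<Longrightarrow> rho x \<le> R" by auto
qed

lemma norm_K_le_R: "a \<in> U \<Longrightarrow> b \<in> U \<Longrightarrow> cmod (bergK a b) \<le> R"
proof -
  assume ab: "a \<in> U" "b \<in> U"
  have "(cmod (bergK a b))\<^sup>2 \<le> rho a * rho b" using ab Ud by (intro norm_bergK_le) auto
  also have "\<dots> \<le> R * R" using ab R by (intro mult_mono) auto
  finally have "(cmod (bergK a b))\<^sup>2 \<le> R\<^sup>2" by (simp only: power2_eq_square)
  then show ?thesis by (rule power2_le_imp_le) (rule R(1))
qed

lemma G_bound: "\<bar>G a b\<bar> \<le> R"
proof (cases "a \<in> U \<and> b \<in> U")
  case True
  have "\<bar>G a b\<bar> \<le> f a * f b * cmod (bergK a b)" by (rule abs_G_le)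
  also have "\<dots> \<le> 1 * R" using True by (intro mult_mono mult_le_one f0 f1 norm_K_le_R) auto
  finally show ?thesis by simp
qed (use G_zero R in auto)

lemma h_bound: "\<bar>h a\<bar> \<le> R" using G_bound[of a a] by (simp add: G_diag)

lemma corr2_bound: "a \<in> U \<Longrightarrow> b \<in> U \<Longrightarrow> 0 \<le> corr2 a b \<and> corr2 a b \<le> rho a * rho b \<and> corr2 a b \<le> R * R"
proof -
  assume ab: "a \<in> U" "b \<in> U"
  have "rho a * rho b \<le> R * R" using ab R by (intro mult_mono) auto
  moreover have "corr2 a b \<le> rho a * rho b" by (simp add: corr2_def)
  moreover have "0 \<le> corr2 a b" using ab Ud by (intro corr2_nonneg) auto
  ultimately show ?thesis by simp
qed

lemma borel_measurable_corr2 [measurable (raw)]: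
  assumes [measurable]: "a \<in> borel_measurable N" "b \<in> borel_measurable N"
  shows "(\<lambda>x. corr2 (a x) (b x)) \<in> borel_measurable N"
  unfolding corr2_def by measurable

lemma f_tendsto: "(\<And>n. X n \<in> U) \<Longrightarrow> x \<in> U \<Longrightarrow> (X \<longlonglongrightarrow> x) \<Longrightarrow> (\<lambda>n. f (X n)) \<longlonglongrightarrow> f x"
  by (rule continuous_on_tendsto_compose[OF fc]) (auto intro: always_eventually)

lemma h_tendsto: "(\<And>n. X n \<in> U) \<Longrightarrow> x \<in> U \<Longrightarrow> (X \<longlonglongrightarrow> x) \<Longrightarrow> (\<lambda>n. h (X n)) \<longlonglongrightarrow> h x"
  unfolding h_def using Ud by (intro tendsto_intros f_tendsto tendsto_rho) auto

lemma G_tendsto: "(\<And>n. X n \<in> U) \<Longrightarrow> x \<in> U \<Longrightarrow> (X \<longlonglongrightarrow> x) \<Longrightarrow> (\<And>n. Y n \<in> U) \<Longrightarrow> y \<in> U \<Longrightarrow> (Y \<longlonglongrightarrow> y) \<Longrightarrow>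
    (\<lambda>n. G (X n) (Y n)) \<longlonglongrightarrow> G x y"
  unfolding G_def using Ud by (intro tendsto_intros f_tendsto tendsto_bergK) auto

section \<open>Sums over single points and pairs, and the diagonal part\<close>

lemma campbell_1:
  assumes [measurable]: "F \<in> borel_measurable borel" and b: "\<And>a. \<bar>F a\<bar> \<le> C"
    and c: "\<And>X x. (\<And>n. X n \<in> U) \<Longrightarrow> x \<in> U \<Longrightarrow> (X \<longlonglongrightarrow> x) \<Longrightarrow> (\<lambda>n. F (X n)) \<longlonglongrightarrow> F x"
  shows "integrable P (\<lambda>X. \<Sum>a\<in>X \<inter> U. F a)" "(\<integral>X. (\<Sum>a\<in>X \<inter> U. F a) \<partial>P) = (\<integral>a. F a * rho a \<partial>\<nu>)"
proof -
  have mm: "(\<lambda>t. F (t 0)) \<in> borel_measurable (PiM {..<Suc 0} (\<lambda>_. \<nu>))" by measurable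
  have C: "integrable P (\<lambda>X. distinct_sum (Suc 0) (\<lambda>t. F (t 0)) (X \<inter> U))"
    "(\<integral>X. distinct_sum (Suc 0) (\<lambda>t. F (t 0)) (X \<inter> U) \<partial>P) = (\<integral>x. F (x 0) * corr (Suc 0) x \<partial>PiM {..<Suc 0} (\<lambda>_. \<nu>))"
    by (rule campbell[OF P U _ _ mm], rule b, rule c, auto simp: PiE_iff)+
  show "integrable P (\<lambda>X. \<Sum>a\<in>X \<inter> U. F a)"
    using C(1) by (simp add: distinct_sum_1)
  have "(\<integral>X. (\<Sum>a\<in>X \<inter> U. F a) \<partial>P) = (\<integral>x. F (x 0) * rho (x 0) \<partial>PiM {..<Suc 0} (\<lambda>_. \<nu>))"
    using C(2) by (simp add: distinct_sum_1 corr_1)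
  also have "\<dots> = (\<integral>a. F a * rho a \<partial>\<nu>)"
    by (rule integral_PiM_1[OF fin_nu]) auto
  finally show "(\<integral>X. (\<Sum>a\<in>X \<inter> U. F a) \<partial>P) = (\<integral>a. F a * rho a \<partial>\<nu>)" .
qed

lemma campbell_2:
  assumes F: "(\<lambda>(a, b). F a b) \<in> borel_measurable (borel \<Otimes>\<^sub>M borel)" and b: "\<And>a b. \<bar>F a b\<bar> \<le> C"
    and z: "\<And>a b. a \<notin> U \<or> b \<notin> U \<Longrightarrow> F a b = 0"
    and c: "\<And>X x Y y. (\<And>n. X n \<in> U) \<Longrightarrow> x \<in> U \<Longrightarrow> (X \<longlonglongrightarrow> x) \<Longrightarrow> (\<And>n. Y n \<in> U) \<Longrightarrow> y \<in> U \<Longrightarrow> (Y \<longlonglongrightarrow> y)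
      \<Longrightarrow> (\<lambda>n. F (X n) (Y n)) \<longlonglongrightarrow> F x y"
  shows "integrable P (\<lambda>X. \<Sum>a\<in>X \<inter> U. \<Sum>b\<in>X \<inter> U. if a \<noteq> b then F a b else 0)"
    "(\<integral>X. (\<Sum>a\<in>X \<inter> U. \<Sum>b\<in>X \<inter> U. if a \<noteq> b then F a b else 0) \<partial>P) = (\<integral>a. \<integral>b. F a b * corr2 a b \<partial>\<nu> \<partial>\<nu>)"
proof -
  have mm: "(\<lambda>t. F (t 0) (t 1)) \<in> borel_measurable (PiM {..<2::nat} (\<lambda>_. \<nu>))"
    by (intro measurable_apply2[OF F]) measurable
  have C1: "integrable P (\<lambda>X. distinct_sum 2 (\<lambda>t. F (t 0) (t 1)) (X \<inter> U))"
    by (rule campbell(1)[OF P U _ _ mm], rule b, rule c) (auto simp: PiE_iff)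
  have C2: "(\<integral>X. distinct_sum 2 (\<lambda>t. F (t 0) (t 1)) (X \<inter> U) \<partial>P) = (\<integral>x. F (x 0) (x 1) * corr 2 x \<partial>PiM {..<2::nat} (\<lambda>_. \<nu>))"
    by (rule campbell(2)[OF P U _ _ mm], rule b, rule c) (auto simp: PiE_iff)
  have C0: "0 \<le> C" using b[of 0 0] by linarith
  show "integrable P (\<lambda>X. \<Sum>a\<in>X \<inter> U. \<Sum>b\<in>X \<inter> U. if a \<noteq> b then F a b else 0)"
    using C1 unfolding distinct_sum_2 .
  have "(\<integral>X. (\<Sum>a\<in>X \<inter> U. \<Sum>b\<in>X \<inter> U. if a \<noteq> b then F a b else 0) \<partial>P) = (\<integral>x. F (x 0) (x 1) * corr 2 x \<partial>PiM {..<2::nat} (\<lambda>_. \<nu>))"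
    using C2 unfolding distinct_sum_2 .
  also have "\<dots> = (\<integral>x. F (x 0) (x 1) * corr2 (x 0) (x 1) \<partial>PiM {..<2::nat} (\<lambda>_. \<nu>))"
  proof (intro Bochner_Integration.integral_cong refl)
    fix x show "F (x 0) (x 1) * corr 2 x = F (x 0) (x 1) * corr2 (x 0) (x 1)"
      using z[of "x 0" "x 1"] corr_2[of x] Ud by (cases "x 0 \<in> U \<and> x 1 \<in> U") auto
  qed
  also have "\<dots> = (\<integral>a. \<integral>b. F a b * corr2 a b \<partial>\<nu> \<partial>\<nu>)"
  proof (rule integral_PiM_2[OF fin_nu, where B = "C * (R * R)"])
    show "(\<lambda>(a, b). F a b * corr2 a b) \<in> borel_measurable (borel \<Otimes>\<^sub>M borel)"
      unfolding split_beta' by (intro borel_measurable_times measurable_apply2[OF F] borel_measurable_corr2) measurable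
    show "\<bar>F a b * corr2 a b\<bar> \<le> C * (R * R)" for a b
      using z[of a b] corr2_bound[of a b] R(1) C0 b[of a b]
      by (cases "a \<in> U \<and> b \<in> U") (auto simp: abs_mult intro!: mult_mono)
  qed simp
  finally show "(\<integral>X. (\<Sum>a\<in>X \<inter> U. \<Sum>b\<in>X \<inter> U. if a \<noteq> b then F a b else 0) \<partial>P) = (\<integral>a. \<integral>b. F a b * corr2 a b \<partial>\<nu> \<partial>\<nu>)" .
qed

lemma integrable_nu: "g \<in> borel_measurable borel \<Longrightarrow> (\<And>x. \<bar>g x\<bar> \<le> B) \<Longrightarrow> integrable \<nu> (g :: _ \<Rightarrow> real)"
  by (rule integrable_bounded[OF fin_nu]) auto

lemma fin_X: "X \<in> space P \<Longrightarrow> finite (X \<inter> U)"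
  using Conf_finite[OF _ U] Conf_space_props(1)[of P] P by (auto simp: is_DPP_K_def)

lemma f_rho_le: "x \<in> U \<Longrightarrow> f x * rho x \<le> m x"
  using ptw[of x x] by (simp add: bergK_diag)

lemma Diag_expectation:
  shows "integrable P Diag" "(\<integral>X. Diag X \<partial>P) = (\<integral>a. h a * rho a \<partial>\<nu>)"
  unfolding Diag_def[abs_def]
  by (rule campbell_1[OF borel_measurable_h h_bound], rule h_tendsto; simp)+

lemma Off_expectation:
  shows "integrable P Off" "(\<integral>X. Off X \<partial>P) = (\<integral>a. \<integral>b. G a b * corr2 a b \<partial>\<nu> \<partial>\<nu>)"
  unfolding Off_def[abs_def]
  by (rule campbell_2[OF _ G_bound], unfold split_beta', measurable, use G_zero in blast, rule G_tendsto; simp)+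

lemma h_rho_bound: "\<bar>h a * rho a\<bar> \<le> R * R"
  using h_bound[of a] h_zero[of a] R by (cases "a \<in> U") (auto simp: abs_mult intro!: mult_mono)

text \<open>Repulsion: \<open>corr2 a b\<close> is at most \<open>rho a * rho b\<close> and
  \<open>h\<close> is nonnegative, so the pair part of the second moment does not exceed the squared
  mean. The variance is thus at most the integral of \<open>h\<^sup>2 * rho\<close>, and
  \<open>f * rho \<le> m\<close> turns this into \<open>J\<close>.\<close>

lemma Diag_variance:
  shows "integrable P (\<lambda>X. (Diag X)\<^sup>2)" "(\<integral>X. (Diag X)\<^sup>2 \<partial>P) - (\<integral>X. Diag X \<partial>P)\<^sup>2 \<le> J"
proof -
  let ?S1 = "\<lambda>X. \<Sum>a\<in>X \<inter> U. (h a)\<^sup>2" and ?S2 = "\<lambda>X. \<Sum>a\<in>X \<inter> U. \<Sum>b\<in>X \<inter> U. if a \<noteq> b then h a * h b else 0"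
  have hb2: "\<bar>(h a)\<^sup>2\<bar> \<le> R\<^sup>2" for a using power_mono[OF h_bound, of a 2] by simp
  have hhb: "\<bar>h a * h b\<bar> \<le> R * R" for a b
    using h_bound R by (auto simp: abs_mult intro!: mult_mono)
  have S1: "integrable P ?S1" "(\<integral>X. ?S1 X \<partial>P) = (\<integral>a. (h a)\<^sup>2 * rho a \<partial>\<nu>)"
    by (rule campbell_1[of "\<lambda>a. (h a)\<^sup>2" "R\<^sup>2"], measurable, auto intro!: tendsto_intros h_tendsto hb2[simplified])+
  have S2: "integrable P ?S2" "(\<integral>X. ?S2 X \<partial>P) = (\<integral>a. \<integral>b. h a * h b * corr2 a b \<partial>\<nu> \<partial>\<nu>)"
    by (rule campbell_2[of "\<lambda>a b. h a * h b" "R * R"], measurable, auto intro!: tendsto_intros h_tendsto hhb simp: h_zero)+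
  have eq: "(Diag X)\<^sup>2 = ?S1 X + ?S2 X" if "X \<in> space P" for X
    unfolding Diag_def by (rule sum_square_offdiag) (rule fin_X[OF that])
  show "integrable P (\<lambda>X. (Diag X)\<^sup>2)"
    by (subst Bochner_Integration.integrable_cong[OF refl eq]) (auto intro: S1 S2)
  have "(\<integral>X. (Diag X)\<^sup>2 \<partial>P) = (\<integral>a. (h a)\<^sup>2 * rho a \<partial>\<nu>) + (\<integral>a. \<integral>b. h a * h b * corr2 a b \<partial>\<nu> \<partial>\<nu>)"
    by (subst Bochner_Integration.integral_cong[OF refl eq]) (auto simp: S1 S2)
  moreover have "(\<integral>a. \<integral>b. h a * h b * corr2 a b \<partial>\<nu> \<partial>\<nu>) \<le> (\<integral>a. h a * rho a \<partial>\<nu>)\<^sup>2"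
  proof -
    have pt: "h a * h b * corr2 a b \<le> (h a * rho a) * (h b * rho b)" and pt2: "\<bar>h a * h b * corr2 a b\<bar> \<le> R * R * (R * R)" for a b
    proof -
      show "h a * h b * corr2 a b \<le> (h a * rho a) * (h b * rho b)"
        using corr2_bound[of a b] h_zero[of a] h_zero[of b] h_nonneg mult_left_mono[of "corr2 a b" "rho a * rho b" "h a * h b"]
        by (cases "a \<in> U \<and> b \<in> U") (auto simp: mult_ac)
      show "\<bar>h a * h b * corr2 a b\<bar> \<le> R * R * (R * R)"
      proof (cases "a \<in> U \<and> b \<in> U")
        case True
        then show ?thesis using corr2_bound[of a b] hhb[of a b] R unfolding abs_mult[of "h a * h b"] by (intro mult_mono) auto
      next
        case False
        then have "h a * h b = 0" using h_zero by auto
        then show ?thesis using R(1) by (simp only: mult_zero_left abs_zero) simp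
      qed
    qed
    have ib: "integrable \<nu> (\<lambda>b. h a * h b * corr2 a b)" for a
      by (rule integrable_nu[OF _ pt2]) measurable
    have ihr: "integrable \<nu> (\<lambda>b. h b * rho b)" by (rule integrable_nu[OF _ h_rho_bound]) measurable
    have "(\<integral>a. \<integral>b. h a * h b * corr2 a b \<partial>\<nu> \<partial>\<nu>) \<le> (\<integral>a. (h a * rho a) * (\<integral>b. h b * rho b \<partial>\<nu>) \<partial>\<nu>)"
    proof (rule integral_mono)
      show "integrable \<nu> (\<lambda>a. h a * rho a * (\<integral>b. h b * rho b \<partial>\<nu>))" using ihr by simp
      show le: "(\<integral>b. h a * h b * corr2 a b \<partial>\<nu>) \<le> h a * rho a * (\<integral>b. h b * rho b \<partial>\<nu>)" for a
        unfolding integral_mult_right_zero[symmetric]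
        by (rule integral_mono[OF ib _ pt]) (use ihr in simp)
      have ge: "0 \<le> (\<integral>b. h a * h b * corr2 a b \<partial>\<nu>)" for a
      proof (rule Bochner_Integration.integral_nonneg)
        fix b show "0 \<le> h a * h b * corr2 a b"
          using corr2_bound[of a b] h_zero[of a] h_zero[of b] h_nonneg[of a] h_nonneg[of b] by (cases "a \<in> U \<and> b \<in> U") auto
      qed
      show "integrable \<nu> (\<lambda>a. \<integral>b. h a * h b * corr2 a b \<partial>\<nu>)"
        by (rule Bochner_Integration.integrable_bound[where f = "\<lambda>a. h a * rho a * (\<integral>b. h b * rho b \<partial>\<nu>)"])
           (use ihr le ge in \<open>auto intro!: AE_I2 order_trans[OF le abs_ge_self]\<close>)
    qed
    also have "\<dots> = (\<integral>a. h a * rho a \<partial>\<nu>)\<^sup>2" by (simp add: power2_eq_square)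
    finally show ?thesis .
  qed
  moreover have "(\<integral>a. (h a)\<^sup>2 * rho a \<partial>\<nu>) \<le> J"
  proof -
    have "\<bar>(h a)\<^sup>2 * rho a\<bar> \<le> R\<^sup>2 * R" for a
      using hb2[of a] h_zero[of a] R by (cases "a \<in> U") (auto simp: abs_mult intro!: mult_mono)
    then have "integrable \<nu> (\<lambda>a. (h a)\<^sup>2 * rho a)" by (intro integrable_nu) auto
    then have "ennreal (\<integral>a. (h a)\<^sup>2 * rho a \<partial>\<nu>) = (\<integral>\<^sup>+a. ennreal ((h a)\<^sup>2 * rho a) \<partial>\<nu>)"
      by (intro nn_integral_eq_integral[symmetric]) auto
    also have "\<dots> \<le> (\<integral>\<^sup>+x. ennreal ((f x)\<^sup>2 * (m x)\<^sup>2 * rho x) \<partial>\<nu>)"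
    proof (intro nn_integral_mono ennreal_leI)
      fix x show "(h x)\<^sup>2 * rho x \<le> (f x)\<^sup>2 * (m x)\<^sup>2 * rho x"
      proof (cases "x \<in> U")
        case True
        have "(f x * rho x)\<^sup>2 \<le> (m x)\<^sup>2" using f_rho_le[OF True] f0 by (intro power_mono) auto
        then have "(f x)\<^sup>2 * (f x * rho x)\<^sup>2 * rho x \<le> (f x)\<^sup>2 * (m x)\<^sup>2 * rho x"
          by (intro mult_right_mono mult_left_mono) auto
        then show ?thesis by (simp add: h_def power2_eq_square mult_ac)
      qed (simp add: h_zero fU)
    qed
    also note J
    finally show ?thesis using J0 by simp
  qed
  ultimately show "(\<integral>X. (Diag X)\<^sup>2 \<partial>P) - (\<integral>X. Diag X \<partial>P)\<^sup>2 \<le> J"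
    by (simp add: Diag_expectation)
qed

lemma campbell_le:
  assumes b: "\<And>x. x \<in> PiE {..<k} (\<lambda>_. U) \<Longrightarrow> \<bar>F x\<bar> \<le> C"
    and c: "\<And>x X. x \<in> PiE {..<k} (\<lambda>_. U) \<Longrightarrow> (\<And>n. X n \<in> PiE {..<k} (\<lambda>_. U)) \<Longrightarrow>
       (\<And>j. j < k \<Longrightarrow> (\<lambda>n. X n j) \<longlonglongrightarrow> x j) \<Longrightarrow> (\<lambda>n. F (X n)) \<longlonglongrightarrow> F x"
    and mm: "F \<in> borel_measurable (PiM {..<k} (\<lambda>_. \<nu>))"
    and le: "(\<integral>\<^sup>+x. ennreal (\<bar>F x\<bar> * corr k x) \<partial>PiM {..<k} (\<lambda>_. \<nu>)) \<le> ennreal B" and B: "0 \<le> B"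
  shows "(\<integral>X. distinct_sum k F (X \<inter> U) \<partial>P) \<le> B"
proof -
  have E: "(\<integral>X. distinct_sum k F (X \<inter> U) \<partial>P) = (\<integral>x. F x * corr k x \<partial>PiM {..<k} (\<lambda>_. \<nu>))"
    by (rule campbell(2)[OF P U b c mm])
  have [measurable]: "corr k \<in> borel_measurable (PiM {..<k} (\<lambda>_. \<nu>))" by (rule borel_measurable_corr) simp
  note mm [measurable]
  have n: "(\<integral>\<^sup>+x. ennreal (norm (F x * corr k x)) \<partial>PiM {..<k} (\<lambda>_. \<nu>)) \<le> ennreal B"
    using le by (simp add: abs_mult)
  have "integrable (PiM {..<k} (\<lambda>_. \<nu>)) (\<lambda>x. F x * corr k x)"
    by (rule integrableI_bounded) (use n in \<open>auto simp: le_less_trans\<close>)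
  then have "ennreal (norm (\<integral>x. F x * corr k x \<partial>PiM {..<k} (\<lambda>_. \<nu>))) \<le> ennreal B"
    by (rule order_trans[OF integral_norm_bound_ennreal n])
  then show ?thesis using B by (simp add: E)
qed

section \<open>Integrals against the correlations in the off-diagonal part\<close>

abbreviation "ef x \<equiv> ennreal (f x)"
abbreviation "em x \<equiv> ennreal (m x)"
abbreviation "er x \<equiv> ennreal (rho x)"
abbreviation "ek x y \<equiv> ennreal (cmod (bergK x y))"
abbreviation "ekk x y \<equiv> ennreal ((cmod (bergK x y))\<^sup>2)"

text \<open>The factor \<open>ef a\<close> vanishes outside \<open>U\<close>, which frees the Schur
  bound from its condition on the point and allows its use under an integral sign.\<close>

lemma ef_schur: "ef a * (\<integral>\<^sup>+b. ef b * ek a b * er b \<partial>\<nu>) \<le> ef a * em a"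
proof (cases "a \<in> U")
  case True
  then show ?thesis using schur[OF True] by (intro mult_left_mono) (simp_all add: ennreal_mult f0)
qed (simp add: fU)

text \<open>Integrates out the end of a pair that carries \<open>rho\<close>; the Schur bound
  replaces it by \<open>m\<close> at the other end, where \<open>\<psi>\<close> holds the rest of
  the configuration.\<close>

lemma pair_reduce1:
  assumes [measurable]: "\<psi> \<in> borel_measurable borel"
  shows "(\<integral>\<^sup>+a. \<integral>\<^sup>+b. ef a * ef b * ek a b * er b * \<psi> a \<partial>\<nu> \<partial>\<nu>) \<le> (\<integral>\<^sup>+a. ef a * em a * \<psi> a \<partial>\<nu>)"
proof (rule nn_integral_mono)
  fix a
  have "(\<integral>\<^sup>+b. ef a * ef b * ek a b * er b * \<psi> a \<partial>\<nu>) = (\<integral>\<^sup>+b. (ef a * \<psi> a) * (ef b * ek a b * er b) \<partial>\<nu>)"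
    by (simp add: mult_ac)
  also have "\<dots> = (ef a * \<psi> a) * (\<integral>\<^sup>+b. ef b * ek a b * er b \<partial>\<nu>)"
    by (rule nn_integral_cmult) measurable
  also have "\<dots> = (ef a * (\<integral>\<^sup>+b. ef b * ek a b * er b \<partial>\<nu>)) * \<psi> a" by (simp add: mult_ac)
  also have "\<dots> \<le> (ef a * em a) * \<psi> a" by (intro mult_right_mono ef_schur) simp
  finally show "(\<integral>\<^sup>+b. ef a * ef b * ek a b * er b * \<psi> a \<partial>\<nu>) \<le> ef a * em a * \<psi> a" .
qed

lemma pair_reduce2:
  assumes [measurable]: "\<psi> \<in> borel_measurable borel"
  shows "(\<integral>\<^sup>+a. \<integral>\<^sup>+b. ef a * ef b * ek a b * er a * \<psi> b \<partial>\<nu> \<partial>\<nu>) \<le> (\<integral>\<^sup>+a. ef a * em a * \<psi> a \<partial>\<nu>)"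
proof -
  have "(\<integral>\<^sup>+a. \<integral>\<^sup>+b. ef a * ef b * ek a b * er a * \<psi> b \<partial>\<nu> \<partial>\<nu>) = (\<integral>\<^sup>+b. \<integral>\<^sup>+a. ef a * ef b * ek a b * er a * \<psi> b \<partial>\<nu> \<partial>\<nu>)"
    by (rule nn_integral_swap[OF fin_nu]) auto
  also have "\<dots> = (\<integral>\<^sup>+b. \<integral>\<^sup>+a. ef b * ef a * ek b a * er a * \<psi> b \<partial>\<nu> \<partial>\<nu>)"
  proof (intro nn_integral_cong)
    fix b a show "ef a * ef b * ek a b * er a * \<psi> b = ef b * ef a * ek b a * er a * \<psi> b"
      by (simp add: norm_bergK_commute[of a b] mult.commute[of "ef a" "ef b"])
  qed
  also have "\<dots> \<le> (\<integral>\<^sup>+a. ef a * em a * \<psi> a \<partial>\<nu>)" by (rule pair_reduce1) fact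
  finally show ?thesis .
qed

lemma nn_integral_ekk: "a \<in> U \<Longrightarrow> (\<integral>\<^sup>+b. ekk a b \<partial>\<nu>) \<le> er a"
  using nn_integral_area_on_mono[OF Ud Ub disk_borel, of "\<lambda>b. ekk a b"] nn_integral_area_disk_norm_bergK[of a] Ud by auto

text \<open>With \<open>u = f * m\<close>, \<open>u a * u b\<close> is at most
  \<open>(u a)\<^sup>2 + (u b)\<^sup>2\<close>, and both summands contribute equally by the symmetry
  of the kernel. The reproducing property bounds the integral of
  \<open>\<bar>bergK a b\<bar>\<^sup>2\<close> over \<open>b\<close> by \<open>rho a\<close>, and
  the definition of \<open>J\<close> applies.\<close>

lemma quad_le: "(\<integral>\<^sup>+a. ef a * em a * (\<integral>\<^sup>+b. ef b * em b * ekk a b \<partial>\<nu>) \<partial>\<nu>) \<le> ennreal (2 * J)"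
proof -
  define u where "u = (\<lambda>x. f x * m x)"
  have [measurable]: "u \<in> borel_measurable borel" unfolding u_def by measurable
  have u0: "0 \<le> u x" for x by (simp add: u_def f0 m0)
  let ?X = "\<integral>\<^sup>+a. \<integral>\<^sup>+b. ennreal ((u a)\<^sup>2) * ekk a b \<partial>\<nu> \<partial>\<nu>"
  have "(\<integral>\<^sup>+a. ef a * em a * (\<integral>\<^sup>+b. ef b * em b * ekk a b \<partial>\<nu>) \<partial>\<nu>) = (\<integral>\<^sup>+a. \<integral>\<^sup>+b. ef a * em a * (ef b * em b * ekk a b) \<partial>\<nu> \<partial>\<nu>)"
    by (intro nn_integral_cong nn_integral_cmult[symmetric]) measurable
  also have "\<dots> \<le> (\<integral>\<^sup>+a. \<integral>\<^sup>+b. ennreal ((u a)\<^sup>2) * ekk a b + ennreal ((u b)\<^sup>2) * ekk a b \<partial>\<nu> \<partial>\<nu>)"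
  proof (intro nn_integral_mono)
    fix a b
    have "u a * u b \<le> (u a)\<^sup>2 + (u b)\<^sup>2"
      using sum_squares_bound[of "u a" "u b"] u0[of a] u0[of b] mult_nonneg_nonneg[OF u0[of a] u0[of b]] by linarith
    then have "u a * u b * (cmod (bergK a b))\<^sup>2 \<le> ((u a)\<^sup>2 + (u b)\<^sup>2) * (cmod (bergK a b))\<^sup>2" by (rule mult_right_mono) simp
    then have "ennreal (u a * u b * (cmod (bergK a b))\<^sup>2) \<le> ennreal (((u a)\<^sup>2 + (u b)\<^sup>2) * (cmod (bergK a b))\<^sup>2)" by (rule ennreal_leI)
    then show "ef a * em a * (ef b * em b * ekk a b) \<le> ennreal ((u a)\<^sup>2) * ekk a b + ennreal ((u b)\<^sup>2) * ekk a b"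
      by (simp add: u_def f0 m0 ennreal_mult[symmetric] ennreal_plus[symmetric] distrib_left mult_ac del: ennreal_plus)
  qed
  also have "\<dots> = (\<integral>\<^sup>+a. (\<integral>\<^sup>+b. ennreal ((u a)\<^sup>2) * ekk a b \<partial>\<nu>) + (\<integral>\<^sup>+b. ennreal ((u b)\<^sup>2) * ekk a b \<partial>\<nu>) \<partial>\<nu>)"
    by (intro nn_integral_cong nn_integral_add) measurable
  also have "\<dots> = ?X + (\<integral>\<^sup>+a. \<integral>\<^sup>+b. ennreal ((u b)\<^sup>2) * ekk a b \<partial>\<nu> \<partial>\<nu>)"
    by (intro nn_integral_add) measurable
  also have "(\<integral>\<^sup>+a. \<integral>\<^sup>+b. ennreal ((u b)\<^sup>2) * ekk a b \<partial>\<nu> \<partial>\<nu>) = (\<integral>\<^sup>+b. \<integral>\<^sup>+a. ennreal ((u b)\<^sup>2) * ekk a b \<partial>\<nu> \<partial>\<nu>)"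
    by (rule nn_integral_swap[OF fin_nu]) auto
  also have "\<dots> = ?X" by (simp add: norm_bergK_commute)
  also have "?X \<le> ennreal J"
  proof -
    have "?X \<le> (\<integral>\<^sup>+x. ennreal ((f x)\<^sup>2 * (m x)\<^sup>2 * rho x) \<partial>\<nu>)"
    proof (rule nn_integral_mono)
      fix a
      have "(\<integral>\<^sup>+b. ennreal ((u a)\<^sup>2) * ekk a b \<partial>\<nu>) = ennreal ((u a)\<^sup>2) * (\<integral>\<^sup>+b. ekk a b \<partial>\<nu>)"
        by (rule nn_integral_cmult) measurable
      also have "\<dots> \<le> ennreal ((u a)\<^sup>2) * er a"
        by (cases "a \<in> U") (auto intro!: mult_left_mono nn_integral_ekk simp: u_def fU)
      also have "\<dots> = ennreal ((f a)\<^sup>2 * (m a)\<^sup>2 * rho a)"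
        by (simp add: ennreal_mult[symmetric] u_def power_mult_distrib)
      finally show "(\<integral>\<^sup>+b. ennreal ((u a)\<^sup>2) * ekk a b \<partial>\<nu>) \<le> ennreal ((f a)\<^sup>2 * (m a)\<^sup>2 * rho a)" .
    qed
    also note J
    finally show ?thesis .
  qed
  then have "?X + ?X \<le> ennreal J + ennreal J" by (intro add_mono)
  also have "\<dots> = ennreal (2 * J)" using J0 by (simp flip: ennreal_plus)
  finally show ?thesis .
qed

text \<open>The weight of a pair, with \<open>rho\<close> at the end that is free: the second point
  in \<open>A1\<close>, the first in \<open>A2\<close>. The other end carries the crossing
  edge.\<close>

definition A1 :: "complex \<Rightarrow> complex \<Rightarrow> ennreal" where "A1 a b = ef a * ef b * ek a b * er b"
definition A2 :: "complex \<Rightarrow> complex \<Rightarrow> ennreal" where "A2 a b = ef a * ef b * ek a b * er a"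

lemma measurable_A1 [measurable (raw)]:
  assumes [measurable]: "a \<in> borel_measurable N" "b \<in> borel_measurable N"
  shows "(\<lambda>x. A1 (a x) (b x)) \<in> borel_measurable N"
  unfolding A1_def by measurable

lemma measurable_A2 [measurable (raw)]:
  assumes [measurable]: "a \<in> borel_measurable N" "b \<in> borel_measurable N"
  shows "(\<lambda>x. A2 (a x) (b x)) \<in> borel_measurable N"
  unfolding A2_def by measurable

text \<open>The two slots \<open>p\<close> and \<open>q\<close> select which point of each pair is joined by the crossing edge.\<close>
lemma crossing_integral_le:
  assumes p: "(p, A) \<in> {(fst, A1), (snd, A2)}" and q: "(q, A') \<in> {(fst, A1), (snd, A2)}"
  shows "(\<integral>\<^sup>+a. \<integral>\<^sup>+b. \<integral>\<^sup>+c. \<integral>\<^sup>+d. A a b * (A' c d * ekk (p (a, b)) (q (c, d))) \<partial>\<nu> \<partial>\<nu> \<partial>\<nu> \<partial>\<nu>) \<le> ennreal (2 * J)"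
proof -
  define \<Psi> where "\<Psi> = (\<lambda>x. \<integral>\<^sup>+c. ef c * em c * ekk x c \<partial>\<nu>)"
  have [measurable]: "\<Psi> \<in> borel_measurable borel" unfolding \<Psi>_def by measurable
  have mA [measurable (raw)]: "\<And>a b. a \<in> borel_measurable borel \<Longrightarrow> b \<in> borel_measurable borel \<Longrightarrow> (\<lambda>x. A' (a x) (b x)) \<in> borel_measurable borel"
    using q measurable_A1 measurable_A2 by auto
  have red: "(\<integral>\<^sup>+a. \<integral>\<^sup>+b. A a b * \<psi> (p (a, b)) \<partial>\<nu> \<partial>\<nu>) \<le> (\<integral>\<^sup>+a. ef a * em a * \<psi> a \<partial>\<nu>)" if "\<psi> \<in> borel_measurable borel" for \<psi>
    using p pair_reduce1[OF that] pair_reduce2[OF that] by (auto simp: A1_def A2_def)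
  have red': "(\<integral>\<^sup>+a. \<integral>\<^sup>+b. A' a b * \<psi> (q (a, b)) \<partial>\<nu> \<partial>\<nu>) \<le> (\<integral>\<^sup>+a. ef a * em a * \<psi> a \<partial>\<nu>)" if "\<psi> \<in> borel_measurable borel" for \<psi>
    using q pair_reduce1[OF that] pair_reduce2[OF that] by (auto simp: A1_def A2_def)
  have "(\<integral>\<^sup>+a. \<integral>\<^sup>+b. \<integral>\<^sup>+c. \<integral>\<^sup>+d. A a b * (A' c d * ekk (p (a, b)) (q (c, d))) \<partial>\<nu> \<partial>\<nu> \<partial>\<nu> \<partial>\<nu>)
     \<le> (\<integral>\<^sup>+a. \<integral>\<^sup>+b. A a b * \<Psi> (p (a, b)) \<partial>\<nu> \<partial>\<nu>)"
  proof (intro nn_integral_mono)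
    fix a b
    let ?x = "p (a, b)"
    have "(\<integral>\<^sup>+c. \<integral>\<^sup>+d. A a b * (A' c d * ekk ?x (q (c, d))) \<partial>\<nu> \<partial>\<nu>) = A a b * (\<integral>\<^sup>+c. \<integral>\<^sup>+d. A' c d * ekk ?x (q (c, d)) \<partial>\<nu> \<partial>\<nu>)"
      using q by (auto simp: nn_integral_cmult)
    also have "\<dots> \<le> A a b * \<Psi> ?x"
      unfolding \<Psi>_def by (intro mult_left_mono red') auto
    finally show "(\<integral>\<^sup>+c. \<integral>\<^sup>+d. A a b * (A' c d * ekk ?x (q (c, d))) \<partial>\<nu> \<partial>\<nu>) \<le> A a b * \<Psi> ?x" .
  qed
  also have "\<dots> \<le> (\<integral>\<^sup>+a. ef a * em a * \<Psi> a \<partial>\<nu>)" by (rule red) measurable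
  also have "\<dots> \<le> ennreal (2 * J)" unfolding \<Psi>_def by (rule quad_le)
  finally show ?thesis .
qed

text \<open>192 is 24 times 4 times 2: the number of permutations of four points, the number of
  positions of a crossing edge, and the factor in the bound for one position.\<close>

lemma corr_4_integral_le:
  "(\<integral>\<^sup>+x. ennreal \<bar>G (x 0) (x 1) * G (x 2) (x 3) * (corr 4 x - corr2 (x 0) (x 1) * corr2 (x 2) (x 3))\<bar> \<partial>PiM {..<4::nat} (\<lambda>_. \<nu>)) \<le> ennreal (192 * J)"
proof -
  let ?t1 = "\<lambda>a b c d. A1 a b * (A1 c d * ekk a c)" and ?t2 = "\<lambda>a b c d. A1 a b * (A2 c d * ekk a d)"
  let ?t3 = "\<lambda>a b c d. A2 a b * (A1 c d * ekk b c)" and ?t4 = "\<lambda>a b c d. A2 a b * (A2 c d * ekk b d)"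
  let ?N = "PiM {..<4::nat} (\<lambda>_. \<nu>)"
  have pt: "ennreal \<bar>G (x 0) (x 1) * G (x 2) (x 3) * (corr 4 x - corr2 (x 0) (x 1) * corr2 (x 2) (x 3))\<bar>
     \<le> 24 * (?t1 (x 0) (x 1) (x 2) (x 3) + ?t2 (x 0) (x 1) (x 2) (x 3) + ?t3 (x 0) (x 1) (x 2) (x 3) + ?t4 (x 0) (x 1) (x 2) (x 3))" for x
  proof (cases "\<forall>i<4. x i \<in> U")
    case False
    then obtain i where i: "i < 4" "x i \<notin> U" by blast
    then have "i \<in> {0,1,2,3}" by auto
    then have "G (x 0) (x 1) * G (x 2) (x 3) = 0" using i G_zero by auto
    then show ?thesis by (simp only: mult_zero_left abs_zero ennreal_0 zero_le)
  next
    case True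
    let ?a = "x 0" and ?b = "x 1" and ?c = "x 2" and ?d = "x 3"
    let ?g = "(f ?a * f ?b * cmod (bergK ?a ?b)) * (f ?c * f ?d * cmod (bergK ?c ?d))"
    let ?T = "(cmod (bergK ?a ?c))\<^sup>2 * rho ?b * rho ?d + (cmod (bergK ?a ?d))\<^sup>2 * rho ?b * rho ?c
     + (cmod (bergK ?b ?c))\<^sup>2 * rho ?a * rho ?d + (cmod (bergK ?b ?d))\<^sup>2 * rho ?a * rho ?c"
    have 4: "\<bar>corr 4 x - corr2 ?a ?b * corr2 ?c ?d\<bar> \<le> 24 * ?T"
      using True Ud by (intro corr_4) auto
    have "\<bar>G ?a ?b * G ?c ?d * (corr 4 x - corr2 ?a ?b * corr2 ?c ?d)\<bar> \<le> ?g * (24 * ?T)"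
      unfolding abs_mult by (intro mult_mono abs_G_le 4) (auto simp: f0)
    then have "ennreal \<bar>G ?a ?b * G ?c ?d * (corr 4 x - corr2 ?a ?b * corr2 ?c ?d)\<bar> \<le> ennreal (?g * (24 * ?T))" by (rule ennreal_leI)
    also have "?g * (24 * ?T) = 24 * (f ?a * f ?b * cmod (bergK ?a ?b) * rho ?b * (f ?c * f ?d * cmod (bergK ?c ?d) * rho ?d * (cmod (bergK ?a ?c))\<^sup>2)
      + f ?a * f ?b * cmod (bergK ?a ?b) * rho ?b * (f ?c * f ?d * cmod (bergK ?c ?d) * rho ?c * (cmod (bergK ?a ?d))\<^sup>2)
      + f ?a * f ?b * cmod (bergK ?a ?b) * rho ?a * (f ?c * f ?d * cmod (bergK ?c ?d) * rho ?d * (cmod (bergK ?b ?c))\<^sup>2)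
      + f ?a * f ?b * cmod (bergK ?a ?b) * rho ?a * (f ?c * f ?d * cmod (bergK ?c ?d) * rho ?c * (cmod (bergK ?b ?d))\<^sup>2))"
      by (simp only: distrib_left distrib_right mult_ac)
    also have "ennreal \<dots> = 24 * (?t1 ?a ?b ?c ?d + ?t2 ?a ?b ?c ?d + ?t3 ?a ?b ?c ?d + ?t4 ?a ?b ?c ?d)"
      unfolding A1_def A2_def
      by (simp add: ennreal_mult f0 ennreal_plus mult_nonneg_nonneg add_nonneg_nonneg del: One_nat_def)
    finally show ?thesis .
  qed
  have m [measurable]: "(\<lambda>x. ?t1 (x 0) (x 1) (x 2) (x 3)) \<in> borel_measurable ?N" "(\<lambda>x. ?t2 (x 0) (x 1) (x 2) (x 3)) \<in> borel_measurable ?N"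
     "(\<lambda>x. ?t3 (x 0) (x 1) (x 2) (x 3)) \<in> borel_measurable ?N" "(\<lambda>x. ?t4 (x 0) (x 1) (x 2) (x 3)) \<in> borel_measurable ?N"
    by measurable
  have "(\<integral>\<^sup>+x. ennreal \<bar>G (x 0) (x 1) * G (x 2) (x 3) * (corr 4 x - corr2 (x 0) (x 1) * corr2 (x 2) (x 3))\<bar> \<partial>?N)
     \<le> (\<integral>\<^sup>+x. 24 * (?t1 (x 0) (x 1) (x 2) (x 3) + ?t2 (x 0) (x 1) (x 2) (x 3) + ?t3 (x 0) (x 1) (x 2) (x 3) + ?t4 (x 0) (x 1) (x 2) (x 3)) \<partial>?N)"
    by (intro nn_integral_mono pt)
  also have "\<dots> = 24 * ((\<integral>\<^sup>+x. ?t1 (x 0) (x 1) (x 2) (x 3) \<partial>?N) + (\<integral>\<^sup>+x. ?t2 (x 0) (x 1) (x 2) (x 3) \<partial>?N)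
      + (\<integral>\<^sup>+x. ?t3 (x 0) (x 1) (x 2) (x 3) \<partial>?N) + (\<integral>\<^sup>+x. ?t4 (x 0) (x 1) (x 2) (x 3) \<partial>?N))"
    using m by (simp only: nn_integral_cmult nn_integral_add borel_measurable_add)
  also have "\<dots> \<le> 24 * (ennreal (2 * J) + ennreal (2 * J) + ennreal (2 * J) + ennreal (2 * J))"
  proof (intro mult_left_mono add_mono)
    show "(\<integral>\<^sup>+x. ?t1 (x 0) (x 1) (x 2) (x 3) \<partial>?N) \<le> ennreal (2 * J)"
      using crossing_integral_le[of fst A1 fst A1] by (subst nn_integral_PiM_4[OF fin_nu, where h = ?t1]) auto
    show "(\<integral>\<^sup>+x. ?t2 (x 0) (x 1) (x 2) (x 3) \<partial>?N) \<le> ennreal (2 * J)"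
      using crossing_integral_le[of fst A1 snd A2] by (subst nn_integral_PiM_4[OF fin_nu, where h = ?t2]) auto
    show "(\<integral>\<^sup>+x. ?t3 (x 0) (x 1) (x 2) (x 3) \<partial>?N) \<le> ennreal (2 * J)"
      using crossing_integral_le[of snd A2 fst A1] by (subst nn_integral_PiM_4[OF fin_nu, where h = ?t3]) auto
    show "(\<integral>\<^sup>+x. ?t4 (x 0) (x 1) (x 2) (x 3) \<partial>?N) \<le> ennreal (2 * J)"
      using crossing_integral_le[of snd A2 snd A2] by (subst nn_integral_PiM_4[OF fin_nu, where h = ?t4]) auto
  qed simp
  also have "ennreal (2 * J) + ennreal (2 * J) + ennreal (2 * J) + ennreal (2 * J) = ennreal (8 * J)"
    using J0 by (simp flip: ennreal_plus)
  also have "24 * ennreal (8 * J) = ennreal (192 * J)"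
    using J0 by (subst ennreal_numeral[symmetric], subst ennreal_mult[symmetric]) auto
  finally show ?thesis .
qed

lemma corr_3_integral_le:
  "(\<integral>\<^sup>+x. ennreal (\<bar>G (x 0) (x 1) * G (x 0) (x 2)\<bar> * corr 3 x) \<partial>PiM {..<3::nat} (\<lambda>_. \<nu>)) \<le> ennreal (6 * J)"
proof -
  let ?B = "\<lambda>a b. ef b * ek a b * er b"
  let ?t = "\<lambda>a b c. 6 * (ef a * ef a * er a * (?B a b * ?B a c))"
  have pt: "ennreal (\<bar>G (x 0) (x 1) * G (x 0) (x 2)\<bar> * corr 3 x) \<le> ?t (x 0) (x 1) (x 2)" for x
  proof (cases "\<forall>i<3. x i \<in> U")
    case False
    then obtain i where i: "i < 3" "x i \<notin> U" by blast
    then have "i \<in> {0,1,2}" by auto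
    then have "G (x 0) (x 1) * G (x 0) (x 2) = 0" using i G_zero by auto
    then show ?thesis by (simp only: mult_zero_left abs_zero ennreal_0 zero_le)
  next
    case True
    let ?a = "x 0" and ?b = "x 1" and ?c = "x 2"
    have "corr 3 x \<le> fact 3 * (\<Prod>i<3. rho (x i))" using True Ud by (intro corr_le) auto
    also have "\<dots> = 6 * (rho ?a * rho ?b * rho ?c)" by (simp add: numeral_3_eq_3 numeral_2_eq_2 fact_numeral)
    finally have "\<bar>G ?a ?b * G ?a ?c\<bar> * corr 3 x \<le> (f ?a * f ?b * cmod (bergK ?a ?b)) * (f ?a * f ?c * cmod (bergK ?a ?c)) * (6 * (rho ?a * rho ?b * rho ?c))"
      unfolding abs_mult by (intro mult_mono abs_G_le) (auto simp: f0)
    also have "\<dots> = 6 * (f ?a * f ?a * rho ?a * ((f ?b * cmod (bergK ?a ?b) * rho ?b) * (f ?c * cmod (bergK ?a ?c) * rho ?c)))"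
      by (simp only: mult_ac)
    finally have "ennreal (\<bar>G ?a ?b * G ?a ?c\<bar> * corr 3 x) \<le> ennreal (6 * (f ?a * f ?a * rho ?a * ((f ?b * cmod (bergK ?a ?b) * rho ?b) * (f ?c * cmod (bergK ?a ?c) * rho ?c))))"
      by (rule ennreal_leI)
    also have "\<dots> = ?t ?a ?b ?c" by (simp add: ennreal_mult f0 mult_nonneg_nonneg del: One_nat_def)
    finally show ?thesis .
  qed
  have "(\<integral>\<^sup>+x. ennreal (\<bar>G (x 0) (x 1) * G (x 0) (x 2)\<bar> * corr 3 x) \<partial>PiM {..<3::nat} (\<lambda>_. \<nu>)) \<le> (\<integral>\<^sup>+x. ?t (x 0) (x 1) (x 2) \<partial>PiM {..<3::nat} (\<lambda>_. \<nu>))"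
    by (intro nn_integral_mono pt)
  also have "\<dots> = (\<integral>\<^sup>+a. \<integral>\<^sup>+b. \<integral>\<^sup>+c. ?t a b c \<partial>\<nu> \<partial>\<nu> \<partial>\<nu>)"
    by (rule nn_integral_PiM_3[OF fin_nu, where h = ?t]) auto
  also have "\<dots> \<le> (\<integral>\<^sup>+a. 6 * ennreal ((f a)\<^sup>2 * (m a)\<^sup>2 * rho a) \<partial>\<nu>)"
  proof (rule nn_integral_mono)
    fix a
    have "(\<integral>\<^sup>+b. \<integral>\<^sup>+c. ?t a b c \<partial>\<nu> \<partial>\<nu>) = 6 * (ef a * ef a * er a * ((\<integral>\<^sup>+b. ?B a b \<partial>\<nu>) * (\<integral>\<^sup>+c. ?B a c \<partial>\<nu>)))"
      by (simp add: nn_integral_cmult nn_integral_multc)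
    also have "\<dots> = 6 * (er a * ((ef a * (\<integral>\<^sup>+b. ?B a b \<partial>\<nu>)) * (ef a * (\<integral>\<^sup>+c. ?B a c \<partial>\<nu>))))"
      by (simp add: mult_ac)
    also have "\<dots> \<le> 6 * (er a * ((ef a * em a) * (ef a * em a)))"
      by (intro mult_left_mono mult_mono ef_schur) auto
    also have "\<dots> = 6 * ennreal ((f a)\<^sup>2 * (m a)\<^sup>2 * rho a)"
      by (simp add: ennreal_mult[symmetric] f0 m0 power2_eq_square mult_ac)
    finally show "(\<integral>\<^sup>+b. \<integral>\<^sup>+c. ?t a b c \<partial>\<nu> \<partial>\<nu>) \<le> 6 * ennreal ((f a)\<^sup>2 * (m a)\<^sup>2 * rho a)" .
  qed
  also have "\<dots> = 6 * (\<integral>\<^sup>+a. ennreal ((f a)\<^sup>2 * (m a)\<^sup>2 * rho a) \<partial>\<nu>)"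
    by (rule nn_integral_cmult) measurable
  also have "\<dots> \<le> 6 * ennreal J" by (intro mult_left_mono J) simp
  also have "\<dots> = ennreal (6 * J)" using J0 by (subst ennreal_numeral[symmetric], subst ennreal_mult[symmetric]) auto
  finally show ?thesis .
qed

text \<open>Of the two factors of the square, one is bounded pointwise by \<open>f a * m a\<close>
  and the other is integrated over \<open>b\<close> by the Schur bound; each contributes one power
  of \<open>m\<close>.\<close>

lemma corr_2_integral_le:
  "(\<integral>\<^sup>+x. ennreal (\<bar>(G (x 0) (x 1))\<^sup>2\<bar> * corr 2 x) \<partial>PiM {..<2::nat} (\<lambda>_. \<nu>)) \<le> ennreal J"
proof -
  let ?B = "\<lambda>a b. ef b * ek a b * er b"
  let ?t = "\<lambda>a b. ef a * ef a * em a * er a * ?B a b"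
  have pt: "ennreal (\<bar>(G (x 0) (x 1))\<^sup>2\<bar> * corr 2 x) \<le> ?t (x 0) (x 1)" for x
  proof (cases "x 0 \<in> U \<and> x 1 \<in> U")
    case False
    then have "(G (x 0) (x 1))\<^sup>2 = 0" using G_zero by auto
    then show ?thesis by (simp only: mult_zero_left abs_zero ennreal_0 zero_le)
  next
    case True
    let ?a = "x 0" and ?b = "x 1"
    have c: "corr 2 x = corr2 ?a ?b" using True Ud by (intro corr_2) auto
    have "corr2 ?a ?b \<le> rho ?a * rho ?b" "0 \<le> corr2 ?a ?b" using corr2_bound[of ?a ?b] True by auto
    moreover have "(G ?a ?b)\<^sup>2 \<le> (f ?a * m ?a) * (f ?a * f ?b * cmod (bergK ?a ?b))"
    proof -
      have "(G ?a ?b)\<^sup>2 = \<bar>G ?a ?b\<bar> * \<bar>G ?a ?b\<bar>" by (simp add: power2_eq_square)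
      also have "\<dots> \<le> (f ?a * (f ?b * cmod (bergK ?a ?b))) * (f ?a * f ?b * cmod (bergK ?a ?b))"
        using abs_G_le[of ?a ?b] by (intro mult_mono) (auto simp: f0 mult.assoc)
      also have "\<dots> \<le> (f ?a * m ?a) * (f ?a * f ?b * cmod (bergK ?a ?b))"
        using True by (intro mult_right_mono mult_left_mono ptw) (auto simp: f0)
      finally show ?thesis .
    qed
    ultimately have "\<bar>(G ?a ?b)\<^sup>2\<bar> * corr 2 x \<le> ((f ?a * m ?a) * (f ?a * f ?b * cmod (bergK ?a ?b))) * (rho ?a * rho ?b)"
      unfolding c abs_power2 by (intro mult_mono) (auto simp: f0 m0)
    also have "\<dots> = f ?a * f ?a * m ?a * rho ?a * (f ?b * cmod (bergK ?a ?b) * rho ?b)" by (simp only: mult_ac)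
    finally have "ennreal (\<bar>(G ?a ?b)\<^sup>2\<bar> * corr 2 x) \<le> ennreal (f ?a * f ?a * m ?a * rho ?a * (f ?b * cmod (bergK ?a ?b) * rho ?b))"
      by (rule ennreal_leI)
    also have "\<dots> = ?t ?a ?b" by (simp add: ennreal_mult f0 m0 mult_nonneg_nonneg del: One_nat_def)
    finally show ?thesis .
  qed
  have "(\<integral>\<^sup>+x. ennreal (\<bar>(G (x 0) (x 1))\<^sup>2\<bar> * corr 2 x) \<partial>PiM {..<2::nat} (\<lambda>_. \<nu>)) \<le> (\<integral>\<^sup>+x. ?t (x 0) (x 1) \<partial>PiM {..<2::nat} (\<lambda>_. \<nu>))"
    by (intro nn_integral_mono pt)
  also have "\<dots> = (\<integral>\<^sup>+a. \<integral>\<^sup>+b. ?t a b \<partial>\<nu> \<partial>\<nu>)"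
    by (rule nn_integral_PiM_2[OF fin_nu, where h = ?t]) auto
  also have "\<dots> \<le> (\<integral>\<^sup>+a. ennreal ((f a)\<^sup>2 * (m a)\<^sup>2 * rho a) \<partial>\<nu>)"
  proof (rule nn_integral_mono)
    fix a
    have "(\<integral>\<^sup>+b. ?t a b \<partial>\<nu>) = ef a * ef a * em a * er a * (\<integral>\<^sup>+b. ?B a b \<partial>\<nu>)"
      by (rule nn_integral_cmult) measurable
    also have "\<dots> = ef a * em a * er a * (ef a * (\<integral>\<^sup>+b. ?B a b \<partial>\<nu>))" by (simp add: mult_ac)
    also have "\<dots> \<le> ef a * em a * er a * (ef a * em a)"
      by (intro mult_left_mono ef_schur) auto
    also have "\<dots> = ennreal ((f a)\<^sup>2 * (m a)\<^sup>2 * rho a)"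
      by (simp add: ennreal_mult[symmetric] f0 m0 power2_eq_square mult_ac)
    finally show "(\<integral>\<^sup>+b. ?t a b \<partial>\<nu>) \<le> ennreal ((f a)\<^sup>2 * (m a)\<^sup>2 * rho a)" .
  qed
  also note J
  finally show ?thesis .
qed

text \<open>218 is 192 + 4 * 6 + 2 * 1. The squared mean is cancelled against the four-point term
  only; the terms with shared points are small enough to be estimated on their own.\<close>

lemma Off_variance:
  shows "integrable P (\<lambda>X. (Off X)\<^sup>2)" "(\<integral>X. (Off X)\<^sup>2 \<partial>P) - (\<integral>X. Off X \<partial>P)\<^sup>2 \<le> 218 * J"
proof -
  define F2 where "F2 = (\<lambda>t::nat \<Rightarrow> complex. (G (t 0) (t 1))\<^sup>2)"
  define F3 where "F3 = (\<lambda>t::nat \<Rightarrow> complex. G (t 0) (t 1) * G (t 0) (t 2))"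
  define F4 where "F4 = (\<lambda>t::nat \<Rightarrow> complex. G (t 0) (t 1) * G (t 2) (t 3))"
  have GG: "\<bar>G a b * G c d\<bar> \<le> R * R" for a b c d
    using G_bound R by (auto simp: abs_mult intro!: mult_mono)
  have b: "\<bar>F2 x\<bar> \<le> R * R" "\<bar>F3 x\<bar> \<le> R * R" "\<bar>F4 x\<bar> \<le> R * R" for x
    unfolding F2_def F3_def F4_def power2_eq_square by (rule GG)+
  have m2: "F2 \<in> borel_measurable (PiM {..<2::nat} (\<lambda>_. \<nu>))" unfolding F2_def by measurable
  have m3: "F3 \<in> borel_measurable (PiM {..<3::nat} (\<lambda>_. \<nu>))" unfolding F3_def by measurable
  have m4 [measurable]: "F4 \<in> borel_measurable (PiM {..<4::nat} (\<lambda>_. \<nu>))" unfolding F4_def by measurable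
  have c2: "(\<lambda>n. F2 (X n)) \<longlonglongrightarrow> F2 x" if "x \<in> PiE {..<2::nat} (\<lambda>_. U)" "\<And>n. X n \<in> PiE {..<2::nat} (\<lambda>_. U)"
       "\<And>j. j < 2 \<Longrightarrow> (\<lambda>n. X n j) \<longlonglongrightarrow> x j" for x X
    unfolding F2_def using that by (intro tendsto_power G_tendsto) (auto simp: PiE_iff)
  have c3: "(\<lambda>n. F3 (X n)) \<longlonglongrightarrow> F3 x" if "x \<in> PiE {..<3::nat} (\<lambda>_. U)" "\<And>n. X n \<in> PiE {..<3::nat} (\<lambda>_. U)"
       "\<And>j. j < 3 \<Longrightarrow> (\<lambda>n. X n j) \<longlonglongrightarrow> x j" for x X
    unfolding F3_def using that by (intro tendsto_mult G_tendsto) (auto simp: PiE_iff)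
  have c4: "(\<lambda>n. F4 (X n)) \<longlonglongrightarrow> F4 x" if "x \<in> PiE {..<4::nat} (\<lambda>_. U)" "\<And>n. X n \<in> PiE {..<4::nat} (\<lambda>_. U)"
       "\<And>j. j < 4 \<Longrightarrow> (\<lambda>n. X n j) \<longlonglongrightarrow> x j" for x X
    unfolding F4_def using that by (intro tendsto_mult G_tendsto) (auto simp: PiE_iff)
  have eq: "(Off X)\<^sup>2 = distinct_sum 4 F4 (X \<inter> U) + 4 * distinct_sum 3 F3 (X \<inter> U) + 2 * distinct_sum 2 F2 (X \<inter> U)" if "X \<in> space P" for X
    unfolding Off_def F2_def F3_def F4_def distinct_sum_2[where h = "\<lambda>a b. (G a b)\<^sup>2"]
      distinct_sum_4[where h = "\<lambda>a b c d. G a b * G c d"]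
      distinct_sum_3[where h = "\<lambda>a b c. G a b * G a c"]
    by (rule offdiag_sum_square[OF fin_X[OF that] G_sym])
  have i2: "integrable P (\<lambda>X. distinct_sum 2 F2 (X \<inter> U))" by (rule campbell(1)[OF P U b(1) c2 m2])
  have i3: "integrable P (\<lambda>X. distinct_sum 3 F3 (X \<inter> U))" by (rule campbell(1)[OF P U b(2) c3 m3])
  have i4: "integrable P (\<lambda>X. distinct_sum 4 F4 (X \<inter> U))" by (rule campbell(1)[OF P U b(3) c4 m4])
  show "integrable P (\<lambda>X. (Off X)\<^sup>2)"
  proof -
    have "integrable P (\<lambda>X. distinct_sum 4 F4 (X \<inter> U) + 4 * distinct_sum 3 F3 (X \<inter> U) + 2 * distinct_sum 2 F2 (X \<inter> U))"
      using i2 i3 i4 by simp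
    then show ?thesis by (simp only: Bochner_Integration.integrable_cong[OF refl eq])
  qed
  have "(\<integral>X. (Off X)\<^sup>2 \<partial>P) = (\<integral>X. distinct_sum 4 F4 (X \<inter> U) + 4 * distinct_sum 3 F3 (X \<inter> U) + 2 * distinct_sum 2 F2 (X \<inter> U) \<partial>P)"
    by (rule Bochner_Integration.integral_cong[OF refl eq])
  also have "\<dots> = (\<integral>X. distinct_sum 4 F4 (X \<inter> U) \<partial>P) + 4 * (\<integral>X. distinct_sum 3 F3 (X \<inter> U) \<partial>P) + 2 * (\<integral>X. distinct_sum 2 F2 (X \<inter> U) \<partial>P)"
    using i2 i3 i4 by simp
  finally have E: "(\<integral>X. (Off X)\<^sup>2 \<partial>P) = (\<integral>X. distinct_sum 4 F4 (X \<inter> U) \<partial>P) + 4 * (\<integral>X. distinct_sum 3 F3 (X \<inter> U) \<partial>P) + 2 * (\<integral>X. distinct_sum 2 F2 (X \<inter> U) \<partial>P)" .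
  have E2: "(\<integral>X. distinct_sum 2 F2 (X \<inter> U) \<partial>P) \<le> J"
    by (rule campbell_le[OF b(1) c2 m2 _ J0]) (simp_all only: F2_def corr_2_integral_le)
  have E3: "(\<integral>X. distinct_sum 3 F3 (X \<inter> U) \<partial>P) \<le> 6 * J"
    by (rule campbell_le[OF b(2) c3 m3]) (simp_all only: F3_def corr_3_integral_le, use J0 in simp)
  have E4: "(\<integral>X. distinct_sum 4 F4 (X \<inter> U) \<partial>P) - (\<integral>X. Off X \<partial>P)\<^sup>2 \<le> 192 * J"
  proof -
    let ?N = "PiM {..<4::nat} (\<lambda>_. \<nu>)"
    have fN: "finite_measure ?N" by (rule finite_measure_PiM[OF fin_nu])
    have [measurable]: "corr 4 \<in> borel_measurable ?N" by (rule borel_measurable_corr) simp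
    have Hb: "\<bar>G a b * corr2 a b\<bar> \<le> R * (R * R)" for a b
    proof (cases "a \<in> U \<and> b \<in> U")
      case True
      then show ?thesis using G_bound[of a b] corr2_bound[of a b] R unfolding abs_mult by (intro mult_mono) auto
    next
      case False
      then have "G a b = 0" using G_zero by auto
      then show ?thesis using R by simp
    qed
    have R3: "0 \<le> R * (R * R)" using R by simp
    \<comment> \<open>Writing the squared mean as an integral over four points lets it be subtracted
      under the integral, so that the integrand contains the difference of \<open>corr 4\<close> and
      the product of the two pair correlations.\<close>
    have sq: "(\<integral>X. Off X \<partial>P)\<^sup>2 = (\<integral>x. G (x 0) (x 1) * corr2 (x 0) (x 1) * (G (x 2) (x 3) * corr2 (x 2) (x 3)) \<partial>?N)"
      unfolding Off_expectation(2)
      by (rule integral_PiM_4_product[OF fin_nu _ _ Hb, symmetric]) auto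
    have int1: "integrable ?N (\<lambda>x. G (x 0) (x 1) * corr2 (x 0) (x 1) * (G (x 2) (x 3) * corr2 (x 2) (x 3)))"
      by (rule integrable_bounded[OF fN, where B = "(R * (R * R)) * (R * (R * R))"])
         (measurable, unfold abs_mult[of "G _ _ * corr2 _ _"], intro mult_mono Hb R3, auto)
    have int2: "integrable ?N (\<lambda>x. F4 x * corr 4 x)"
    proof (rule integrable_bounded[OF fN, where B = "R * R * (24 * R ^ 4)"])
      fix x
      show "\<bar>F4 x * corr 4 x\<bar> \<le> R * R * (24 * R ^ 4)"
      proof (cases "\<forall>i<4. x i \<in> U")
        case False
        then obtain i where i: "i < 4" "x i \<notin> U" by blast
        then have "i \<in> {0,1,2,3}" by auto
        then have "F4 x = 0" using i G_zero by (auto simp: F4_def)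
        then show ?thesis using R by simp
      next
        case True
        have "corr 4 x \<le> fact 4 * (\<Prod>i<4. rho (x i))" using True Ud by (intro corr_le) auto
        also have "\<dots> \<le> 24 * (\<Prod>i<4::nat. R)"
          using True R by (intro mult_mono prod_mono prod_nonneg) (auto simp: fact_numeral)
        finally have "corr 4 x \<le> 24 * R ^ 4" by simp
        then show ?thesis using b(3)[of x] R unfolding abs_mult by (intro mult_mono) auto
      qed
    qed measurable
    have e4: "(\<integral>X. distinct_sum 4 F4 (X \<inter> U) \<partial>P) = (\<integral>x. F4 x * corr 4 x \<partial>?N)"
      by (rule campbell(2)[OF P U b(3) c4 m4])
    have "(\<integral>X. distinct_sum 4 F4 (X \<inter> U) \<partial>P) - (\<integral>X. Off X \<partial>P)\<^sup>2 =
       (\<integral>x. F4 x * corr 4 x - G (x 0) (x 1) * corr2 (x 0) (x 1) * (G (x 2) (x 3) * corr2 (x 2) (x 3)) \<partial>?N)"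
      unfolding sq e4 using int1 int2 by (rule Bochner_Integration.integral_diff[symmetric, rotated])
    also have "\<dots> = (\<integral>x. G (x 0) (x 1) * G (x 2) (x 3) * (corr 4 x - corr2 (x 0) (x 1) * corr2 (x 2) (x 3)) \<partial>?N)" (is "_ = integral\<^sup>L _ ?D")
      by (intro Bochner_Integration.integral_cong refl) (simp add: F4_def algebra_simps)
    also have "\<dots> \<le> 192 * J"
    proof -
      have "integrable ?N ?D"
        using Bochner_Integration.integrable_diff[OF int2 int1] by (rule Bochner_Integration.integrable_cong[THEN iffD1, rotated -1]) (auto simp: F4_def algebra_simps)
      then have "ennreal (norm (integral\<^sup>L ?N ?D)) \<le> (\<integral>\<^sup>+x. ennreal (norm (?D x)) \<partial>?N)" by (rule integral_norm_bound_ennreal)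
      also have "\<dots> \<le> ennreal (192 * J)" unfolding real_norm_def by (rule corr_4_integral_le)
      finally show ?thesis using J0 by simp
    qed
    finally show ?thesis .
  qed
  show "(\<integral>X. (Off X)\<^sup>2 \<partial>P) - (\<integral>X. Off X \<partial>P)\<^sup>2 \<le> 218 * J"
    using E E2 E3 E4 by linarith
qed

section \<open>The full quadratic statistic and its mean\<close>

lemma Q_eq: "X \<in> space P \<Longrightarrow> Q X = Diag X + Off X"
proof -
  assume X: "X \<in> space P"
  have "Q X = (\<Sum>a\<in>X \<inter> U. \<Sum>b\<in>X \<inter> U. (if a = b then h a else 0) + (if a \<noteq> b then G a b else 0))"
    unfolding Q_def by (intro sum.cong refl) (auto simp: G_diag)
  then show ?thesis using fin_X[OF X] by (simp add: sum.distrib Diag_def Off_def)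
qed

lemma Q_expectation:
  shows "integrable P Q" "(\<integral>X. Q X \<partial>P) = (\<integral>a. h a * rho a \<partial>\<nu>) + (\<integral>a. \<integral>b. G a b * corr2 a b \<partial>\<nu> \<partial>\<nu>)"
proof -
  show "integrable P Q"
    by (subst Bochner_Integration.integrable_cong[OF refl Q_eq]) (auto intro: Diag_expectation Off_expectation)
  show "(\<integral>X. Q X \<partial>P) = (\<integral>a. h a * rho a \<partial>\<nu>) + (\<integral>a. \<integral>b. G a b * corr2 a b \<partial>\<nu> \<partial>\<nu>)"
    by (subst Bochner_Integration.integral_cong[OF refl Q_eq]) (auto simp: Diag_expectation Off_expectation)
qed

text \<open>The two parts are not independent, so their deviations are separated by
  \<open>(u + v)\<^sup>2 \<le> 2 * u\<^sup>2 + 2 * v\<^sup>2\<close>; this gives 438 = 2 * 1 + 2 *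
  218.\<close>

lemma Q_variance: "(\<integral>\<^sup>+X. ennreal ((Q X - (\<integral>Y. Q Y \<partial>P))\<^sup>2) \<partial>P) \<le> ennreal (438 * J)"
proof -
  let ?d = "\<integral>X. Diag X \<partial>P" and ?o = "\<integral>X. Off X \<partial>P"
  have iD: "integrable P (\<lambda>X. (Diag X - ?d)\<^sup>2)" "(\<integral>X. (Diag X - ?d)\<^sup>2 \<partial>P) = (\<integral>X. (Diag X)\<^sup>2 \<partial>P) - ?d\<^sup>2"
    using P.variance_eq[OF Diag_expectation(1) Diag_variance(1)] Diag_expectation(1) Diag_variance(1)
    by (auto simp: power2_diff)
  have iO: "integrable P (\<lambda>X. (Off X - ?o)\<^sup>2)" "(\<integral>X. (Off X - ?o)\<^sup>2 \<partial>P) = (\<integral>X. (Off X)\<^sup>2 \<partial>P) - ?o\<^sup>2"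
    using P.variance_eq[OF Off_expectation(1) Off_variance(1)] Off_expectation(1) Off_variance(1)
    by (auto simp: power2_diff)
  have EQ: "(\<integral>Y. Q Y \<partial>P) = ?d + ?o" by (simp add: Q_expectation Diag_expectation Off_expectation)
  have "(\<integral>\<^sup>+X. ennreal ((Q X - (\<integral>Y. Q Y \<partial>P))\<^sup>2) \<partial>P) \<le> (\<integral>\<^sup>+X. ennreal (2 * (Diag X - ?d)\<^sup>2 + 2 * (Off X - ?o)\<^sup>2) \<partial>P)"
  proof (intro nn_integral_mono ennreal_leI)
    fix X assume "X \<in> space P"
    then have e: "Q X - (\<integral>Y. Q Y \<partial>P) = (Diag X - ?d) + (Off X - ?o)" by (simp add: Q_eq EQ)
    have "(u + v)\<^sup>2 \<le> 2 * u\<^sup>2 + 2 * v\<^sup>2" for u v :: real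
      using sum_squares_bound[of u v] by (simp add: power2_sum)
    then show "(Q X - (\<integral>Y. Q Y \<partial>P))\<^sup>2 \<le> 2 * (Diag X - ?d)\<^sup>2 + 2 * (Off X - ?o)\<^sup>2" unfolding e .
  qed
  also have "\<dots> = ennreal (\<integral>X. 2 * (Diag X - ?d)\<^sup>2 + 2 * (Off X - ?o)\<^sup>2 \<partial>P)"
    using iD iO by (intro nn_integral_eq_integral) auto
  also have "\<dots> \<le> ennreal (438 * J)"
    using iD iO Diag_variance(2) Off_variance(2) by (intro ennreal_leI) simp
  finally show ?thesis .
qed

text \<open>The kernel is the sum of \<open>Suc n * (a * cnj b) ^ n\<close>. The real part of each
  term separates into real and imaginary parts of \<open>a ^ n\<close> and \<open>b ^ n\<close>, so
  its double integral is a sum of two squares. The partial sums are bounded uniformly because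
  \<open>U\<close> keeps a distance from the circle, and nonnegativity survives the limit.\<close>

lemma bergK_form_nonneg:
  assumes [measurable]: "g \<in> borel_measurable borel" and gb: "\<And>a. \<bar>g a\<bar> \<le> B" and gU: "\<And>a. a \<notin> U \<Longrightarrow> g a = 0"
  shows "0 \<le> (\<integral>a. \<integral>b. g a * g b * Re (bergK a b) \<partial>\<nu> \<partial>\<nu>)"
proof -
  obtain r where r: "0 \<le> r" "r < 1" "U \<subseteq> cball 0 r" using relcpt_cball[OF U] by blast
  have B0: "0 \<le> B" using gb[of 0] by linarith
  let ?N = "PiM {..<2::nat} (\<lambda>_. \<nu>)"
  have fN: "finite_measure ?N" by (rule finite_measure_PiM[OF fin_nu])
  interpret N: finite_measure ?N by (rule fN)
  define p where "p = (\<lambda>k a b. \<Sum>n<k. of_nat (Suc n) * (a * cnj b) ^ n :: complex)"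
  have pm [measurable]: "(\<lambda>x. p k (x 0) (x 1)) \<in> borel_measurable ?N" for k
    unfolding p_def by measurable
  have bound: "\<bar>g a * g b * Re (p k a b)\<bar> \<le> B * B * (1 / (1 - r)\<^sup>2)" for k a b
  proof (cases "a \<in> U \<and> b \<in> U")
    case True
    then have ab: "a \<in> disk" "b \<in> disk" "cmod a \<le> 1" "cmod b \<le> r" using Ud r(3) by (auto simp: disk_def)
    have "\<bar>Re (p k a b)\<bar> \<le> cmod (p k a b)" by (rule abs_Re_le_cmod)
    also have "\<dots> \<le> 1 / (1 - cmod b)\<^sup>2" unfolding p_def by (rule bergK_partial_bound[OF ab(2,3)])
    also have "\<dots> \<le> 1 / (1 - r)\<^sup>2" using ab r by (intro divide_left_mono power_mono mult_pos_pos) auto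
    finally show ?thesis unfolding abs_mult using gb B0 by (intro mult_mono) auto
  next
    case False
    then have "g a * g b = 0" using gU by auto
    then show ?thesis using B0 by (simp only: mult_zero_left abs_zero) simp
  qed
  have lim0: "(\<lambda>k. g a * g b * Re (p k a b)) \<longlonglongrightarrow> g a * g b * Re (bergK a b)" for a b
  proof (cases "a \<in> U \<and> b \<in> U")
    case True
    then have ab: "b \<in> disk" "cmod a \<le> 1" using Ud by (auto simp: disk_def)
    show ?thesis using bergK_sums[OF ab] unfolding sums_def p_def by (intro tendsto_mult tendsto_const tendsto_Re)
  next
    case False
    then have "g a * g b = 0" using gU by auto
    then show ?thesis by (simp only: mult_zero_left tendsto_const)
  qed
  have bound': "\<bar>g a * g b * Re (bergK a b)\<bar> \<le> B * B * (1 / (1 - r)\<^sup>2)" for a b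
    by (rule Lim_bounded[OF tendsto_rabs[OF lim0], of 0]) (intro allI impI bound)
  have L: "(\<lambda>k. \<integral>x. g (x 0) * g (x 1) * Re (p k (x 0) (x 1)) \<partial>?N) \<longlonglongrightarrow> (\<integral>x. g (x 0) * g (x 1) * Re (bergK (x 0) (x 1)) \<partial>?N)"
    by (rule integral_dominated_convergence[where w = "\<lambda>_. B * B * (1 / (1 - r)\<^sup>2)"])
       (measurable, simp, rule AE_I2, rule lim0, rule AE_I2, unfold real_norm_def, rule bound)
  have "0 \<le> (\<integral>x. g (x 0) * g (x 1) * Re (p k (x 0) (x 1)) \<partial>?N)" for k
  proof -
    define P1 where "P1 = (\<lambda>n a. g a * Re (a ^ n))"
    define P2 where "P2 = (\<lambda>n a. g a * Im (a ^ n))"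
    have [measurable]: "P1 n \<in> borel_measurable borel" "P2 n \<in> borel_measurable borel" for n
      unfolding P1_def P2_def by measurable
    have Pb: "\<bar>P1 n a\<bar> \<le> B" "\<bar>P2 n a\<bar> \<le> B" for n a
    proof -
      have "\<bar>g a * y\<bar> \<le> B" if "\<bar>y\<bar> \<le> cmod (a ^ n)" for y
      proof (cases "a \<in> U")
        case True
        then have "cmod (a ^ n) \<le> 1" using Ud by (auto simp: disk_def norm_power intro!: power_le_one)
        then have "\<bar>g a\<bar> * \<bar>y\<bar> \<le> B * 1" using that gb B0 by (intro mult_mono) auto
        then show ?thesis by (simp add: abs_mult)
      qed (use gU B0 in simp)
      then show "\<bar>P1 n a\<bar> \<le> B" "\<bar>P2 n a\<bar> \<le> B" unfolding P1_def P2_def using abs_Re_le_cmod abs_Im_le_cmod by blast+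
    qed
    have PP: "\<bar>P1 n a * P1 n b\<bar> \<le> B * B" "\<bar>P2 n a * P2 n b\<bar> \<le> B * B" for n a b
      unfolding abs_mult using Pb B0 by (auto intro!: mult_mono)
    have "(\<integral>x. g (x 0) * g (x 1) * Re (p k (x 0) (x 1)) \<partial>?N) = (\<integral>x. (\<Sum>n<k. real (Suc n) * (P1 n (x 0) * P1 n (x 1) + P2 n (x 0) * P2 n (x 1))) \<partial>?N)"
    proof (intro Bochner_Integration.integral_cong refl)
      fix x :: "nat \<Rightarrow> complex"
      have "Re (of_nat (Suc n) * (x 0 * cnj (x 1)) ^ n) = real (Suc n) * (Re (x 0 ^ n) * Re (x 1 ^ n) + Im (x 0 ^ n) * Im (x 1 ^ n))" for n
        unfolding power_mult_distrib complex_cnj_power[symmetric] by (simp del: of_nat_Suc complex_cnj_power)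
      then show "g (x 0) * g (x 1) * Re (p k (x 0) (x 1)) = (\<Sum>n<k. real (Suc n) * (P1 n (x 0) * P1 n (x 1) + P2 n (x 0) * P2 n (x 1)))"
        unfolding p_def Re_sum sum_distrib_left P1_def P2_def by (intro sum.cong refl) (simp only: algebra_simps)
    qed
    also have "\<dots> = (\<Sum>n<k. real (Suc n) * ((\<integral>x. P1 n (x 0) * P1 n (x 1) \<partial>?N) + (\<integral>x. P2 n (x 0) * P2 n (x 1) \<partial>?N)))"
    proof -
      have "integrable ?N (\<lambda>x. P1 n (x 0) * P1 n (x 1))" "integrable ?N (\<lambda>x. P2 n (x 0) * P2 n (x 1))" for n
        by (rule integrable_bounded[OF fN _ PP(1)], measurable) (rule integrable_bounded[OF fN _ PP(2)], measurable)
      then show ?thesis by (simp del: of_nat_Suc One_nat_def)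
    qed
    also have "\<dots> = (\<Sum>n<k. real (Suc n) * ((\<integral>a. P1 n a \<partial>\<nu>)\<^sup>2 + (\<integral>a. P2 n a \<partial>\<nu>)\<^sup>2))"
    proof -
      have "(\<integral>x. P1 n (x 0) * P1 n (x 1) \<partial>?N) = (\<integral>a. P1 n a \<partial>\<nu>)\<^sup>2" for n
        by (subst integral_PiM_2[OF fin_nu, where h = "\<lambda>a b. P1 n a * P1 n b", OF _ _ PP(1)]) (auto simp: power2_eq_square)
      moreover have "(\<integral>x. P2 n (x 0) * P2 n (x 1) \<partial>?N) = (\<integral>a. P2 n a \<partial>\<nu>)\<^sup>2" for n
        by (subst integral_PiM_2[OF fin_nu, where h = "\<lambda>a b. P2 n a * P2 n b", OF _ _ PP(2)]) (auto simp: power2_eq_square)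
      ultimately show ?thesis by simp
    qed
    also have "\<dots> \<ge> 0" by (intro sum_nonneg) auto
    finally show ?thesis .
  qed
  then have "0 \<le> (\<integral>x. g (x 0) * g (x 1) * Re (bergK (x 0) (x 1)) \<partial>?N)"
    by (intro LIMSEQ_le_const[OF L]) auto
  also have "\<dots> = (\<integral>a. \<integral>b. g a * g b * Re (bergK a b) \<partial>\<nu> \<partial>\<nu>)"
    by (rule integral_PiM_2[OF fin_nu, where h = "\<lambda>a b. g a * g b * Re (bergK a b)", OF _ _ bound']) auto
  finally show ?thesis .
qed

lemma G_le: "G a b \<le> (h a + h b) / 2"
proof (cases "a \<in> U \<and> b \<in> U")
  case True
  have "(cmod (bergK a b))\<^sup>2 \<le> rho a * rho b" using True Ud by (intro norm_bergK_le) auto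
  then have "f a * f b * cmod (bergK a b) \<le> ((f a)\<^sup>2 * rho a + (f b)\<^sup>2 * rho b) / 2"
    by (rule amgm_sq) auto
  then show ?thesis using abs_G_le[of a b] by (simp add: h_def)
next
  case False
  then have "G a b = 0" using G_zero by auto
  then show ?thesis using h_nonneg[of a] h_nonneg[of b] by simp
qed

text \<open>By the reproducing property the integrand on the left is \<open>h a\<close> times the integral of
  \<open>\<bar>bergK a b\<bar>\<^sup>2\<close> over the complement of \<open>U\<close>.\<close>
lemma Q_expectation_ge:
  "(\<integral>a. h a * (rho a - (\<integral>b. (cmod (bergK a b))\<^sup>2 \<partial>\<nu>)) \<partial>\<nu>) \<le> (\<integral>X. Q X \<partial>P)"
proof -
  \<comment> \<open>The indicators make \<open>k\<close> bounded on the whole product space, so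
    integrability for Fubini's theorem follows from boundedness.\<close>
  define k where "k = (\<lambda>a b. (cmod (bergK a b))\<^sup>2 * (indicator U a * indicator U b))"
  define \<kappa> where "\<kappa> = (\<lambda>a. \<integral>b. k a b \<partial>\<nu>)"
  interpret pair_sigma_finite \<nu> \<nu> by standard
  have fPP: "finite_measure (\<nu> \<Otimes>\<^sub>M \<nu>)"
  proof (rule finite_measureI)
    have "emeasure (\<nu> \<Otimes>\<^sub>M \<nu>) (space \<nu> \<times> space \<nu>) = emeasure \<nu> (space \<nu>) * emeasure \<nu> (space \<nu>)"
      by (rule A.emeasure_pair_measure_Times) auto
    then show "emeasure (\<nu> \<Otimes>\<^sub>M \<nu>) (space (\<nu> \<Otimes>\<^sub>M \<nu>)) \<noteq> \<infinity>"
      using A.emeasure_finite[of UNIV] by (simp add: space_pair_measure ennreal_mult_eq_top_iff)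
  qed
  have km: "(\<lambda>(a, b). k a b) \<in> borel_measurable (borel \<Otimes>\<^sub>M borel)" unfolding k_def by measurable
  have k0: "0 \<le> k a b" for a b by (simp add: k_def)
  have kb: "k a b \<le> R\<^sup>2" for a b
    using norm_K_le_R[of a b] R by (auto simp: k_def indicator_def intro!: power_mono)
  have kU: "k a b = (cmod (bergK a b))\<^sup>2" if "a \<in> U" "b \<in> U" for a b using that by (simp add: k_def)
  have ksym: "k a b = k b a" for a b by (simp add: k_def norm_bergK_commute[of a b] mult_ac)
  note k_meas = measurable_apply2[OF km]
  have hk: "\<bar>h a * k a b\<bar> \<le> R * R\<^sup>2" "\<bar>h b * k a b\<bar> \<le> R * R\<^sup>2" for a b
    unfolding abs_mult using h_bound k0 kb R by (auto intro!: mult_mono simp: abs_of_nonneg)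
  have int_b: "integrable \<nu> (\<lambda>b. k a b)" for a
    by (rule integrable_nu[where B = "R\<^sup>2"]) (intro k_meas, auto simp: k0 kb)
  have IP: "integrable (\<nu> \<Otimes>\<^sub>M \<nu>) (\<lambda>(a, b). H a b)"
    if H: "(\<lambda>(a, b). H a b) \<in> borel_measurable (borel \<Otimes>\<^sub>M borel)" and Hb: "\<And>a b. \<bar>H a b\<bar> \<le> B" for H :: "complex \<Rightarrow> complex \<Rightarrow> real" and B
  proof (rule integrable_bounded[OF fPP])
    show "(\<lambda>(a, b). H a b) \<in> borel_measurable (\<nu> \<Otimes>\<^sub>M \<nu>)" using H by measurable
    show "\<bar>case x of (a, b) \<Rightarrow> H a b\<bar> \<le> B" for x using Hb by (cases x) simp
  qed
  have b1: "\<bar>G a b * k a b\<bar> \<le> R * R\<^sup>2" for a b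
    unfolding abs_mult using G_bound k0 kb R by (intro mult_mono) (auto simp: abs_of_nonneg)
  have m1: "(\<lambda>(a, b). G a b * k a b) \<in> borel_measurable (borel \<Otimes>\<^sub>M borel)"
    unfolding split_beta' by (intro borel_measurable_times borel_measurable_G k_meas) measurable
  have I1: "integrable (\<nu> \<Otimes>\<^sub>M \<nu>) (\<lambda>(a, b). h a * k a b)" "integrable (\<nu> \<Otimes>\<^sub>M \<nu>) (\<lambda>(a, b). h b * k a b)"
    by (rule IP[OF _ hk(1)], unfold split_beta', intro borel_measurable_times k_meas; measurable)
       (rule IP[OF _ hk(2)], unfold split_beta', intro borel_measurable_times k_meas; measurable)
  have \<kappa>m [measurable]: "\<kappa> \<in> borel_measurable borel"
    unfolding \<kappa>_def by (rule A.borel_measurable_lebesgue_integral) (unfold split_beta', intro k_meas, measurable)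
  have \<kappa>b: "\<bar>h a * \<kappa> a\<bar> \<le> R * (R\<^sup>2 * measure \<nu> UNIV)" for a
  proof -
    have "0 \<le> \<kappa> a" unfolding \<kappa>_def by (rule Bochner_Integration.integral_nonneg) (rule k0)
    moreover have "\<kappa> a \<le> (\<integral>b. R\<^sup>2 \<partial>\<nu>)" unfolding \<kappa>_def by (rule integral_mono[OF int_b]) (auto intro: kb)
    ultimately show ?thesis unfolding abs_mult using h_bound[of a] R by (intro mult_mono) (auto simp: mult.commute)
  qed
  \<comment> \<open>\<open>G a b\<close> is at most the mean of \<open>h a\<close> and
    \<open>h b\<close>. As \<open>k\<close> is symmetric, swapping the order of integration shows
    that both halves equal half of the right side.\<close>
  have Gk: "(\<integral>a. \<integral>b. G a b * k a b \<partial>\<nu> \<partial>\<nu>) \<le> (\<integral>a. h a * \<kappa> a \<partial>\<nu>)"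
  proof -
    have IG: "integrable (\<nu> \<Otimes>\<^sub>M \<nu>) (\<lambda>(a, b). G a b * k a b)"
      by (rule IP[OF m1 b1])
    have "(\<integral>a. \<integral>b. G a b * k a b \<partial>\<nu> \<partial>\<nu>) = (\<integral>x. (case x of (a, b) \<Rightarrow> G a b * k a b) \<partial>(\<nu> \<Otimes>\<^sub>M \<nu>))"
      using integral_fst'[OF IG] by simp
    also have "\<dots> \<le> (\<integral>x. (1/2) * (case x of (a, b) \<Rightarrow> h a * k a b) + (1/2) * (case x of (a, b) \<Rightarrow> h b * k a b) \<partial>(\<nu> \<Otimes>\<^sub>M \<nu>))"
    proof (rule integral_mono[OF IG])
      fix x :: "complex \<times> complex"
      obtain a b where x: "x = (a, b)" by force
      have "G a b * k a b \<le> (h a + h b) / 2 * k a b" by (rule mult_right_mono[OF G_le k0])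
      then show "(case x of (a, b) \<Rightarrow> G a b * k a b) \<le> (1/2) * (case x of (a, b) \<Rightarrow> h a * k a b) + (1/2) * (case x of (a, b) \<Rightarrow> h b * k a b)"
        unfolding x by (simp add: algebra_simps add_divide_distrib)
    qed (use I1 in auto)
    also have "\<dots> = (1/2) * (\<integral>x. (case x of (a, b) \<Rightarrow> h a * k a b) \<partial>(\<nu> \<Otimes>\<^sub>M \<nu>)) + (1/2) * (\<integral>x. (case x of (a, b) \<Rightarrow> h b * k a b) \<partial>(\<nu> \<Otimes>\<^sub>M \<nu>))"
      using I1 by simp
    also have "(\<integral>x. (case x of (a, b) \<Rightarrow> h a * k a b) \<partial>(\<nu> \<Otimes>\<^sub>M \<nu>)) = (\<integral>a. \<integral>b. h a * k a b \<partial>\<nu> \<partial>\<nu>)"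
      using integral_fst'[OF I1(1)] by simp
    also have "\<dots> = (\<integral>a. h a * \<kappa> a \<partial>\<nu>)" by (simp add: \<kappa>_def)
    also have "(\<integral>x. (case x of (a, b) \<Rightarrow> h b * k a b) \<partial>(\<nu> \<Otimes>\<^sub>M \<nu>)) = (\<integral>b. \<integral>a. h b * k a b \<partial>\<nu> \<partial>\<nu>)"
      by (rule integral_snd[OF I1(2), symmetric])
    also have "\<dots> = (\<integral>b. \<integral>a. h b * k b a \<partial>\<nu> \<partial>\<nu>)"
      by (intro Bochner_Integration.integral_cong refl arg_cong2[where f = "(*)"] ksym)
    also have "\<dots> = (\<integral>a. h a * \<kappa> a \<partial>\<nu>)" by (simp add: \<kappa>_def)
    finally show ?thesis by simp
  qed
  \<comment> \<open>This double integral is the squared norm of the mean vector of the statistic.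
    Discarding it passes from the expected squared norm to the variance of the vector.\<close>
  have pos: "0 \<le> (\<integral>a. \<integral>b. (f a * rho a) * (f b * rho b) * Re (bergK a b) \<partial>\<nu> \<partial>\<nu>)"
  proof (rule bergK_form_nonneg[where B = R])
    show "\<bar>f a * rho a\<bar> \<le> R" for a
    proof (cases "a \<in> U")
      case True
      then have "f a * rho a \<le> 1 * R" using f0 f1 R by (intro mult_mono) auto
      then show ?thesis using f0 by simp
    qed (use fU R in simp)
  qed (auto simp: fU)
  have Gc: "G a b * corr2 a b = (f a * rho a) * (f b * rho b) * Re (bergK a b) - G a b * k a b" for a b
  proof (cases "a \<in> U \<and> b \<in> U")
    case True
    then show ?thesis by (simp add: kU corr2_def G_def algebra_simps)
  next
    case False
    then have "G a b = 0" "f a * f b = 0" using G_zero fU by auto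
    then show ?thesis by (auto simp: algebra_simps)
  qed
  have split: "(\<integral>a. \<integral>b. G a b * corr2 a b \<partial>\<nu> \<partial>\<nu>) = (\<integral>a. \<integral>b. (f a * rho a) * (f b * rho b) * Re (bergK a b) \<partial>\<nu> \<partial>\<nu>) - (\<integral>a. \<integral>b. G a b * k a b \<partial>\<nu> \<partial>\<nu>)"
  proof -
    have b2: "\<bar>(f a * rho a) * (f b * rho b) * Re (bergK a b)\<bar> \<le> R * R\<^sup>2" for a b
    proof (cases "a \<in> U \<and> b \<in> U")
      case True
      have "(f a * rho a) * (f b * rho b) * Re (bergK a b) = G a b * (rho a * rho b)" by (simp add: G_def algebra_simps)
      also have "\<bar>\<dots>\<bar> \<le> R * (R * R)" unfolding abs_mult[of "G a b"] using G_bound[of a b] True R by (intro mult_mono) (auto simp: abs_mult intro!: mult_mono)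
      finally show ?thesis by (simp add: power2_eq_square)
    next
      case False
      then have "f a * f b = 0" using fU by auto
      then show ?thesis using R by auto
    qed
    let ?N = "PiM {..<2::nat} (\<lambda>_. \<nu>)"
    have fN: "finite_measure ?N" by (rule finite_measure_PiM[OF fin_nu])
    have m2: "(\<lambda>(a, b). (f a * rho a) * (f b * rho b) * Re (bergK a b)) \<in> borel_measurable (borel \<Otimes>\<^sub>M borel)" by measurable
    have "(\<integral>a. \<integral>b. G a b * corr2 a b \<partial>\<nu> \<partial>\<nu>) = (\<integral>x. G (x 0) (x 1) * corr2 (x 0) (x 1) \<partial>?N)"
    proof (rule integral_PiM_2[OF fin_nu, symmetric, where B = "R * R\<^sup>2 + R * R\<^sup>2"])
      show "\<bar>G a b * corr2 a b\<bar> \<le> R * R\<^sup>2 + R * R\<^sup>2" for a b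
        unfolding Gc by (rule order_trans[OF abs_triangle_ineq4 add_mono[OF b2 b1]])
    qed auto
    also have "\<dots> = (\<integral>x. (f (x 0) * rho (x 0)) * (f (x 1) * rho (x 1)) * Re (bergK (x 0) (x 1)) - G (x 0) (x 1) * k (x 0) (x 1) \<partial>?N)"
      by (simp only: Gc)
    also have "\<dots> = (\<integral>x. (f (x 0) * rho (x 0)) * (f (x 1) * rho (x 1)) * Re (bergK (x 0) (x 1)) \<partial>?N) - (\<integral>x. G (x 0) (x 1) * k (x 0) (x 1) \<partial>?N)"
    proof (rule Bochner_Integration.integral_diff)
      show "integrable ?N (\<lambda>x. (f (x 0) * rho (x 0)) * (f (x 1) * rho (x 1)) * Re (bergK (x 0) (x 1)))"
        by (rule integrable_bounded[OF fN _ b2]) measurable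
      show "integrable ?N (\<lambda>x. G (x 0) (x 1) * k (x 0) (x 1))"
        by (rule integrable_bounded[OF fN _ b1]) (rule measurable_apply2[OF m1], measurable)
    qed
    also have "(\<integral>x. (f (x 0) * rho (x 0)) * (f (x 1) * rho (x 1)) * Re (bergK (x 0) (x 1)) \<partial>?N) = (\<integral>a. \<integral>b. (f a * rho a) * (f b * rho b) * Re (bergK a b) \<partial>\<nu> \<partial>\<nu>)"
      by (rule integral_PiM_2[OF fin_nu _ m2 b2]) simp
    also have "(\<integral>x. G (x 0) (x 1) * k (x 0) (x 1) \<partial>?N) = (\<integral>a. \<integral>b. G a b * k a b \<partial>\<nu> \<partial>\<nu>)"
      by (rule integral_PiM_2[OF fin_nu _ m1 b1]) simp
    finally show ?thesis .
  qed
  have "(\<integral>a. h a * (rho a - (\<integral>b. (cmod (bergK a b))\<^sup>2 \<partial>\<nu>)) \<partial>\<nu>) = (\<integral>a. h a * rho a - h a * \<kappa> a \<partial>\<nu>)"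
  proof (intro Bochner_Integration.integral_cong refl)
    fix a
    have "(\<integral>b. (cmod (bergK a b))\<^sup>2 \<partial>\<nu>) = \<kappa> a" if "a \<in> U"
      unfolding \<kappa>_def using AE_area_on[OF Ub] that
      by (intro integral_cong_AE) (auto elim!: eventually_mono intro!: k_meas simp: kU)
    then show "h a * (rho a - (\<integral>b. (cmod (bergK a b))\<^sup>2 \<partial>\<nu>)) = h a * rho a - h a * \<kappa> a"
      using h_zero[of a] by (cases "a \<in> U") (auto simp: algebra_simps)
  qed
  also have "\<dots> = (\<integral>a. h a * rho a \<partial>\<nu>) - (\<integral>a. h a * \<kappa> a \<partial>\<nu>)"
    by (intro Bochner_Integration.integral_diff integrable_nu[OF _ h_rho_bound] integrable_nu[OF _ \<kappa>b]) auto
  finally show ?thesis using Q_expectation(2) split pos Gk by linarith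
qed

end

section \<open>The hyperbolic weights\<close>

lemma bergK_inner:
  assumes x: "x \<in> disk" and y: "y \<in> disk"
  shows "integrable (area_on disk) (\<lambda>w. bergK w x * cnj (bergK w y))"
    "(\<integral>w. bergK w x * cnj (bergK w y) \<partial>area_on disk) = bergK y x"
proof -
  interpret finite_measure "area_on disk" by (rule finite_measure_area_disk)
  have AEd: "AE w in area_on disk. w \<in> disk" by (rule AE_area_on) simp
  show "integrable (area_on disk) (\<lambda>w. bergK w x * cnj (bergK w y))"
  proof (rule integrable_const_bound[where B = "1 / (1 - cmod x)\<^sup>2 * (1 / (1 - cmod y)\<^sup>2)"])
    show "AE w in area_on disk. norm (bergK w x * cnj (bergK w y)) \<le> 1 / (1 - cmod x)\<^sup>2 * (1 / (1 - cmod y)\<^sup>2)"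
      using AEd
    proof eventually_elim
      case (elim w)
      show ?case unfolding norm_mult complex_mod_cnj
        by (intro mult_mono norm_bergK_bound x y elim) auto
    qed
  qed auto
  have "(\<integral>w. bergK w x * cnj (bergK w y) \<partial>area_on disk) = (\<integral>w. indicator {w. (cmod w)\<^sup>2 < 1} w * bergK w x * cnj (bergK w y) \<partial>area_on disk)"
    using AEd by (intro integral_cong_AE) (auto elim!: eventually_mono dest!: one_minus_norm_pos simp: indicator_def)
  also have "\<dots> = bergK y x"
    using integral_area_disk_bergK_bergK[of 1 x y] x y by (simp add: bergK_def mult.commute)
  finally show "(\<integral>w. bergK w x * cnj (bergK w y) \<partial>area_on disk) = bergK y x" .
qed

text \<open>The reproducing property evaluates each inner product of two kernel functions. The left
  side is real, so taking real parts of the double sum loses nothing.\<close>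

lemma A2_norm_sq_sum:
  assumes Y: "finite Y" "Y \<subseteq> disk"
  shows "A2_norm_sq (\<lambda>w. \<Sum>x\<in>Y. complex_of_real (c x) * bergK w x) = (\<Sum>x\<in>Y. \<Sum>y\<in>Y. c x * c y * Re (bergK x y))"
proof -
  let ?g = "\<lambda>w. \<Sum>x\<in>Y. complex_of_real (c x) * bergK w x"
  have "A2_norm_sq ?g = (\<integral>w. (cmod (?g w))\<^sup>2 \<partial>area_on disk)"
  proof -
    have "(\<integral>w. (cmod (?g w))\<^sup>2 \<partial>area_on disk) = (\<integral>w. (indicator disk w / pi) *\<^sub>R (cmod (?g w))\<^sup>2 \<partial>lborel)"
      unfolding area_on_def by (subst integral_density) auto
    also have "\<dots> = (\<integral>w. (indicator disk w *\<^sub>R (cmod (?g w))\<^sup>2) / pi \<partial>lborel)" by simp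
    also have "\<dots> = A2_norm_sq ?g"
      unfolding A2_norm_sq_def set_lebesgue_integral_def by (rule integral_divide_zero)
    finally show ?thesis by simp
  qed
  also have "complex_of_real \<dots> = (\<integral>w. complex_of_real ((cmod (?g w))\<^sup>2) \<partial>area_on disk)"
    by (rule integral_complex_of_real[symmetric])
  also have "\<dots> = (\<integral>w. (\<Sum>x\<in>Y. \<Sum>y\<in>Y. complex_of_real (c x * c y) * (bergK w x * cnj (bergK w y))) \<partial>area_on disk)"
  proof (intro Bochner_Integration.integral_cong refl)
    fix w
    have "complex_of_real ((cmod (?g w))\<^sup>2) = ?g w * cnj (?g w)" by (rule complex_norm_square)
    also have "\<dots> = (\<Sum>x\<in>Y. \<Sum>y\<in>Y. complex_of_real (c x * c y) * (bergK w x * cnj (bergK w y)))"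
      by (simp add: sum_product mult_ac)
    finally show "complex_of_real ((cmod (?g w))\<^sup>2) = (\<Sum>x\<in>Y. \<Sum>y\<in>Y. complex_of_real (c x * c y) * (bergK w x * cnj (bergK w y)))" .
  qed
  also have "\<dots> = (\<Sum>x\<in>Y. \<Sum>y\<in>Y. complex_of_real (c x * c y) * (\<integral>w. bergK w x * cnj (bergK w y) \<partial>area_on disk))"
    using Y bergK_inner(1) by (subst Bochner_Integration.integral_sum) (auto intro!: Bochner_Integration.integrable_sum sum.cong simp: subset_iff)
  also have "\<dots> = (\<Sum>x\<in>Y. \<Sum>y\<in>Y. complex_of_real (c x * c y) * bergK y x)"
    using Y by (intro sum.cong refl) (auto simp: bergK_inner subset_iff)
  finally have "complex_of_real (A2_norm_sq ?g) = (\<Sum>x\<in>Y. \<Sum>y\<in>Y. complex_of_real (c x * c y) * bergK y x)" .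
  then have "Re (complex_of_real (A2_norm_sq ?g)) = Re (\<Sum>x\<in>Y. \<Sum>y\<in>Y. complex_of_real (c x * c y) * bergK y x)" by simp
  then have "A2_norm_sq ?g = (\<Sum>x\<in>Y. \<Sum>y\<in>Y. c x * c y * Re (bergK y x))" by simp
  also have "\<dots> = (\<Sum>x\<in>Y. \<Sum>y\<in>Y. c x * c y * Re (bergK x y))"
    by (intro sum.cong refl arg_cong2[where f = "(*)"]) (subst cnj_bergK[symmetric], simp)
  finally show ?thesis .
qed

section \<open>The statistic on hyperbolic balls\<close>

locale hyperbolic_statistic =
  fixes s :: real and z :: complex and P :: "complex set measure"
  assumes s: "1 < s" "s < 3/2" and z: "z \<in> disk" and DPP: "is_DPP_K P"
begin

definition "A = (1 + cmod z) / (1 - cmod z)"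

lemma A_ge: "1 \<le> A"
  using z by (simp add: A_def disk_def field_simps)

lemmas dh_bounds = exp_dh_bounds[OF z _ A_def]

abbreviation "U N \<equiv> hypball N z"
abbreviation w :: "complex \<Rightarrow> real" where "w x \<equiv> 1 - (cmod x)\<^sup>2"

definition f :: "real \<Rightarrow> complex \<Rightarrow> real" where "f N x = exp (- s * dh z x) * indicator (U N) x"

lemma exp_powr: "exp (- s * dh z x) = exp (- dh z x) powr s"
  by (simp add: powr_def)

lemma w_bounds: "x \<in> disk \<Longrightarrow> 0 < w x \<and> w x \<le> 1"
  using one_minus_norm_pos[of x] by simp

lemma hypball_borel [measurable]: "U N \<in> sets borel"
proof -
  have "U N = disk \<inter> {x \<in> space borel. dh z x < N}" by (auto simp: hypball_def)
  also have "\<dots> \<in> sets borel" unfolding dh_def mobius_def by measurable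
  finally show ?thesis .
qed

lemma hypball_disk: "U N \<subseteq> disk" by (auto simp: hypball_def)

text \<open>Together with the converse inclusion that follows, this places the hyperbolic ball
  between two centred Euclidean disks whose defects differ by the factor
  \<open>4 * A\<^sup>2\<close>. Integrals over centred disks are explicit, so \<open>z\<close>
  enters only through constants.\<close>

lemma hypball_w: "x \<in> U N \<Longrightarrow> exp (- N) / A < w x"
proof -
  assume x: "x \<in> U N"
  then have "exp (- N) < exp (- dh z x)" by (simp add: hypball_def)
  also have "\<dots> \<le> A * w x" using x hypball_disk by (intro dh_bounds) auto
  finally show ?thesis using A_ge by (simp add: divide_less_eq mult.commute)
qed

lemma hypballI: "x \<in> disk \<Longrightarrow> 4 * A * exp (- N) < w x \<Longrightarrow> x \<in> U N"
proof -
  assume x: "x \<in> disk" and "4 * A * exp (- N) < w x"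
  then have "exp (- N) < w x / (4 * A)" using A_ge by (simp add: less_divide_eq mult.commute)
  also have "\<dots> \<le> exp (- dh z x)" by (rule dh_bounds(1)[OF x])
  finally show ?thesis using x by (simp add: hypball_def)
qed

lemma relcpt_hypball: "relcpt (U N)"
proof (rule relcptI)
  show "U N \<subseteq> cball 0 (sqrt (1 - exp (- N) / A))"
  proof
    fix x assume "x \<in> U N"
    from hypball_w[OF this] have "(cmod x)\<^sup>2 \<le> 1 - exp (- N) / A" by linarith
    then have "cmod x \<le> sqrt (1 - exp (- N) / A)" by (rule real_le_rsqrt)
    then show "x \<in> cball 0 (sqrt (1 - exp (- N) / A))" by simp
  qed
  have "0 < exp (- N) / A" using A_ge by (intro divide_pos_pos) auto
  then have "sqrt (1 - exp (- N) / A) < sqrt 1" by (intro real_sqrt_less_mono) linarith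
  then show "sqrt (1 - exp (- N) / A) < 1" by simp
qed (rule hypball_borel)

lemma dh_nonneg: "x \<in> disk \<Longrightarrow> 0 \<le> dh z x"
  using dh_bounds(3)[of x] unfolding dh_def by (intro ln_ge_zero) (simp add: field_simps)

lemma f_meas [measurable]: "f N \<in> borel_measurable borel"
  unfolding f_def dh_def mobius_def by measurable

lemma f_cont: "continuous_on (U N) (f N)"
proof -
  have nz: "1 - cnj z * x \<noteq> 0" if "x \<in> U N" for x
  proof
    have x: "x \<in> disk" using that hypball_disk by auto
    assume "1 - cnj z * x = 0"
    moreover have "cmod (cnj z * x) < 1"
      using x z mult_left_mono[of "cmod x" 1 "cmod z"] by (auto simp: disk_def norm_mult)
    ultimately show False by auto
  qed
  have "continuous_on (U N) (\<lambda>x. exp (- s * dh z x))"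
    unfolding dh_def mobius_def
  proof (intro continuous_intros ballI nz)
    fix x assume "x \<in> U N"
    then have x: "x \<in> disk" using hypball_disk by auto
    have m: "cmod ((z - x) / (1 - cnj z * x)) < 1" using dh_bounds(3)[OF x] by (simp add: mobius_def)
    then show "1 - cmod ((z - x) / (1 - cnj z * x)) \<noteq> 0" by simp
    have "0 < (1 + cmod ((z - x) / (1 - cnj z * x))) / (1 - cmod ((z - x) / (1 - cnj z * x)))"
      using m by (intro divide_pos_pos add_pos_nonneg) auto
    then show "(1 + cmod ((z - x) / (1 - cnj z * x))) / (1 - cmod ((z - x) / (1 - cnj z * x))) \<noteq> 0" by (rule less_imp_neq[symmetric])
  qed
  then show ?thesis by (rule continuous_on_eq) (simp add: f_def)
qed

lemma f_le: "f N x \<le> A powr s * w x powr s" if "x \<in> disk"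
proof (cases "x \<in> U N")
  case True
  have "exp (- dh z x) powr s \<le> (A * w x) powr s"
    using s dh_bounds(2)[OF that] by (intro powr_mono2) auto
  also have "\<dots> = A powr s * w x powr s" by (rule powr_mult)
  finally show ?thesis using True by (simp only: f_def exp_powr indicator_simps mult_1_right)
qed (simp add: f_def)

text \<open>\<open>C1\<close> adds the constant 4 of the pointwise kernel bound to
  \<open>2 / (s - 1)\<close> of the integral bound, so that one \<open>m\<close> serves for both;
  the exponent is that of the integral bound, the worse of the two because \<open>1 < s\<close>. The
  leading 2 in \<open>CJ\<close> is the integral of \<open>t powr (-1/2)\<close> over the unit
  interval.\<close>

definition "C1 = A powr s * (4 + 2 / (s - 1))"
definition m :: "complex \<Rightarrow> real" where "m x = C1 * w x powr (- ((3 - s) / 2))"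
definition "CJ = 2 * ((A powr s)\<^sup>2 * C1\<^sup>2) * A powr (9/2 - 3 * s)"

lemma C1_pos: "0 < C1"
  using s A_ge by (auto simp: C1_def intro!: mult_pos_pos add_pos_pos divide_pos_pos)

text \<open>The integrand is of order
  \<open>w powr (2 * s - (3 - s) - 2) = w powr (3 * s - 5)\<close>. This is split into
  \<open>w powr (- (9/2 - 3 * s))\<close>, largest at the edge of the ball where \<open>w\<close> is
  about \<open>exp (- N)\<close> because \<open>s < 3/2\<close>, and \<open>w powr (-1/2)\<close>,
  which is integrable over the disk. The split treats all \<open>s\<close> in the range
  alike.\<close>

lemma J_bound: "(\<integral>\<^sup>+x. ennreal ((f N x)\<^sup>2 * (m x)\<^sup>2 * rho x) \<partial>area_on (U N)) \<le> ennreal (CJ * exp ((9/2 - 3 * s) * N))"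
proof -
  let ?c = "(A powr s)\<^sup>2 * C1\<^sup>2 * (A powr (9/2 - 3 * s) * exp ((9/2 - 3 * s) * N))"
  have c0: "0 \<le> ?c" by simp
  have pt: "(f N x)\<^sup>2 * (m x)\<^sup>2 * rho x \<le> ?c * w x powr (-1/2)" if x: "x \<in> U N" for x
  proof -
    have xd: "x \<in> disk" using x hypball_disk by auto
    note wb = w_bounds[OF xd]
    have "(f N x)\<^sup>2 \<le> (A powr s * w x powr s)\<^sup>2" using f_le[OF xd] by (intro power_mono) (auto simp: f_def)
    then have "(f N x)\<^sup>2 * (m x)\<^sup>2 * rho x \<le> (A powr s * w x powr s)\<^sup>2 * (m x)\<^sup>2 * rho x"
      by (intro mult_right_mono) auto
    also have "\<dots> = (A powr s)\<^sup>2 * C1\<^sup>2 * (w x powr (s + s) * w x powr (- ((3 - s) / 2) + - ((3 - s) / 2)) * w x powr (-2))"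
    proof -
      have "rho x = w x powr (-2)" using wb by (simp add: rho_def powr_neg_numeral)
      then show ?thesis unfolding m_def powr_add power2_eq_square by (simp only: mult_ac)
    qed
    also have "w x powr (s + s) * w x powr (- ((3 - s) / 2) + - ((3 - s) / 2)) * w x powr (-2) = w x powr (3 * s - 5)"
      unfolding powr_add[symmetric] by (rule arg_cong2[where f = "(powr)"]) (simp_all add: field_simps)
    also have "\<dots> = w x powr (- (9/2 - 3 * s)) * w x powr (-1/2)"
      unfolding powr_add[symmetric] by (rule arg_cong2[where f = "(powr)"]) (simp_all add: field_simps)
    finally have le: "(f N x)\<^sup>2 * (m x)\<^sup>2 * rho x \<le> (A powr s)\<^sup>2 * C1\<^sup>2 * (w x powr (- (9/2 - 3 * s)) * w x powr (-1/2))" .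
    have "w x powr (- (9/2 - 3 * s)) \<le> (exp (- N) / A) powr (- (9/2 - 3 * s))"
      using hypball_w[OF x] A_ge s by (intro powr_mono2') auto
    also have "(exp (- N) / A) powr (- (9/2 - 3 * s)) = A powr (9/2 - 3 * s) * exp ((9/2 - 3 * s) * N)"
    proof -
      have "(exp (- N) / A) powr (- (9/2 - 3 * s)) = exp (- N) powr (- (9/2 - 3 * s)) / A powr (- (9/2 - 3 * s))"
        by (rule powr_divide)
      also have "exp (- N) powr (- (9/2 - 3 * s)) = exp ((9/2 - 3 * s) * N)" by (simp add: powr_def algebra_simps)
      finally show ?thesis by (simp only: powr_minus[of A] divide_inverse inverse_inverse_eq mult.commute)
    qed
    finally have "(A powr s)\<^sup>2 * C1\<^sup>2 * (w x powr (- (9/2 - 3 * s)) * w x powr (-1/2))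
      \<le> (A powr s)\<^sup>2 * C1\<^sup>2 * ((A powr (9/2 - 3 * s) * exp ((9/2 - 3 * s) * N)) * w x powr (-1/2))"
      by (intro mult_left_mono mult_right_mono) auto
    with le show ?thesis by (simp only: mult.assoc)
  qed
  have "(\<integral>\<^sup>+x. ennreal ((f N x)\<^sup>2 * (m x)\<^sup>2 * rho x) \<partial>area_on (U N)) \<le> (\<integral>\<^sup>+x. ennreal (?c * w x powr (-1/2)) \<partial>area_on (U N))"
  proof (rule nn_integral_mono_AE)
    show "AE x in area_on (U N). ennreal ((f N x)\<^sup>2 * (m x)\<^sup>2 * rho x) \<le> ennreal (?c * w x powr (-1/2))"
      using AE_area_on[OF hypball_borel] by eventually_elim (intro ennreal_leI pt)
  qed
  also have "\<dots> \<le> (\<integral>\<^sup>+x. ennreal (?c * w x powr (-1/2)) \<partial>area_on disk)"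
    by (rule nn_integral_area_on_mono[OF hypball_disk]) auto
  also have "\<dots> = ennreal ?c * (\<integral>\<^sup>+x. ennreal (w x powr (-1/2)) \<partial>area_on disk)"
    unfolding ennreal_mult[OF c0 powr_ge_zero] by (rule nn_integral_cmult) measurable
  also have "(\<integral>\<^sup>+x. ennreal (w x powr (-1/2)) \<partial>area_on disk) = ennreal (1 / (-1/2 + 1))"
    by (rule trans[OF nn_integral_area_disk_radial[where h = "\<lambda>t. ennreal (t powr (-1/2))"] nn_integral_powr_unit]) auto
  also have "ennreal ?c * ennreal (1 / (-1/2 + 1)) = ennreal (CJ * exp ((9/2 - 3 * s) * N))"
    using c0 by (subst ennreal_mult[symmetric]) (auto simp: CJ_def mult_ac)
  finally show ?thesis .
qed

sublocale W: weighted_DPP P "U N" "f N" m "CJ * exp ((9/2 - 3 * s) * N)" for N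
proof
  show "is_DPP_K P" by (rule DPP)
  show "relcpt (U N)" by (rule relcpt_hypball)
  show "0 \<le> f N x" for x by (simp add: f_def)
  show "f N x \<le> 1" for x
    using dh_nonneg[of x] s hypball_disk[of N] by (auto simp: f_def indicator_def)
  show "f N x = 0" if "x \<notin> U N" for x using that by (simp add: f_def)
  show "continuous_on (U N) (f N)" by (rule f_cont)
  show "m \<in> borel_measurable borel" unfolding m_def by measurable
  show "0 \<le> m x" for x using C1_pos by (simp add: m_def)
  show "(\<integral>\<^sup>+x. ennreal ((f N x)\<^sup>2 * (m x)\<^sup>2 * rho x) \<partial>area_on (U N)) \<le> ennreal (CJ * exp ((9/2 - 3 * s) * N))" by (rule J_bound)
  show "0 \<le> CJ * exp ((9/2 - 3 * s) * N)" by (simp add: CJ_def)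
  show "f N y * cmod (bergK x y) \<le> m x" if "x \<in> U N" "y \<in> U N" for x y
  proof -
    have xy: "x \<in> disk" "y \<in> disk" using that hypball_disk by auto
    note wb = w_bounds[OF xy(1)]
    have "f N y * cmod (bergK x y) \<le> A powr s * w y powr s * cmod (bergK x y)"
      by (intro mult_right_mono f_le xy) auto
    also have "\<dots> \<le> A powr s * (4 * w x powr (s - 2))"
      unfolding mult.assoc using s by (intro mult_left_mono norm_bergK_powr_le xy) auto
    also have "\<dots> \<le> A powr s * (4 * w x powr (- ((3 - s) / 2)))"
      using wb s by (intro mult_left_mono powr_mono') (auto simp: field_simps)
    also have "\<dots> \<le> m x"
      unfolding m_def C1_def mult.assoc[of "A powr s"] using s by (intro mult_left_mono mult_right_mono) auto
    finally show ?thesis .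
  qed
  show "(\<integral>\<^sup>+y. ennreal (f N y * cmod (bergK x y) * rho y) \<partial>area_on (U N)) \<le> ennreal (m x)" if "x \<in> U N" for x
  proof -
    have x: "x \<in> disk" using that hypball_disk by auto
    have "(\<integral>\<^sup>+y. ennreal (f N y * cmod (bergK x y) * rho y) \<partial>area_on (U N)) \<le> (\<integral>\<^sup>+y. ennreal (f N y * cmod (bergK x y) * rho y) \<partial>area_on disk)"
      by (rule nn_integral_area_on_mono[OF hypball_disk]) auto
    also have "\<dots> \<le> (\<integral>\<^sup>+y. ennreal (A powr s) * ennreal (w y powr (s - 2) * cmod (bergK x y)) \<partial>area_on disk)"
    proof (rule nn_integral_mono_AE)
      show "AE y in area_on disk. ennreal (f N y * cmod (bergK x y) * rho y) \<le> ennreal (A powr s) * ennreal (w y powr (s - 2) * cmod (bergK x y))"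
        using AE_area_on[OF disk_borel]
      proof eventually_elim
        case (elim y)
        note wb = w_bounds[OF elim]
        have "f N y * cmod (bergK x y) * rho y \<le> A powr s * w y powr s * cmod (bergK x y) * rho y"
          by (intro mult_right_mono f_le elim) auto
        also have "\<dots> = A powr s * (w y powr (s - 2) * cmod (bergK x y))"
          using wb by (simp add: rho_def powr_diff powr_numeral)
        finally show ?case by (subst ennreal_mult[symmetric]) (auto intro!: ennreal_leI)
      qed
    qed
    also have "\<dots> = ennreal (A powr s) * (\<integral>\<^sup>+y. ennreal (w y powr (s - 2) * cmod (bergK x y)) \<partial>area_on disk)"
      by (rule nn_integral_cmult) measurable
    also have "\<dots> \<le> ennreal (A powr s) * ennreal (2 / (s - 1) * w x powr (- ((3 - s) / 2)))"
      using s x by (intro mult_left_mono nn_integral_bergK_powr_le) auto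
    also have "\<dots> = ennreal (A powr s * (2 / (s - 1) * w x powr (- ((3 - s) / 2))))"
      using s by (subst ennreal_mult[symmetric]) auto
    also have "\<dots> \<le> ennreal (m x)"
      unfolding m_def C1_def mult.assoc[of "A powr s"] by (intro ennreal_leI mult_left_mono mult_right_mono) auto
    finally show ?thesis .
  qed
qed auto

lemma Q_eq_norm: "X \<in> Conf \<Longrightarrow> W.Q N X = A2_norm_sq (Theta s z N X)"
proof -
  assume X: "X \<in> Conf"
  have fin: "finite (X \<inter> U N)" by (rule Conf_finite[OF X relcpt_hypball])
  have "A2_norm_sq (Theta s z N X) = (\<Sum>x\<in>X \<inter> U N. \<Sum>y\<in>X \<inter> U N. exp (- s * dh z x) * exp (- s * dh z y) * Re (bergK x y))"
    unfolding Theta_def using hypball_disk by (intro A2_norm_sq_sum fin) auto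
  also have "\<dots> = W.Q N X"
    unfolding W.Q_def W.G_def by (intro sum.cong refl) (auto simp: f_def)
  finally show ?thesis by simp
qed

section \<open>Growth of the expected squared norm\<close>

text \<open>With \<open>e = exp (- N)\<close>, \<open>\<tau>\<close> solves
  \<open>8 * A * e * \<tau> = e / (2 * A)\<close>: the right side is half of the margin
  \<open>e / A\<close> between the ball and the circle, and \<open>8 * A * e\<close> bounds
  \<open>w\<close> on the shell. \<open>CE\<close> collects a lower bound for the escaping fraction
  of mass, the area \<open>4 * A * e\<close> of the shell and the bound
  \<open>1 / (8 * A * e) ^ 4\<close> for \<open>rho\<^sup>2\<close>, with the powers of
  \<open>e\<close> split off.\<close>

definition "\<tau> = 1 / (16 * A\<^sup>2)"
definition "CE = (1 - 1 / (1 + \<tau>)\<^sup>2) * (4 * A / (8 * A) ^ 4)"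

lemma \<tau>_pos: "0 < \<tau>" using A_ge by (simp add: \<tau>_def)

lemma \<tau>'_pos: "0 < 1 - 1 / (1 + \<tau>)\<^sup>2"
  using \<tau>_pos by (simp add: one_less_power)

lemma CE_pos: "0 < CE"
  using A_ge \<tau>'_pos by (auto simp: CE_def intro!: mult_pos_pos divide_pos_pos)

text \<open>Only the shell \<open>S\<close> just inside the boundary of the hyperbolic ball is used: from there a fixed
  fraction of the mass of \<open>\<bar>bergK a b\<bar>\<^sup>2\<close> lies outside the ball.\<close>
lemma expectation_ge:
  assumes N: "0 \<le> N" and N0: "16 * A * exp (- N) \<le> 1"
  shows "CE * exp ((3 - 2 * s) * N) \<le> (\<integral>X. W.Q N X \<partial>P)"
proof -
  define e where "e = exp (- N)"
  have e: "0 < e" "e \<le> 1" "16 * A * e \<le> 1" using N N0 by (auto simp: e_def)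
  \<comment> \<open>The ball lies in the disk where \<open>w\<close> exceeds \<open>d\<close>, so
    the kernel mass inside the ball is at most the explicit integral over the disk of squared radius
    \<open>1 - d\<close>.\<close>
  define d where "d = e / A"
  have d: "0 < d" "d \<le> 1" using e A_ge by (auto simp: d_def divide_le_eq_1)
  \<comment> \<open>The lower limit \<open>4 * A * e\<close> puts the shell inside the ball. The
    upper limit keeps it within a bounded factor of the edge, and \<open>16 * A * e \<le> 1\<close>
    makes it at most 1/2, hence \<open>\<bar>a\<bar>\<^sup>2\<close> at least 1/2 on the
    shell.\<close>
  define S where "S = {x \<in> disk. 4 * A * e < w x \<and> w x < 8 * A * e}"
  have S_eq: "S = disk \<inter> {x \<in> space borel. 4 * A * e < w x \<and> w x < 8 * A * e}" by (auto simp: S_def)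
  have Sm [measurable]: "S \<in> sets borel" unfolding S_eq by measurable
  have SU: "S \<subseteq> U N" using hypballI by (auto simp: S_def e_def)
  define \<kappa> where "\<kappa> = (\<lambda>a. \<integral>b. (cmod (bergK a b))\<^sup>2 \<partial>area_on (U N))"
  have \<kappa>_le: "\<kappa> a \<le> (1 - d) / (1 - (1 - d) * (cmod a)\<^sup>2)\<^sup>2" if a: "a \<in> disk" for a
  proof -
    have int: "integrable (area_on disk) (\<lambda>b. (cmod (bergK a b))\<^sup>2)"
      by (rule integrableI_nonneg) (auto simp: nn_integral_area_disk_norm_bergK[OF a])
    have "\<kappa> a = (\<integral>b. indicator (U N) b *\<^sub>R (cmod (bergK a b))\<^sup>2 \<partial>area_on disk)"
      unfolding \<kappa>_def by (rule integral_area_on[OF hypball_disk]) auto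
    also have "\<dots> \<le> (\<integral>b. indicator {b. (cmod b)\<^sup>2 < 1 - d} b * (cmod (bergK a b))\<^sup>2 \<partial>area_on disk)"
    proof (rule integral_mono)
      show "integrable (area_on disk) (\<lambda>b. indicator (U N) b *\<^sub>R (cmod (bergK a b))\<^sup>2)"
        using int by (rule integrable_mult_indicator[rotated]) simp
      show "integrable (area_on disk) (\<lambda>b. indicator {b. (cmod b)\<^sup>2 < 1 - d} b * (cmod (bergK a b))\<^sup>2)"
        using integrable_mult_indicator[OF _ int, of "{b. (cmod b)\<^sup>2 < 1 - d}"] by simp
      show "indicator (U N) b *\<^sub>R (cmod (bergK a b))\<^sup>2 \<le> indicator {b. (cmod b)\<^sup>2 < 1 - d} b * (cmod (bergK a b))\<^sup>2" for b
        using hypball_w[of b N] by (auto simp: indicator_def d_def e_def)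
    qed
    also have "\<dots> = (1 - d) / (1 - (1 - d) * (cmod a)\<^sup>2)\<^sup>2"
      using d a by (intro integral_area_disk_norm_bergK) auto
    finally show ?thesis .
  qed
  have denom: "1 - (1 - d) * (cmod a)\<^sup>2 = w a + d * (cmod a)\<^sup>2" for a by (simp add: algebra_simps)
  have nonneg: "0 \<le> rho a - \<kappa> a" if a: "a \<in> disk" for a
  proof -
    note wb = w_bounds[OF a]
    have "\<kappa> a \<le> (1 - d) / (w a + d * (cmod a)\<^sup>2)\<^sup>2" using \<kappa>_le[OF a] by (simp only: denom)
    also have "\<dots> \<le> 1 / (w a)\<^sup>2" using wb d by (intro frac_le power_mono) auto
    finally show ?thesis by (simp add: rho_def)
  qed
  have onS: "(1 - 1 / (1 + \<tau>)\<^sup>2) * rho a \<le> rho a - \<kappa> a" if "a \<in> S" for a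
  proof -
    have a: "a \<in> disk" and w8: "w a < 8 * A * e" using that by (auto simp: S_def)
    note wb = w_bounds[OF a]
    have half: "1/2 \<le> (cmod a)\<^sup>2" using w8 e by simp
    have "w a * \<tau> \<le> 8 * A * e * \<tau>" using w8 \<tau>_pos by (intro mult_right_mono) auto
    also have "\<dots> = d / 2" using A_ge by (simp add: \<tau>_def d_def power2_eq_square)
    also have "\<dots> \<le> d * (cmod a)\<^sup>2" using mult_left_mono[OF half, of d] d by simp
    finally have ge: "w a * (1 + \<tau>) \<le> w a + d * (cmod a)\<^sup>2" by (simp add: algebra_simps)
    have p: "0 < w a * (1 + \<tau>)" using wb \<tau>_pos by (intro mult_pos_pos) auto
    have "\<kappa> a \<le> (1 - d) / (w a + d * (cmod a)\<^sup>2)\<^sup>2" using \<kappa>_le[OF a] by (simp only: denom)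
    also have "\<dots> \<le> 1 / (w a * (1 + \<tau>))\<^sup>2" using ge p d by (intro frac_le power_mono zero_less_power) auto
    also have "\<dots> = rho a / (1 + \<tau>)\<^sup>2" by (simp add: rho_def power_mult_distrib)
    finally show ?thesis by (simp add: algebra_simps)
  qed
  define c where "c = e powr (2 * s) / (8 * A * e) ^ 4 * (1 - 1 / (1 + \<tau>)\<^sup>2)"
  have c0: "0 \<le> c" using \<tau>'_pos A_ge e by (auto simp: c_def intro!: mult_nonneg_nonneg divide_nonneg_nonneg)
  have lower: "c * indicator S a \<le> W.h N a * (rho a - \<kappa> a)" for a
  proof (cases "a \<in> S")
    case True
    then have a: "a \<in> disk" "a \<in> U N" and w4: "4 * A * e < w a" and w8: "w a < 8 * A * e" using SU by (auto simp: S_def)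
    note wb = w_bounds[OF a(1)]
    have "e powr s \<le> f N a"
    proof -
      have "e \<le> w a / (4 * A)" using w4 A_ge by (simp add: le_divide_eq mult.commute)
      also have "\<dots> \<le> exp (- dh z a)" by (rule dh_bounds(1)[OF a(1)])
      finally have "e powr s \<le> exp (- dh z a) powr s" using e s by (intro powr_mono2) auto
      then show ?thesis using a(2) by (simp only: f_def exp_powr indicator_simps mult_1_right)
    qed
    then have "(e powr s)\<^sup>2 \<le> (f N a)\<^sup>2" by (intro power_mono) auto
    also have "(e powr s)\<^sup>2 = e powr (2 * s)" by (simp add: power2_eq_square powr_add[symmetric])
    finally have f2: "e powr (2 * s) \<le> (f N a)\<^sup>2" .
    have r: "1 / (8 * A * e)\<^sup>2 \<le> rho a"
      unfolding rho_def using wb w8 by (intro frac_le power_mono) auto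
    have "c = e powr (2 * s) * (1 / (8 * A * e)\<^sup>2) * ((1 - 1 / (1 + \<tau>)\<^sup>2) * (1 / (8 * A * e)\<^sup>2))"
      by (simp add: c_def power4_eq_xxxx power2_eq_square)
    also have "\<dots> \<le> (f N a)\<^sup>2 * rho a * ((1 - 1 / (1 + \<tau>)\<^sup>2) * rho a)"
      using \<tau>'_pos A_ge e by (intro mult_mono f2 r mult_nonneg_nonneg) auto
    also have "\<dots> \<le> W.h N a * (rho a - \<kappa> a)"
      unfolding W.h_def by (intro mult_left_mono onS[OF True]) auto
    finally show ?thesis using True by simp
  next
    case False
    have "0 \<le> W.h N a * (rho a - \<kappa> a)"
    proof (cases "a \<in> U N")
      case True
      then show ?thesis using nonneg[of a] hypball_disk W.h_nonneg by (intro mult_nonneg_nonneg) auto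
    qed (simp add: W.h_zero)
    then show ?thesis using False by simp
  qed
  \<comment> \<open>\<open>w\<close> is uniform on the unit interval under
    \<open>area_on disk\<close>, so the mass of the shell is the length of its range of
    \<open>w\<close>, which stays inside that interval.\<close>
  have area: "measure (area_on (U N)) S = 4 * A * e"
  proof -
    have "emeasure (area_on (U N)) S = emeasure (area_on disk) S"
      using SU hypball_disk[of N] by (simp add: emeasure_area_on Int_absorb1)
    also have "\<dots> = (\<integral>\<^sup>+x. indicator S x \<partial>area_on disk)" by simp
    also have "\<dots> = (\<integral>\<^sup>+x. indicator {4 * A * e<..<8 * A * e} (w x) \<partial>area_on disk)"
      using AE_area_on[OF disk_borel] by (intro nn_integral_cong_AE) (auto elim!: eventually_mono simp: S_def indicator_def)
    also have "\<dots> = (\<integral>\<^sup>+t. indicator {4 * A * e<..<8 * A * e} t * indicator {0..1} t \<partial>lborel)"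
      by (rule nn_integral_area_disk_radial) auto
    also have "\<dots> = (\<integral>\<^sup>+t. indicator {4 * A * e<..<8 * A * e} t \<partial>lborel)"
    proof (intro nn_integral_cong)
      fix t :: real
      have "0 \<le> A * e" using A_ge e by simp
      then have "t \<in> {4 * A * e<..<8 * A * e} \<Longrightarrow> t \<in> {0..1}" using e(3) by auto
      then show "indicator {4 * A * e<..<8 * A * e} t * indicator {0..1} t = (indicator {4 * A * e<..<8 * A * e} t :: ennreal)"
        by (auto simp: indicator_def)
    qed
    also have "\<dots> = ennreal (8 * A * e - 4 * A * e)"
      using A_ge e by simp
    finally show ?thesis using A_ge e by (simp add: measure_def)
  qed
  have "CE * exp ((3 - 2 * s) * N) = c * (4 * A * e)"
  proof -
    have "exp ((3 - 2 * s) * N) = e powr (2 * s - 3)" by (simp add: e_def powr_def algebra_simps)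
    also have "\<dots> = e powr (2 * s) * e / e ^ 4"
    proof -
      have "e powr (2 * s - 3) = e powr (2 * s) / e ^ 3" using e by (simp add: powr_diff powr_numeral)
      then show ?thesis using e by (simp add: power4_eq_xxxx power3_eq_cube)
    qed
    finally have E: "exp ((3 - 2 * s) * N) = e powr (2 * s) * e / e ^ 4" .
    have "T * (4 * A / B) * (p * e / q) = p / (B * q) * T * (4 * A * e)" for T B p q :: real by simp
    then show ?thesis unfolding CE_def c_def E power_mult_distrib[of "8 * A" e] .
  qed
  also have "\<dots> = (\<integral>a. c * indicator S a \<partial>area_on (U N))" by (simp add: area)
  also have "\<dots> \<le> (\<integral>a. W.h N a * (rho a - \<kappa> a) \<partial>area_on (U N))"
  proof (rule integral_mono')
    show "integrable (area_on (U N)) (\<lambda>a. W.h N a * (rho a - \<kappa> a))"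
    proof (rule W.integrable_nu)
      have [measurable]: "\<kappa> \<in> borel_measurable borel"
        unfolding \<kappa>_def by (rule W.A.borel_measurable_lebesgue_integral) measurable
      show "(\<lambda>a. W.h N a * (rho a - \<kappa> a)) \<in> borel_measurable borel" by measurable
      show "\<bar>W.h N a * (rho a - \<kappa> a)\<bar> \<le> W.R N * W.R N" for a
      proof (cases "a \<in> U N")
        case True
        then have a: "a \<in> disk" using hypball_disk by auto
        have "0 \<le> \<kappa> a" unfolding \<kappa>_def by (rule Bochner_Integration.integral_nonneg) simp
        then have "\<bar>rho a - \<kappa> a\<bar> \<le> W.R N" using nonneg[OF a] W.R(2)[OF True] by linarith
        then show ?thesis unfolding abs_mult using W.h_bound W.R(1) by (intro mult_mono) auto
      next
        case False
        then show ?thesis using W.R(1)[of N] by (simp add: W.h_zero)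
      qed
    qed
    show "c * indicator S a \<le> W.h N a * (rho a - \<kappa> a)" for a by (rule lower)
    show "0 \<le> W.h N a * (rho a - \<kappa> a)" for a by (rule order_trans[OF _ lower]) (use c0 in simp)
  qed
  also have "\<dots> \<le> (\<integral>X. W.Q N X \<partial>P)" unfolding \<kappa>_def by (rule W.Q_expectation_ge)
  finally show ?thesis .
qed

section \<open>Almost sure convergence\<close>

lemma normalized_variance_le:
  assumes N: "0 \<le> N" and N0: "16 * A * exp (- N) \<le> 1"
  shows "(\<integral>\<^sup>+X. ennreal ((W.Q N X / (\<integral>Y. W.Q N Y \<partial>P) - 1)\<^sup>2) \<partial>P) \<le> ennreal (438 * CJ / CE\<^sup>2 * exp ((s - 3/2) * N))"
proof -
  let ?E = "\<integral>Y. W.Q N Y \<partial>P"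
  have ge: "CE * exp ((3 - 2 * s) * N) \<le> ?E" by (rule expectation_ge[OF N N0])
  have pos: "0 < CE * exp ((3 - 2 * s) * N)" using CE_pos by simp
  have E0: "0 < ?E" using ge pos by linarith
  have CJ0: "0 \<le> CJ" by (simp add: CJ_def)
  have [measurable]: "W.Q N \<in> borel_measurable P" using W.Q_expectation(1) by (rule borel_measurable_integrable)
  have "(\<integral>\<^sup>+X. ennreal ((W.Q N X / ?E - 1)\<^sup>2) \<partial>P) = (\<integral>\<^sup>+X. ennreal (1 / ?E\<^sup>2) * ennreal ((W.Q N X - ?E)\<^sup>2) \<partial>P)"
  proof (intro nn_integral_cong)
    fix X
    have "W.Q N X / ?E - 1 = (W.Q N X - ?E) / ?E" using E0 by (simp add: diff_divide_distrib)
    then show "ennreal ((W.Q N X / ?E - 1)\<^sup>2) = ennreal (1 / ?E\<^sup>2) * ennreal ((W.Q N X - ?E)\<^sup>2)"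
      by (subst ennreal_mult[symmetric]) (auto simp: power_divide)
  qed
  also have "\<dots> = ennreal (1 / ?E\<^sup>2) * (\<integral>\<^sup>+X. ennreal ((W.Q N X - ?E)\<^sup>2) \<partial>P)"
    by (rule nn_integral_cmult) measurable
  also have "\<dots> \<le> ennreal (1 / ?E\<^sup>2) * ennreal (438 * (CJ * exp ((9/2 - 3 * s) * N)))"
    by (intro mult_left_mono W.Q_variance) simp
  also have "\<dots> = ennreal (438 * (CJ * exp ((9/2 - 3 * s) * N)) / ?E\<^sup>2)"
    using CJ0 by (subst ennreal_mult[symmetric]) auto
  also have "\<dots> \<le> ennreal (438 * (CJ * exp ((9/2 - 3 * s) * N)) / (CE * exp ((3 - 2 * s) * N))\<^sup>2)"
    using ge pos CJ0 CE_pos by (intro ennreal_leI divide_left_mono power_mono mult_pos_pos zero_less_power E0) auto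
  also have "438 * (CJ * exp ((9/2 - 3 * s) * N)) / (CE * exp ((3 - 2 * s) * N))\<^sup>2 = 438 * CJ / CE\<^sup>2 * exp ((s - 3/2) * N)"
  proof -
    have "exp ((9/2 - 3 * s) * N) = exp ((s - 3/2) * N) * (exp ((3 - 2 * s) * N))\<^sup>2"
      unfolding power2_eq_square exp_add[symmetric] by (rule arg_cong[where f = exp]) (simp add: algebra_simps)
    then show ?thesis by (simp add: power_mult_distrib)
  qed
  finally show ?thesis .
qed

text \<open>The squared relative deviations have geometrically decaying means along the integers. By
  monotone convergence their sum has finite mean, so it is finite almost surely and its terms tend
  to 0.\<close>

lemma norm_ratio_tendsto:
  "AE X in P. (\<lambda>N::nat. A2_norm_sq (Theta s z (real N) X) / (\<integral>Y. A2_norm_sq (Theta s z (real N) Y) \<partial>P)) \<longlonglongrightarrow> 1"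
proof -
  define Z where "Z = (\<lambda>(n::nat) X. (W.Q n X / (\<integral>Y. W.Q n Y \<partial>P) - 1)\<^sup>2)"
  define q where "q = exp (s - 3/2)"
  have q: "0 \<le> q" "q < 1" using s by (auto simp: q_def)
  define C where "C = 438 * CJ / CE\<^sup>2"
  have C0: "0 \<le> C" by (simp add: C_def CJ_def)
  have "(\<lambda>n. 16 * A * exp (- real n)) \<longlonglongrightarrow> 16 * A * 0"
    by (intro tendsto_mult tendsto_const filterlim_compose[OF exp_at_bot] filterlim_compose[OF filterlim_uminus_at_bot_at_top] filterlim_real_sequentially)
  then have "eventually (\<lambda>n. 16 * A * exp (- real n) < 1) sequentially"
    by (intro order_tendstoD) auto
  \<comment> \<open>The lower bound on the expectation holds only once the shell fits into the half
    of the unit interval near 0; the finitely many earlier \<open>n\<close> do not affect the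
    limit.\<close>
  then obtain n0 where n0: "\<And>n. n \<ge> n0 \<Longrightarrow> 16 * A * exp (- real n) < 1" unfolding eventually_sequentially by blast
  have Zm [measurable]: "Z n \<in> borel_measurable P" for n
  proof -
    have [measurable]: "W.Q n \<in> borel_measurable P" using W.Q_expectation(1) by (rule borel_measurable_integrable)
    show ?thesis unfolding Z_def by measurable
  qed
  have Zle: "(\<integral>\<^sup>+X. ennreal (Z (n + n0) X) \<partial>P) \<le> ennreal (C * q ^ (n + n0))" for n
  proof -
    have "q ^ (n + n0) = exp ((s - 3/2) * real (n + n0))" unfolding q_def by (simp only: exp_of_nat_mult[symmetric] mult.commute)
    then show ?thesis unfolding Z_def C_def
      using normalized_variance_le[of "real (n + n0)"] n0[of "n + n0"] by simp
  qed
  have "(\<integral>\<^sup>+X. (\<Sum>n. ennreal (Z (n + n0) X)) \<partial>P) = (\<Sum>n. \<integral>\<^sup>+X. ennreal (Z (n + n0) X) \<partial>P)"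
    by (rule nn_integral_suminf) measurable
  also have "\<dots> \<le> (\<Sum>n. ennreal (C * q ^ (n + n0)))" by (intro suminf_le Zle) auto
  also have "\<dots> < top"
  proof -
    have "summable (\<lambda>n. C * q ^ (n + n0))"
      using q by (intro summable_mult summable_ignore_initial_segment summable_geometric) auto
    then show ?thesis using C0 q by (subst suminf_ennreal2) auto
  qed
  finally have AEf: "AE X in P. (\<Sum>n. ennreal (Z (n + n0) X)) \<noteq> \<infinity>"
    by (intro nn_integral_PInf_AE) auto
  have sp: "space P = Conf" using DPP by (intro Conf_space_props) (simp add: is_DPP_K_def)
  have EQ: "(\<integral>Y. A2_norm_sq (Theta s z (real N) Y) \<partial>P) = (\<integral>Y. W.Q N Y \<partial>P)" for N :: nat
    by (intro Bochner_Integration.integral_cong refl) (simp add: Q_eq_norm sp)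
  show ?thesis
    using AEf AE_space
  proof eventually_elim
    case (elim X)
    then have X: "X \<in> Conf" by (simp add: sp)
    have "summable (\<lambda>n. Z (n + n0) X)"
      using elim(1) by (intro summable_suminf_not_top) (auto simp: Z_def)
    then have "(\<lambda>n. Z (n + n0) X) \<longlonglongrightarrow> 0" by (rule summable_LIMSEQ_zero)
    then have "(\<lambda>n. Z n X) \<longlonglongrightarrow> 0" by (rule LIMSEQ_offset)
    then have "(\<lambda>n. sqrt (Z n X)) \<longlonglongrightarrow> sqrt 0" by (rule tendsto_real_sqrt)
    then have "(\<lambda>n. \<bar>W.Q n X / (\<integral>Y. W.Q n Y \<partial>P) - 1\<bar>) \<longlonglongrightarrow> 0" by (simp add: Z_def)
    then have "(\<lambda>n. W.Q n X / (\<integral>Y. W.Q n Y \<partial>P) - 1) \<longlonglongrightarrow> 0" by (rule tendsto_rabs_zero_cancel)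
    then have "(\<lambda>n. W.Q n X / (\<integral>Y. W.Q n Y \<partial>P)) \<longlonglongrightarrow> 1" by (simp add: LIM_zero_iff)
    then show ?case by (simp add: EQ Q_eq_norm[OF X])
  qed
qed

end

theorem theorem1p2:
  fixes s :: real and z :: complex and P :: "complex set measure"
  assumes "1 < s" and "s < 3/2" and "z \<in> disk" and "is_DPP_K P"
  shows "AE X in P.
    (\<lambda>N::nat. A2_norm_sq (Theta s z (real N) X) /
              (\<integral> Y. A2_norm_sq (Theta s z (real N) Y) \<partial>P)) \<longlonglongrightarrow> 1"
proof -
  interpret hyperbolic_statistic s z P by standard (fact assms)+
  show ?thesis by (rule norm_ratio_tendsto)
qed

end
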